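(* Let $k,\ell\geq1$ be integers and let $u,v:\{1,\dots,k\}\to\{1,\dots,\ell\}$ be maps such that $\{u(i),v(i)\}\neq\{u(j),v(j)\}$ for $i\neq j$, and such that for each $i\leq k$, one of the numbers $u(i)$ and $v(i)$ does not occur in the set $\{u(i+1),\dots,u(k),v(i+1),\dots,v(k)\}$. Let $P(\mathbf{x}):=\prod_{i=1}^{k}(x_{u(i)}^2+x_{v(i)}^2)\in\mathbb{Z}[x_1,\dots,x_\ell]$. Then there exists a constant $C>0$ depending only on $k$ and $\ell$ such that, for real $Q>1$, \[\sum_{\mathbf{q}\sim Q}\mu^2(P(\mathbf{q}))\,\Lambda(q_{u(1)}^2+q_{v(1)}^2)\cdots\Lambda(q_{u(k)}^2+q_{v(k)}^2)\gg_{k,\ell}\frac{Q^{\ell}}{(\log Q)^{C}}.\]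
   Context: $\Lambda$ is the von Mangoldt function and $\mu$ the Möbius function. The notation $\mathbf{q}\sim Q$ means $\mathbf{q}=(q_1,\dots,q_\ell)\in\mathbb{Z}^\ell$ with $Q<q_i\leq 2Q$ for all $i=1,\dots,\ell$. $f\gg_{k,\ell} g$ means $f\geq c\,g$ for some constant $c>0$ depending only on $k$ and $\ell$.
   Formalization: It is additionally assumed that u(i)≠v(i) for all i (otherwise P(q) is never squarefree and the sum is 0), and the bound is asserted for Q≥Q_0 with Q_0>1 depending only on k and ℓ, instead of all Q>1 (for 1<Q<3/2 the sum is 0). *)

theory Defs
  imports "HOL-Analysis.Analysis" "HOL-Number_Theory.Number_Theory" "HOL-Computational_Algebra.Squarefree"
begin

definition moebius_mu :: "nat \<Rightarrow> int" where
  "moebius_mu n = (if n = 0 \<or> \<not> squarefree n then 0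
                   else (-1) ^ card (prime_factors n))"

end

theory Submission
  imports Defs "HOL-Complex_Analysis.Complex_Analysis" "HOL-Probability.Sinc_Integral" "HOL-Real_Asymp.Real_Asymp"
begin

text \<open>
  The edges \<open>{u i, v i}\<close> form a forest, ordered so that each edge has an endpoint missing from the
  later ones. Hence it suffices to know that the graph on the integers of \<open>(Q, 2Q]\<close> which joins \<open>a\<close>
  and \<open>b\<close> if \<open>a\<^sup>2 + b\<^sup>2\<close> is prime has \<open>\<gg> Q\<^sup>2 / log Q\<close> edges: a nonempty subgraph of minimum degree
  \<open>\<gg> Q / log Q\<close> then exists, and the forest is embedded edge by edge, with a bounded number of
  choices excluded at each step to keep the primes distinct.

  The edge count is a count of Gaussian primes in a box. It follows from the Hecke \<open>L\<close>-series of the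
  characters \<open>(z/|z|)\<^bsup>4m\<^esup>\<close>. Such a series is continued by comparing the lattice \<open>\<int>[i]\<close> with its
  sublattices \<open>(c + i)\<int>[i]\<close>; it does not vanish on \<open>Re s = 1\<close> by the inequality
  \<open>3 + 4 cos \<theta> + cos 2\<theta> \<ge> 0\<close>. The primes are then detected by a band-limited function of \<open>(log |z|\<^sup>2, arg z)\<close>
  that is positive only inside the box and has positive mean: the pole at \<open>s = 1\<close>
  contributes this mean and the Riemann-Lebesgue lemma removes everything else.
\<close>

section \<open>Arithmetic of the Gaussian integers\<close>

text \<open>Only a lower bound of the right order up to logarithms is wanted, so no asymptotic for
  the sum itself is attempted. A subgraph of large minimum degree may have as few as about Q / log Q
  vertices; this costs l of the k + l logarithms, and the edge densities cost the other k.

  The detection of primes follows the mechanism of the Wiener-Ikehara theorem: a band-limited test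
  function sees only a bounded segment of Re s = 1, so continuity of the logarithmic derivative up
  to that line, apart from the pole, is enough, and no growth bound or zero-free region enters. Its
  price is that such a function cannot vanish outside the box; it is only required to be nonpositive
  there, which still gives a lower bound.

  For the same reason the continuation need not reach far. The lattice comparison is the analogue of
  the factor 1 - 2^(1-s) for the Riemann zeta function and replaces theta functions and functional
  equations. Each multiplier has zeros on Re s = 1, hence a family of sublattices is used and the
  quotients are glued.\<close>

definition GI :: "complex set" where
  "GI = {z. Re z \<in> \<int> \<and> Im z \<in> \<int>}"

definition gdvd :: "complex \<Rightarrow> complex \<Rightarrow> bool" where
  "gdvd d z \<longleftrightarrow> (\<exists>w\<in>GI. z = d * w)"

definition gunit :: "complex \<Rightarrow> bool" where
  "gunit e \<longleftrightarrow> e \<in> GI \<and> cmod e = 1"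

definition girr :: "complex \<Rightarrow> bool" where
  "girr p \<longleftrightarrow> p \<in> GI \<and> cmod p > 1 \<and>
     (\<forall>a\<in>GI. \<forall>b\<in>GI. p = a * b \<longrightarrow> cmod a = 1 \<or> cmod b = 1)"

lemma GI_closed [simp, intro]:
  "0 \<in> GI" "1 \<in> GI" "\<i> \<in> GI" "of_int k \<in> GI" "of_nat n \<in> GI"
  "a \<in> GI \<Longrightarrow> b \<in> GI \<Longrightarrow> a + b \<in> GI"
  "a \<in> GI \<Longrightarrow> b \<in> GI \<Longrightarrow> a - b \<in> GI"
  "a \<in> GI \<Longrightarrow> b \<in> GI \<Longrightarrow> a * b \<in> GI"
  "a \<in> GI \<Longrightarrow> - a \<in> GI"
  "a \<in> GI \<Longrightarrow> cnj a \<in> GI"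
  by (auto simp: GI_def)

lemma GI_power [simp, intro]: "a \<in> GI \<Longrightarrow> a ^ n \<in> GI"
  by (induction n) auto

lemma GI_Complex: "z \<in> GI \<longleftrightarrow> (\<exists>a b :: int. z = Complex (of_int a) (of_int b))"
  by (auto simp: GI_def Ints_def complex_eq_iff)

lemma GI_cmod_square_nat: assumes "z \<in> GI" shows "\<exists>n::nat. (cmod z)\<^sup>2 = real n"
proof -
  obtain a b where z: "z = Complex (of_int a) (of_int b)" using assms GI_Complex by auto
  have "(cmod z)\<^sup>2 = real (nat (a\<^sup>2 + b\<^sup>2))"
    by (simp add: z cmod_power2 del: of_nat_nat) simp
  then show ?thesis by blast
qed

lemma GI_cmod_square_floor: "z \<in> GI \<Longrightarrow> real (nat \<lfloor>(cmod z)\<^sup>2\<rfloor>) = (cmod z)\<^sup>2"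
  using GI_cmod_square_nat by (metis floor_of_nat nat_int)

lemma GI_cmod_ge_1: assumes "z \<in> GI" "z \<noteq> 0" shows "cmod z \<ge> 1"
proof -
  obtain n::nat where n: "(cmod z)\<^sup>2 = real n" using GI_cmod_square_nat assms by blast
  with assms have "n \<noteq> 0" by (metis norm_eq_zero of_nat_0 zero_eq_power2)
  then have "real n \<ge> 1" by simp
  with n have "(cmod z)\<^sup>2 \<ge> 1\<^sup>2" by simp
  then show ?thesis by (rule power2_le_imp_le) auto
qed

lemma gunit_iff: "gunit e \<longleftrightarrow> e \<in> {1, -1, \<i>, -\<i>}"
proof
  assume "gunit e"
  then obtain a b where e: "e = Complex (of_int a) (of_int b)" and n: "cmod e = 1"
    unfolding gunit_def GI_Complex by auto
  have "real_of_int (a\<^sup>2 + b\<^sup>2) = (cmod e)\<^sup>2" by (simp add: e cmod_power2)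
  also have "\<dots> = real_of_int 1" using n by simp
  finally have ab: "a\<^sup>2 + b\<^sup>2 = 1" by linarith
  have "\<bar>a\<bar> \<le> 1" "\<bar>b\<bar> \<le> 1"
    unfolding abs_square_le_1[symmetric] using ab zero_le_power2[of a] zero_le_power2[of b] by linarith+
  then have "a \<in> {-1,0,1}" "b \<in> {-1,0,1}" by auto
  then show "e \<in> {1, -1, \<i>, -\<i>}" using ab by (auto simp: e complex_eq_iff)
qed (auto simp: gunit_def)

lemma gunit_cnj: "gunit e \<Longrightarrow> e * cnj e = 1" "gunit e \<Longrightarrow> gunit (cnj e)"
  by (auto simp: gunit_iff)

lemma gunit_cancel: assumes "gunit e" shows "cnj e * (e * x) = x" "e * (cnj e * x) = x"
proof -
  have "cnj e * (e * x) = (e * cnj e) * x" "e * (cnj e * x) = (e * cnj e) * x" by (simp_all only: mult_ac)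
  then show "cnj e * (e * x) = x" "e * (cnj e * x) = x" by (simp_all only: gunit_cnj(1)[OF assms] mult_1)
qed

lemma gunit_mult: "gunit e \<Longrightarrow> gunit f \<Longrightarrow> gunit (e * f)"
  by (auto simp: gunit_iff)

lemma card_gunit: "card {e. gunit e} = 4"
proof -
  have "{e. gunit e} = {1, -1, \<i>, -\<i>}" using gunit_iff by blast
  also have "card \<dots> = 4"
    by (subst card_insert_disjoint; simp add: complex_eq_iff)+
  finally show ?thesis .
qed

lemma gdvd_trans: "gdvd a b \<Longrightarrow> gdvd b c \<Longrightarrow> gdvd a c"
  unfolding gdvd_def by (metis GI_closed(8) mult.assoc)

lemma gdvd_mult: "gdvd a b \<Longrightarrow> c \<in> GI \<Longrightarrow> gdvd a (c * b)"
  unfolding gdvd_def by (metis GI_closed(8) mult.left_commute)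

section \<open>Euclidean division and irreducible elements\<close>

lemma GI_division:
  assumes "a \<in> GI" "b \<in> GI" "b \<noteq> 0"
  shows "\<exists>q\<in>GI. cmod (a - q * b) < cmod b"
proof -
  define w where "w = a / b"
  define q where "q = Complex (of_int (round (Re w))) (of_int (round (Im w)))"
  have "q \<in> GI" by (auto simp: q_def GI_def)
  have 1: "(Re w - of_int (round (Re w)))\<^sup>2 \<le> (1/2)\<^sup>2" "(Im w - of_int (round (Im w)))\<^sup>2 \<le> (1/2)\<^sup>2"
    by (rule abs_le_square_iff[THEN iffD1], use of_int_round_abs_le[of "Re w"] of_int_round_abs_le[of "Im w"] in \<open>simp add: abs_minus_commute\<close>)+
  have "(cmod (w - q))\<^sup>2 < 1\<^sup>2" unfolding cmod_power2 q_def using 1 by (simp add: power2_eq_square)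
  then have "cmod (w - q) < 1" by (rule power2_less_imp_less) auto
  moreover have "a - q * b = (w - q) * b" using assms by (simp add: w_def algebra_simps)
  ultimately have "cmod (a - q * b) < cmod b" using assms by (simp add: norm_mult)
  then show ?thesis using \<open>q \<in> GI\<close> by blast
qed

text \<open>The norm is a natural number, so among the nonzero combinations of a and b there is one
  of least norm; division with remainder shows that it divides every combination.\<close>

lemma GI_bezout:
  assumes "a \<in> GI" "b \<in> GI" "b \<noteq> 0"
  shows "\<exists>x\<in>GI. \<exists>y\<in>GI. gdvd (x * a + y * b) a \<and> gdvd (x * a + y * b) b"
proof -
  define S where "S = {x * a + y * b | x y. x \<in> GI \<and> y \<in> GI} - {0}"
  define f where "f z = nat \<lfloor>(cmod z)\<^sup>2\<rfloor>" for z
  have f: "real (f z) = (cmod z)\<^sup>2" if "z \<in> GI" for z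
    using GI_cmod_square_floor[OF that] by (simp add: f_def)
  have SGI: "S \<subseteq> GI" using assms by (auto simp: S_def)
  have "\<exists>x y. b = x * a + y * b \<and> x \<in> GI \<and> y \<in> GI" by (rule exI[of _ 0], rule exI[of _ 1]) simp
  then have "b \<in> S" using assms unfolding S_def by blast
  then obtain g where g: "g \<in> S" "\<And>h. h \<in> S \<Longrightarrow> f g \<le> f h"
    using exists_least_iff[of "\<lambda>n. \<exists>g\<in>S. f g = n"] by (metis not_less)
  have div: "gdvd g c" if c: "\<exists>x\<in>GI. \<exists>y\<in>GI. c = x * a + y * b" for c
  proof -
    have cG: "c \<in> GI" using c assms by auto
    have gG: "g \<in> GI" "g \<noteq> 0" using g SGI by (auto simp: S_def)
    obtain q where q: "q \<in> GI" "cmod (c - q * g) < cmod g" using GI_division[OF cG gG] by blast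
    obtain x y where xy: "x \<in> GI" "y \<in> GI" "c = x * a + y * b" using c by auto
    obtain x' y' where xy': "x' \<in> GI" "y' \<in> GI" "g = x' * a + y' * b" using g by (auto simp: S_def)
    have e: "c - q * g = (x - q * x') * a + (y - q * y') * b" using xy xy' by (simp add: algebra_simps)
    have "c - q * g = 0"
    proof (rule ccontr)
      assume "c - q * g \<noteq> 0"
      then have "c - q * g \<in> S" unfolding S_def e using xy xy' q by auto
      then have "real (f g) \<le> real (f (c - q * g))" using g by simp
      then have "(cmod g)\<^sup>2 \<le> (cmod (c - q * g))\<^sup>2" using f gG cG q by simp
      then show False using q by (simp add: abs_le_square_iff[symmetric])
    qed
    then show ?thesis using q by (auto simp: gdvd_def mult.commute intro!: bexI[of _ q])
  qed
  obtain x y where "x \<in> GI" "y \<in> GI" "g = x * a + y * b" using g by (auto simp: S_def)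
  moreover have "gdvd g a" by (rule div) (rule bexI[of _ 1], rule bexI[of _ 0], auto)
  moreover have "gdvd g b" by (rule div) (rule bexI[of _ 0], rule bexI[of _ 1], auto)
  ultimately show ?thesis by blast
qed

text \<open>A common divisor x a + y p of a and p is, by irreducibility of p, an associate of p or a
  unit. In the first case p divides a; in the second case, multiplying by b shows that p divides
  b.\<close>

lemma girr_prime:
  assumes p: "girr p" and ab: "a \<in> GI" "b \<in> GI" "gdvd p (a * b)"
  shows "gdvd p a \<or> gdvd p b"
proof (rule ccontr)
  assume n: "\<not> (gdvd p a \<or> gdvd p b)"
  have pG: "p \<in> GI" "p \<noteq> 0" using p by (auto simp: girr_def)
  obtain x y where xy: "x \<in> GI" "y \<in> GI" "gdvd (x * a + y * p) a" "gdvd (x * a + y * p) p"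
    using GI_bezout[OF ab(1) pG] by blast
  define g where "g = x * a + y * p"
  have gG: "g \<in> GI" using xy ab pG by (auto simp: g_def)
  obtain h where h: "h \<in> GI" "p = g * h" using xy unfolding g_def[symmetric] gdvd_def by auto
  have "cmod g = 1 \<or> cmod h = 1" using p h gG by (auto simp: girr_def)
  then show False
  proof
    assume "cmod h = 1"
    then have hu: "gunit h" using h by (auto simp: gunit_def)
    have "g = p * cnj h" using h gunit_cnj[OF hu] by (simp add: mult.assoc)
    then have "gdvd p g" unfolding gdvd_def using h by auto
    then have "gdvd p a" using xy gdvd_trans unfolding g_def by blast
    then show False using n by blast
  next
    assume "cmod g = 1"
    then have gu: "gunit g" using gG by (auto simp: gunit_def)
    obtain w where w: "w \<in> GI" "a * b = p * w" using ab by (auto simp: gdvd_def)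
    have "b = cnj g * (g * b)" using gunit_cancel[OF gu] by simp
    also have "g * b = p * (x * w + y * b)" unfolding g_def using w by (simp add: algebra_simps)
    finally have "b = p * (cnj g * (x * w + y * b))" by (simp add: algebra_simps)
    then have "gdvd p b" unfolding gdvd_def using gG xy w ab by blast
    then show False using n by blast
  qed
qed

lemma GI_norm_induct [consumes 1, case_names less]:
  assumes "z \<in> GI" "\<And>z. z \<in> GI \<Longrightarrow> (\<And>w. w \<in> GI \<Longrightarrow> cmod w < cmod z \<Longrightarrow> P w) \<Longrightarrow> P z"
  shows "P z"
proof -
  define f where "f z = nat \<lfloor>(cmod z)\<^sup>2\<rfloor>" for z
  have f: "real (f z) = (cmod z)\<^sup>2" if "z \<in> GI" for z
    using GI_cmod_square_floor[OF that] by (simp add: f_def)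
  show ?thesis using assms(1)
  proof (induction "f z" arbitrary: z rule: less_induct)
    case less
    show ?case
    proof (rule assms(2)[OF less.prems])
      fix w assume w: "w \<in> GI" "cmod w < cmod z"
      then have "(cmod w)\<^sup>2 < (cmod z)\<^sup>2" by (simp add: power_strict_mono)
      then have "real (f w) < real (f z)" using f w less.prems by simp
      then show "P w" using less.hyps w by auto
    qed
  qed
qed

lemma girr_divisor_exists:
  assumes "z \<in> GI" "cmod z > 1" shows "\<exists>p. girr p \<and> gdvd p z"
  using assms
proof (induction z rule: GI_norm_induct)
  case (less z)
  show ?case
  proof (cases "girr z")
    case True
    then show ?thesis by (auto simp: gdvd_def intro!: exI[of _ z] bexI[of _ 1])
  next
    case False
    then obtain a b where ab: "a \<in> GI" "b \<in> GI" "z = a * b" "cmod a \<noteq> 1" "cmod b \<noteq> 1"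
      using less by (auto simp: girr_def)
    have "a \<noteq> 0" "b \<noteq> 0" using ab less by auto
    then have "cmod a > 1 \<and> cmod b > 1" using GI_cmod_ge_1[of a] GI_cmod_ge_1[of b] ab by linarith
    moreover have "cmod a > 0" using \<open>a \<noteq> 0\<close> by simp
    ultimately have "cmod a < cmod z" using ab by (simp add: norm_mult)
    then obtain p where "girr p" "gdvd p a" using less.IH[of a] ab \<open>cmod a > 1 \<and> cmod b > 1\<close> by blast
    then show ?thesis using ab gdvd_mult[of p a b] by (auto simp: mult.commute)
  qed
qed

lemma girr_dvd_power: "girr p \<Longrightarrow> a \<in> GI \<Longrightarrow> gdvd p (a ^ n) \<Longrightarrow> gdvd p a"
proof (induction n)
  case 0
  then obtain w where w: "w \<in> GI" "1 = p * w" by (auto simp: gdvd_def)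
  then have "w \<noteq> 0" by auto
  then have "cmod w \<ge> 1" using GI_cmod_ge_1 w by auto
  moreover have "1 = cmod p * cmod w" using arg_cong[OF w(2), of cmod] by (simp add: norm_mult)
  moreover have "cmod p > 1" using 0 by (simp add: girr_def)
  ultimately show ?case using mult_left_mono[of 1 "cmod w" "cmod p"] by simp
next
  case (Suc n)
  then have "gdvd p (a * a ^ n)" by simp
  then show ?case using girr_prime[of p a "a ^ n"] Suc by blast
qed

lemma girr_dvd_girr:
  assumes "girr p" "girr q" "gdvd p q" shows "\<exists>e. gunit e \<and> q = p * e"
proof -
  obtain w where w: "w \<in> GI" "q = p * w" using assms by (auto simp: gdvd_def)
  then have "cmod w = 1" using assms unfolding girr_def by (metis less_irrefl)
  then show ?thesis using w by (auto simp: gunit_def)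
qed

section \<open>The von Mangoldt function of the Gaussian integers\<close>

definition gprimepow :: "complex \<Rightarrow> nat \<Rightarrow> complex \<Rightarrow> bool" where
  "gprimepow p j z \<longleftrightarrow> girr p \<and> 0 < j \<and> (\<exists>e. gunit e \<and> z = e * p ^ j)"

text \<open>The chosen prime matters only through its absolute value, which
  \<open>gprimepow_unique\<close> makes unambiguous. All four associates of z receive the same
  value.\<close>

definition gmangoldt :: "complex \<Rightarrow> real" where
  "gmangoldt z = (if \<exists>p j. gprimepow p j z
     then ln ((cmod (SOME p. \<exists>j. gprimepow p j z))\<^sup>2) else 0)"

lemma gprimepow_unique:
  assumes "gprimepow p j z" "gprimepow q k z"
  shows "\<exists>e. gunit e \<and> q = p * e"
proof -
  obtain e f where ef: "gunit e" "gunit f" "z = e * p ^ j" "z = f * q ^ k"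
    using assms by (auto simp: gprimepow_def)
  have pq: "girr p" "girr q" "j > 0" using assms by (auto simp: gprimepow_def)
  have "q ^ k = cnj f * (f * q ^ k)" by (simp only: gunit_cancel[OF ef(2)])
  also have "f * q ^ k = e * p ^ j" using ef by simp
  also have "p ^ j = p * p ^ (j - 1)" using pq by (cases j) auto
  finally have "q ^ k = p * (cnj f * e * p ^ (j - 1))" by (simp only: mult_ac)
  moreover have "cnj f * e * p ^ (j - 1) \<in> GI" using ef pq by (auto simp: gunit_def girr_def)
  ultimately have "gdvd p (q ^ k)" unfolding gdvd_def by blast
  moreover have "q \<in> GI" using pq by (simp add: girr_def)
  ultimately have "gdvd p q" using girr_dvd_power pq by blast
  then show ?thesis using girr_dvd_girr pq by blast
qed

lemma gmangoldt_primepow: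
  assumes "gprimepow p j z" shows "gmangoldt z = ln ((cmod p)\<^sup>2)"
proof -
  define q where "q = (SOME p. \<exists>j. gprimepow p j z)"
  have "\<exists>j. gprimepow q j z" unfolding q_def by (rule someI[of _ p]) (use assms in blast)
  then obtain k where "gprimepow q k z" by blast
  from gprimepow_unique[OF assms this] have "cmod q = cmod p" by (auto simp: gunit_def norm_mult)
  then show ?thesis unfolding gmangoldt_def q_def[symmetric] using assms by auto
qed

lemma gmangoldt_bounds:
  assumes "z \<in> GI" "z \<noteq> 0"
  shows "0 \<le> gmangoldt z" "gmangoldt z \<le> ln ((cmod z)\<^sup>2)"
proof -
  have 1: "0 \<le> gmangoldt z \<and> gmangoldt z \<le> ln ((cmod z)\<^sup>2)"
  proof (cases "\<exists>p j. gprimepow p j z")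
    case True
    then obtain p j where pj: "gprimepow p j z" by blast
    then have p: "cmod p > 1" "j > 0" "cmod z = cmod p ^ j"
      by (auto simp: gprimepow_def girr_def gunit_def norm_mult norm_power)
    have "cmod p ^ 1 \<le> cmod p ^ j" using p by (intro power_increasing) auto
    then have "cmod p \<le> cmod z" using p by simp
    then have "(cmod p)\<^sup>2 \<le> (cmod z)\<^sup>2" by (simp add: power_mono)
    moreover have "(cmod p)\<^sup>2 > 1" using p by (simp add: one_less_power)
    ultimately show ?thesis unfolding gmangoldt_primepow[OF pj] by (auto simp del: ln_le_cancel_iff intro!: ln_mono)
  next
    case False
    then show ?thesis using GI_cmod_ge_1[OF assms] by (auto simp: gmangoldt_def)
  qed
  then show "0 \<le> gmangoldt z" "gmangoldt z \<le> ln ((cmod z)\<^sup>2)" by auto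
qed

lemma GI_cball_subset:
  "{z \<in> GI. cmod z \<le> r} \<subseteq> (\<lambda>(a,b). Complex (of_int a) (of_int b)) ` ({-\<lceil>r\<rceil>..\<lceil>r\<rceil>} \<times> {-\<lceil>r\<rceil>..\<lceil>r\<rceil>})"
proof
  fix z assume z: "z \<in> {z \<in> GI. cmod z \<le> r}"
  then obtain a b where ab: "z = Complex (of_int a) (of_int b)" using GI_Complex by auto
  have "\<bar>of_int a\<bar> \<le> r" "\<bar>of_int b\<bar> \<le> r" using z abs_Re_le_cmod[of z] abs_Im_le_cmod[of z] by (simp_all add: ab)
  then have "\<bar>a\<bar> \<le> \<lceil>r\<rceil>" "\<bar>b\<bar> \<le> \<lceil>r\<rceil>" by linarith+
  then show "z \<in> (\<lambda>(a,b). Complex (of_int a) (of_int b)) ` ({-\<lceil>r\<rceil>..\<lceil>r\<rceil>} \<times> {-\<lceil>r\<rceil>..\<lceil>r\<rceil>})"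
    using ab by (intro rev_image_eqI[of "(a, b)"]) auto
qed

lemma finite_GI_cball: "finite {z \<in> GI. cmod z \<le> r}"
  by (rule finite_subset[OF GI_cball_subset]) auto

definition gdivs :: "complex \<Rightarrow> complex set" where
  "gdivs z = {d \<in> GI. gdvd d z}"

lemma gdvd_cmod_le: assumes "gdvd d z" "z \<noteq> 0" shows "cmod d \<le> cmod z"
proof -
  obtain w where w: "w \<in> GI" "z = d * w" using assms by (auto simp: gdvd_def)
  then have "cmod w \<ge> 1" using GI_cmod_ge_1 assms by auto
  then show ?thesis using w by (simp add: norm_mult mult_le_cancel_left1)
qed

lemma finite_gdivs: "z \<noteq> 0 \<Longrightarrow> finite (gdivs z)"
  by (rule finite_subset[OF _ finite_GI_cball[of "cmod z"]]) (auto simp: gdivs_def gdvd_cmod_le)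

lemma gprimepow_dvd_other:
  assumes "girr p" "girr q" "\<not> gdvd p q" "w \<in> GI" "gdvd (q ^ j) (p * w)"
  shows "gdvd (q ^ j) w"
proof -
  obtain x where x: "x \<in> GI" "p * w = q ^ j * x" using assms by (auto simp: gdvd_def)
  have qG: "q \<in> GI" "p \<noteq> 0" using assms by (auto simp: girr_def)
  have "gdvd p (q ^ j * x)" using x assms by (metis gdvd_def)
  then have "gdvd p x" using girr_prime[of p "q ^ j" x] girr_dvd_power[of p q j] assms x qG by blast
  then obtain y where y: "y \<in> GI" "x = p * y" by (auto simp: gdvd_def)
  have "w = q ^ j * y" using x y qG by simp
  then show ?thesis using y by (auto simp: gdvd_def)
qed

text \<open>Split off a prime: let z = p w and let p^v be the exact power of p in w. The divisors of
  z that do not divide w and carry weight are the four associates of p^(v+1), collected in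
  \<open>D\<close>. Together they add 4 ln |p|^2, and induction on the norm applies to w.\<close>

theorem gmangoldt_sum:
  assumes "z \<in> GI" "z \<noteq> 0"
  shows "(\<Sum>d\<in>gdivs z. gmangoldt d) = 4 * ln ((cmod z)\<^sup>2)"
  using assms
proof (induction z rule: GI_norm_induct)
  case (less z)
  have ge: "cmod z \<ge> 1" using less GI_cmod_ge_1 by auto
  show ?case
  proof (cases "cmod z = 1")
    case True
    have "gmangoldt d = 0" if d: "d \<in> gdivs z" for d
    proof -
      have dz: "d \<in> GI" "d \<noteq> 0" using d less by (auto simp: gdivs_def gdvd_def)
      then have "cmod d = 1" using True d gdvd_cmod_le[of d z] less GI_cmod_ge_1[of d] by (auto simp: gdivs_def)
      then show ?thesis using gmangoldt_bounds[OF dz] by simp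
    qed
    then show ?thesis using True by simp
  next
    case False
    then obtain p where p: "girr p" "gdvd p z" using girr_divisor_exists less ge by force
    then obtain w where w: "w \<in> GI" "z = p * w" by (auto simp: gdvd_def)
    have pG: "p \<in> GI" "cmod p > 1" "p \<noteq> 0" using p by (auto simp: girr_def)
    have w0: "w \<noteq> 0" using w less by auto
    have "cmod w < cmod z" using w w0 pG by (simp add: norm_mult)
    then have IH: "(\<Sum>d\<in>gdivs w. gmangoldt d) = 4 * ln ((cmod w)\<^sup>2)" using less.IH w w0 by blast
    define V where "V = {j. gdvd (p ^ j) w}"
    have Vd: "i \<in> V" if "j \<in> V" "i \<le> j" for i j
    proof -
      have "p ^ j = p ^ i * p ^ (j - i)" using that by (simp add: power_add[symmetric])
      then have "gdvd (p ^ i) (p ^ j)" using pG by (auto simp: gdvd_def)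
      then show ?thesis using that gdvd_trans by (auto simp: V_def)
    qed
    have "finite V"
    proof -
      obtain n where n: "cmod w < cmod p ^ n" using real_arch_pow pG by blast
      have "j < n" if "j \<in> V" for j
      proof (rule ccontr)
        assume "\<not> j < n"
        then have "cmod p ^ n \<le> cmod p ^ j" using pG by (intro power_increasing) auto
        moreover have "cmod (p ^ j) \<le> cmod w" using that gdvd_cmod_le w0 by (auto simp: V_def)
        ultimately show False using n by (simp add: norm_power)
      qed
      then show ?thesis by (meson finite_nat_set_iff_bounded)
    qed
    moreover have "0 \<in> V" using w by (auto simp: V_def gdvd_def)
    ultimately have vmax: "Max V \<in> V" "\<And>j. j \<in> V \<Longrightarrow> j \<le> Max V" using Max_in[of V] Max_ge[of V] by blast+
    define v where "v = Max V"
    have V: "j \<in> V \<longleftrightarrow> j \<le> v" for j using vmax Vd unfolding v_def by blast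
    define D where "D = (\<lambda>e. e * p ^ (v + 1)) ` {e. gunit e}"
    have assoc: "gdvd (e * x) y \<longleftrightarrow> gdvd x y" if "gunit e" for e x y
    proof
      assume "gdvd (e * x) y"
      then obtain h where "h \<in> GI" "y = e * x * h" by (auto simp: gdvd_def)
      then show "gdvd x y" using that unfolding gdvd_def gunit_def
        by (intro bexI[of _ "e * h"]) (auto simp: algebra_simps)
    next
      assume "gdvd x y"
      then obtain h where "h \<in> GI" "y = x * h" by (auto simp: gdvd_def)
      moreover have "x * h = e * (cnj e * (x * h))" using gunit_cancel(2)[OF that] by simp
      then have "x * h = e * x * (cnj e * h)" by (simp only: mult_ac)
      ultimately show "gdvd (e * x) y" using that unfolding gdvd_def gunit_def
        by (intro bexI[of _ "cnj e * h"]) auto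
    qed
    have pz: "gdvd (p ^ j) z \<longleftrightarrow> j \<le> v + 1" if j0: "j > 0" for j
    proof -
      obtain i where i: "j = Suc i" using j0 by (cases j) auto
      have "gdvd (p ^ j) z \<longleftrightarrow> gdvd (p ^ i) w" unfolding gdvd_def w i using pG by simp
      also have "\<dots> \<longleftrightarrow> j \<le> v + 1" using V[of i] i by (auto simp: V_def)
      finally show ?thesis .
    qed
    have D1: "D \<subseteq> gdivs z"
      using pz[of "v + 1"] assoc pG by (auto simp: D_def gdivs_def gunit_def)
    have D2: "D \<inter> gdivs w = {}"
      using assoc[of _ "p ^ (v + 1)" w] V[of "v + 1"] by (auto simp: D_def gdivs_def V_def)
    have sub: "gdivs w \<subseteq> gdivs z" using w gdvd_mult[of _ w p] pG by (auto simp: gdivs_def)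
    have D3: "gmangoldt d = 0" if d: "d \<in> gdivs z - (gdivs w \<union> D)" for d
    proof (rule ccontr)
      assume "gmangoldt d \<noteq> 0"
      then obtain q j where "gprimepow q j d" by (auto simp: gmangoldt_def split: if_splits)
      then obtain e where q: "girr q" "j > 0" "gunit e" "d = e * q ^ j" by (auto simp: gprimepow_def)
      have dz: "gdvd (q ^ j) z" "\<not> gdvd (q ^ j) w" using d q assoc by (auto simp: gdivs_def)
      \<comment> \<open>If p did not divide q, then q^j would already divide w.\<close>
      have "gdvd p q" using gprimepow_dvd_other[OF p(1) q(1) _ w(1), of j] dz w by blast
      then obtain f where f: "gunit f" "q = p * f" using girr_dvd_girr p q by blast
      have fj: "gunit (f ^ j)" using f by (auto simp: gunit_def norm_power)
      have qj: "q ^ j = f ^ j * p ^ j" by (simp add: f power_mult_distrib mult.commute)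
      have "gdvd (p ^ j) z" "\<not> gdvd (p ^ j) w" using dz unfolding qj by (simp_all add: assoc fj)
      then have "j = v + 1" using pz[OF q(2)] V[of j] by (auto simp: V_def)
      then have "d = (e * f ^ j) * p ^ (v + 1)" using q qj by simp
      then have "d \<in> D" unfolding D_def using gunit_mult[OF q(3) fj] by blast
      then show False using d by blast
    qed
    have pp: "gmangoldt d = ln ((cmod p)\<^sup>2)" if "d \<in> D" for d
      using that p by (intro gmangoldt_primepow[of p "v + 1"]) (auto simp: D_def gprimepow_def)
    have cD: "card D = 4" unfolding D_def using card_gunit pG by (subst card_image) (auto simp: inj_on_def)
    have fin: "finite (gdivs z)" "finite (gdivs w)" using finite_gdivs less w0 by auto
    have "(\<Sum>d\<in>gdivs z. gmangoldt d) = (\<Sum>d\<in>gdivs w \<union> D. gmangoldt d)"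
      using D3 D1 sub fin by (intro sum.mono_neutral_right) auto
    also have "\<dots> = (\<Sum>d\<in>gdivs w. gmangoldt d) + (\<Sum>d\<in>D. gmangoldt d)"
      using fin D1 D2 by (intro sum.union_disjoint) (auto intro: finite_subset)
    also have "(\<Sum>d\<in>D. gmangoldt d) = 4 * ln ((cmod p)\<^sup>2)" using pp cD by simp
    finally have "(\<Sum>d\<in>gdivs z. gmangoldt d) = 4 * (ln ((cmod p)\<^sup>2) + ln ((cmod w)\<^sup>2))" using IH by simp
    also have "ln ((cmod p)\<^sup>2) + ln ((cmod w)\<^sup>2) = ln ((cmod z)\<^sup>2)"
      using w w0 pG by (simp add: norm_mult power_mult_distrib ln_mult)
    finally show ?thesis .
  qed
qed

section \<open>Tools from analysis\<close>

text \<open>One integration by parts gives the rate O(1/Y). The next lemma reaches continuous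
  functions by uniform polynomial approximation.\<close>

lemma riemann_lebesgue_polynomial:
  fixes p :: "real \<Rightarrow> complex"
  assumes p: "polynomial_function p" and ab: "a \<le> b"
  shows "((\<lambda>Y. integral {a..b} (\<lambda>t. p t * exp (\<i> * of_real (Y * t)))) \<longlongrightarrow> 0) at_top"
proof -
  obtain p' where p': "polynomial_function p'" "\<And>x. (p has_vector_derivative p' x) (at x)"
    using has_vector_derivative_polynomial_function[OF p] by blast
  have cp: "continuous_on {a..b} p" "continuous_on {a..b} p'"
    using p p' by (auto intro: continuous_on_polymonial_function)
  obtain M where M: "\<And>t. t \<in> {a..b} \<Longrightarrow> norm (p t) \<le> M"
    using compact_imp_bounded[OF compact_continuous_image[OF cp(1)]] by (force simp: bounded_iff)
  obtain M' where M': "\<And>t. t \<in> {a..b} \<Longrightarrow> norm (p' t) \<le> M'"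
    using compact_imp_bounded[OF compact_continuous_image[OF cp(2)]] by (force simp: bounded_iff)
  have bound: "norm (integral {a..b} (\<lambda>t. p t * exp (\<i> * of_real (Y * t)))) \<le> (2 * M + M' * (b - a)) / Y"
    if Y: "Y > 0" for Y
  proof -
    define E where "E t = exp (\<i> * of_real (Y * t))" for t
    have nE: "norm (E t) = 1" for t by (simp add: E_def)
    have cE: "continuous_on {a..b} E" unfolding E_def by (intro continuous_intros)
    have dE: "(E has_vector_derivative (\<i> * of_real Y * E t)) (at t within S)" for t S
    proof -
      have "((\<lambda>z. exp (\<i> * (of_real Y * z))) has_field_derivative (\<i> * of_real Y * exp (\<i> * (of_real Y * of_real t)))) (at (of_real t))"
        by (auto intro!: derivative_eq_intros)
      from has_vector_derivative_real_field[OF this] show ?thesis by (simp add: E_def[abs_def])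
    qed
    have "((\<lambda>t. p t * (\<i> * of_real Y * E t) + p' t * E t) has_integral (p b * E b - p a * E a)) {a..b}"
      by (rule fundamental_theorem_of_calculus[OF ab])
         (intro has_vector_derivative_mult has_vector_derivative_at_within[OF p'(2)] dE)
    moreover have "(\<lambda>t. p' t * E t) integrable_on {a..b}"
      by (intro integrable_continuous_real continuous_intros cp cE)
    ultimately have "((\<lambda>t. p t * (\<i> * of_real Y * E t) + p' t * E t - p' t * E t) has_integral
        (p b * E b - p a * E a - integral {a..b} (\<lambda>t. p' t * E t))) {a..b}"
      by (intro has_integral_diff integrable_integral)
    then have "((\<lambda>t. (\<i> * of_real Y) * (p t * E t)) has_integral
        (p b * E b - p a * E a - integral {a..b} (\<lambda>t. p' t * E t))) {a..b}"
      by (simp add: mult_ac)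
    from integral_unique[OF this] have eq: "(\<i> * of_real Y) * integral {a..b} (\<lambda>t. p t * E t) =
        p b * E b - p a * E a - integral {a..b} (\<lambda>t. p' t * E t)"
      by (simp only: integral_mult_right)
    have "norm (integral {a..b} (\<lambda>t. p' t * E t)) \<le> M' * (b - a)"
      by (rule integral_bound[OF ab]) (auto intro!: continuous_intros cp cE simp: norm_mult nE M')
    moreover have "norm (p b * E b - p a * E a) \<le> M + M"
      using norm_triangle_ineq4[of "p b * E b" "p a * E a"] M[of a] M[of b] ab by (simp add: norm_mult nE)
    moreover have "Y * norm (integral {a..b} (\<lambda>t. p t * E t)) = norm (p b * E b - p a * E a - integral {a..b} (\<lambda>t. p' t * E t))"
      unfolding eq[symmetric] using Y by (simp add: norm_mult)
    ultimately have "Y * norm (integral {a..b} (\<lambda>t. p t * E t)) \<le> 2 * M + M' * (b - a)"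
      using norm_triangle_ineq4[of "p b * E b - p a * E a" "integral {a..b} (\<lambda>t. p' t * E t)"] by linarith
    then show ?thesis using Y by (simp add: E_def field_simps)
  qed
  show ?thesis
  proof (rule Lim_null_comparison)
    show "\<forall>\<^sub>F Y in at_top. norm (integral {a..b} (\<lambda>t. p t * exp (\<i> * of_real (Y * t)))) \<le> (2 * M + M' * (b - a)) / Y"
      using eventually_gt_at_top[of 0] by eventually_elim (rule bound)
    show "((\<lambda>Y. (2 * M + M' * (b - a)) / Y) \<longlongrightarrow> 0) at_top" by real_asymp
  qed
qed

lemma riemann_lebesgue:
  fixes g :: "real \<Rightarrow> complex"
  assumes g: "continuous_on {a..b} g" and ab: "a \<le> b"
  shows "((\<lambda>Y. integral {a..b} (\<lambda>t. g t * exp (\<i> * of_real (Y * t)))) \<longlongrightarrow> 0) at_top"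
proof (rule tendstoI)
  fix e :: real assume e: "e > 0"
  \<comment> \<open>The added 1 keeps the denominator positive when a = b; the approximation error d
    (b - a) is then below e / 2 in all cases.\<close>
  define d where "d = e / (2 * (b - a + 1))"
  have d: "d > 0" using e ab by (simp add: d_def)
  obtain p where p: "polynomial_function p" "\<And>t. t \<in> {a..b} \<Longrightarrow> norm (g t - p t) < d"
    using Stone_Weierstrass_polynomial_function[OF compact_Icc g d] by blast
  have cp: "continuous_on {a..b} p" using p by (auto intro: continuous_on_polymonial_function)
  have "\<forall>\<^sub>F Y in at_top. dist (integral {a..b} (\<lambda>t. p t * exp (\<i> * of_real (Y * t)))) 0 < e / 2"
    by (rule tendstoD[OF riemann_lebesgue_polynomial[OF p(1) ab]]) (use e in auto)
  then show "\<forall>\<^sub>F Y in at_top. dist (integral {a..b} (\<lambda>t. g t * exp (\<i> * of_real (Y * t)))) 0 < e"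
  proof eventually_elim
    case (elim Y)
    let ?E = "\<lambda>t. exp (\<i> * of_real (Y * t))"
    have "norm (integral {a..b} (\<lambda>t. (g t - p t) * ?E t)) \<le> d * (b - a)"
      by (rule integral_bound[OF ab]) (auto intro!: continuous_intros cp g less_imp_le p(2) simp: norm_mult)
    also have "\<dots> < e / 2" using ab e by (simp add: d_def field_simps)
    finally have "norm (integral {a..b} (\<lambda>t. (g t - p t) * ?E t)) < e / 2" .
    moreover have "integral {a..b} (\<lambda>t. (g t - p t) * ?E t) =
        integral {a..b} (\<lambda>t. g t * ?E t) - integral {a..b} (\<lambda>t. p t * ?E t)"
      unfolding left_diff_distrib
      by (rule integral_diff) (intro integrable_continuous_real continuous_intros cp g)+
    ultimately show ?case
      using elim norm_triangle_ineq[of "integral {a..b} (\<lambda>t. g t * ?E t) - integral {a..b} (\<lambda>t. p t * ?E t)" "integral {a..b} (\<lambda>t. p t * ?E t)"]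
      by (simp add: dist_norm)
  qed
qed

section \<open>Orders of vanishing, and continuation by quotients\<close>

lemma holomorphic_order_factor:
  assumes F: "F holomorphic_on ball s0 r0" "r0 > 0" and nz: "\<exists>w\<in>ball s0 r0. F w \<noteq> 0"
  obtains n g r where "0 < r" "r \<le> r0" "g holomorphic_on ball s0 r"
    "\<And>w. w \<in> ball s0 r \<Longrightarrow> F w = (w - s0) ^ n * g w" "\<And>w. w \<in> ball s0 r \<Longrightarrow> g w \<noteq> 0" "n = 0 \<longleftrightarrow> F s0 \<noteq> 0"
proof (cases "F s0 = 0")
  case True
  have "\<not> F constant_on ball s0 r0" using True nz F(2) unfolding constant_on_def by (metis centre_in_ball)
  then obtain g r n where "0 < n" "0 < r" "ball s0 r \<subseteq> ball s0 r0" "g holomorphic_on ball s0 r"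
      "\<And>w. w \<in> ball s0 r \<Longrightarrow> F w = (w - s0) ^ n * g w" "\<And>w. w \<in> ball s0 r \<Longrightarrow> g w \<noteq> 0"
    using holomorphic_factor_zero_nonconstant[OF F(1) open_ball connected_ball _ True] F(2) by (metis centre_in_ball)
  moreover from this have "r \<le> r0" using F(2) by (simp add: ball_subset_ball_iff)
  ultimately show ?thesis using that[of r g n] True by auto
next
  case False
  have "continuous (at s0) F" using F by (meson centre_in_ball holomorphic_on_imp_continuous_on continuous_on_eq_continuous_at open_ball)
  then obtain e where e: "e > 0" "\<And>y. dist s0 y < e \<Longrightarrow> F y \<noteq> 0"
    using continuous_at_avoid[of s0 F 0] False by blast
  show ?thesis
    by (rule that[of "min e r0" F 0]) (use F e False in \<open>auto intro: holomorphic_on_subset\<close>)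
qed

text \<open>Where F = (w - s0)^n g with g nonzero, F'/F = n / (w - s0) + g'/g, and the last term
  stays bounded. The point s0 is approached horizontally from the right because the Dirichlet series
  converge on that side.\<close>

lemma log_deriv_order:
  assumes F: "F holomorphic_on ball s0 r0" "r0 > 0" and nz: "\<exists>w\<in>ball s0 r0. F w \<noteq> 0"
  obtains n :: nat where
    "((\<lambda>\<epsilon>. of_real \<epsilon> * (deriv F (s0 + of_real \<epsilon>) / F (s0 + of_real \<epsilon>))) \<longlongrightarrow> of_nat n) (at_right 0)"
    "n = 0 \<longleftrightarrow> F s0 \<noteq> 0" "\<forall>\<^sub>F \<epsilon> in at_right 0. F (s0 + of_real \<epsilon>) \<noteq> 0"
proof -
  obtain n g r where g: "0 < r" "r \<le> r0" "g holomorphic_on ball s0 r"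
    "\<And>w. w \<in> ball s0 r \<Longrightarrow> F w = (w - s0) ^ n * g w" "\<And>w. w \<in> ball s0 r \<Longrightarrow> g w \<noteq> 0" "n = 0 \<longleftrightarrow> F s0 \<noteq> 0"
    using holomorphic_order_factor[OF assms] by metis
  have ev: "\<forall>\<^sub>F \<epsilon> in at_right 0. 0 < \<epsilon> \<and> \<epsilon> < r"
    using g(1) by (auto simp: eventually_at_right_field)
  have dg: "deriv g holomorphic_on ball s0 r" using g(3) by (rule holomorphic_deriv) auto
  have form: "of_real \<epsilon> * (deriv F (s0 + of_real \<epsilon>) / F (s0 + of_real \<epsilon>)) =
      of_nat n + of_real \<epsilon> * (deriv g (s0 + of_real \<epsilon>) / g (s0 + of_real \<epsilon>)) \<and> F (s0 + of_real \<epsilon>) \<noteq> 0"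
    if e: "0 < \<epsilon> \<and> \<epsilon> < r" for \<epsilon> :: real
  proof -
    define w where "w = s0 + of_real \<epsilon>"
    have w: "w \<in> ball s0 r" "w - s0 = of_real \<epsilon>" using e by (auto simp: w_def dist_norm)
    have "(g has_field_derivative deriv g w) (at w)" using holomorphic_derivI[OF g(3) _ w(1)] by simp
    then have "((\<lambda>w. (w - s0) ^ n * g w) has_field_derivative
        (of_nat n * (w - s0) ^ (n - 1) * g w + (w - s0) ^ n * deriv g w)) (at w)"
      by (auto intro!: derivative_eq_intros)
    then have "(F has_field_derivative (of_nat n * (w - s0) ^ (n - 1) * g w + (w - s0) ^ n * deriv g w)) (at w)"
      by (rule has_field_derivative_transform_within_open[OF _ open_ball w(1)]) (use g in auto)
    then have d: "deriv F w = of_nat n * (w - s0) ^ (n - 1) * g w + (w - s0) ^ n * deriv g w"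
      by (rule DERIV_imp_deriv)
    have e0: "w - s0 \<noteq> 0" using w e by simp
    have "(w - s0) * (deriv F w / F w) = of_nat n + (w - s0) * (deriv g w / g w)"
      unfolding d g(4)[OF w(1)] using e0 g(5)[OF w(1)]
      by (cases n) (auto simp: field_simps)
    moreover have "F w \<noteq> 0" using g(4)[OF w(1)] g(5)[OF w(1)] e0 by simp
    ultimately show ?thesis using w(2) by (simp add: w_def)
  qed
  have cont: "isCont (\<lambda>w. deriv g w / g w) s0"
  proof -
    have "(\<lambda>w. deriv g w / g w) holomorphic_on ball s0 r" using g dg by (intro holomorphic_intros) auto
    then show ?thesis using g(1) by (meson centre_in_ball holomorphic_on_imp_continuous_on continuous_on_eq_continuous_at open_ball)
  qed
  have t: "((\<lambda>\<epsilon>. s0 + complex_of_real \<epsilon>) \<longlongrightarrow> s0 + of_real 0) (at_right 0)"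
    by (intro tendsto_intros)
  have "((\<lambda>\<epsilon>. of_nat n + complex_of_real \<epsilon> * (deriv g (s0 + of_real \<epsilon>) / g (s0 + of_real \<epsilon>))) \<longlongrightarrow>
      of_nat n + of_real 0 * (deriv g s0 / g s0)) (at_right 0)"
    by (intro tendsto_add tendsto_mult tendsto_const tendsto_of_real tendsto_ident_at
        isCont_tendsto_compose[OF cont]) (use t in simp)
  then have "((\<lambda>\<epsilon>. of_nat n + complex_of_real \<epsilon> * (deriv g (s0 + of_real \<epsilon>) / g (s0 + of_real \<epsilon>))) \<longlongrightarrow>
      of_nat n) (at_right 0)" by simp
  then have "((\<lambda>\<epsilon>. of_real \<epsilon> * (deriv F (s0 + of_real \<epsilon>) / F (s0 + of_real \<epsilon>))) \<longlongrightarrow> of_nat n) (at_right 0)"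
    by (rule Lim_transform_eventually) (use ev form in \<open>auto elim!: eventually_mono\<close>)
  moreover have "\<forall>\<^sub>F \<epsilon> in at_right 0. F (s0 + of_real \<epsilon>) \<noteq> 0"
    using ev form by (auto elim!: eventually_mono)
  ultimately show ?thesis using that g(6) by blast
qed

text \<open>Each quotient h j / e j continues f where its denominator is nonzero. The cross products
  h i * e j and h j * e i agree on R, hence on the connected set H, so the quotients agree on
  overlaps and can be glued.\<close>

lemma holomorphic_extension_by_quotients:
  fixes h e :: "'i \<Rightarrow> complex \<Rightarrow> complex"
  assumes H: "open H" "connected H" and R: "open R" "R \<noteq> {}" "R \<subseteq> K" "K \<subseteq> H"
    and hol: "\<And>j. h j holomorphic_on H" "\<And>j. e j holomorphic_on H"
    and ef: "\<And>j s. s \<in> R \<Longrightarrow> e j s * f s = h j s"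
    and cover: "\<And>s. s \<in> K \<Longrightarrow> \<exists>j. e j s \<noteq> 0"
  obtains U F where "open U" "K \<subseteq> U" "F holomorphic_on U" "\<And>s. s \<in> R \<Longrightarrow> F s = f s"
proof -
  have id: "h i s * e j s = h j s * e i s" if "s \<in> H" for i j s
  proof (rule analytic_continuation_open[of R H "\<lambda>s. h i s * e j s" "\<lambda>s. h j s * e i s"])
    show "h i z * e j z = h j z * e i z" if "z \<in> R" for z
      using ef[OF that, of i] ef[OF that, of j] by (simp flip: ef[OF that])
  qed (use H R hol that in \<open>auto intro!: holomorphic_intros\<close>)
  define U where "U = (\<Union>j. {s\<in>H. e j s \<noteq> 0})"
  define F where "F s = (let j = (SOME j. e j s \<noteq> 0) in h j s / e j s)" for s
  have Feq: "F s = h j s / e j s" if "s \<in> H" "e j s \<noteq> 0" for s j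
  proof -
    define i where "i = (SOME j. e j s \<noteq> 0)"
    have "e i s \<noteq> 0" unfolding i_def by (rule someI[of _ j]) (rule that)
    moreover have "F s = h i s / e i s" by (simp add: F_def i_def Let_def)
    ultimately show ?thesis using id[OF that(1), of i j] that by (simp add: frac_eq_eq)
  qed
  have op: "open {s\<in>H. e j s \<noteq> 0}" for j
  proof -
    have "continuous_on H (e j)" using hol(2) by (rule holomorphic_on_imp_continuous_on)
    then have "open (e j -` (- {0}) \<inter> H)" using continuous_on_open_vimage[OF H(1), of "e j"] by blast
    moreover have "{s\<in>H. e j s \<noteq> 0} = e j -` (- {0}) \<inter> H" by auto
    ultimately show ?thesis by simp
  qed
  show ?thesis
  proof (rule that[of U F])
    show "open U" unfolding U_def using op by blast
    show "K \<subseteq> U" using cover R by (auto simp: U_def)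
    show "F s = f s" if "s \<in> R" for s
    proof -
      obtain j where j: "e j s \<noteq> 0" using cover \<open>s \<in> R\<close> R by blast
      have "F s = e j s * f s / e j s" using Feq[OF _ j] ef[OF \<open>s \<in> R\<close>, of j] \<open>s \<in> R\<close> R by auto
      then show ?thesis using j by simp
    qed
    show "F holomorphic_on U" unfolding U_def
    proof (rule holomorphic_on_UN_open)
      fix j
      have "(\<lambda>s. h j s / e j s) holomorphic_on {s\<in>H. e j s \<noteq> 0}"
        by (intro holomorphic_intros holomorphic_on_subset[OF hol(1)] holomorphic_on_subset[OF hol(2)]) auto
      then show "F holomorphic_on {s\<in>H. e j s \<noteq> 0}"
        by (rule holomorphic_transform) (use Feq in auto)
    qed (rule op)
  qed
qed

text \<open>Used for the trivial character: there (s - 1) times the series is continued, so the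
  factor s - 1 has to be removed from the multiplier. The zero of 1 - N^(1-s) at 1 is simple, as its
  derivative there is ln N.\<close>

lemma entire_quotient_one_minus_powr:
  fixes N :: real
  assumes "N > 1"
  obtains e where "e holomorphic_on UNIV" "\<And>s. (s - 1) * e s = 1 - of_real N powr (1 - s)" "e 1 \<noteq> 0"
proof -
  define f where "f s = 1 - (of_real N :: complex) powr (1 - s)" for s
  have N0: "(of_real N :: complex) \<noteq> 0" using assms by auto
  have df: "(f has_field_derivative (of_real N powr (1 - s) * ln (of_real N))) (at s)" for s
    unfolding f_def powr_def using N0 by (auto intro!: derivative_eq_intros)
  then have hol: "f holomorphic_on UNIV" using holomorphic_onI field_differentiable_def field_differentiable_at_within by metis
  have f1: "f 1 = 0" using N0 by (simp add: f_def)
  define e where "e z = (if z = 1 then deriv f 1 else (f z - f 1) / (z - 1))" for z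
  show ?thesis
  proof (rule that[of e])
    show "e holomorphic_on UNIV" unfolding e_def by (rule pole_lemma[OF hol]) auto
    show "(s - 1) * e s = 1 - of_real N powr (1 - s)" for s
      using f1 by (auto simp: e_def f_def)
    have "deriv f 1 = ln (of_real N)" using DERIV_imp_deriv[OF df[of 1]] N0 by simp
    also have "\<dots> = of_real (ln N)" using assms by (simp add: Ln_of_real)
    finally show "e 1 \<noteq> 0" using assms by (simp add: e_def)
  qed
qed

section \<open>Hecke series\<close>

lemma summable_on_int_powr:
  assumes "\<sigma> > (1::real)"
  shows "(\<lambda>a::int. (1 + \<bar>of_int a\<bar>) powr (-\<sigma>)) summable_on UNIV"
proof -
  have s: "summable (\<lambda>n. real n powr (-\<sigma>))" using assms by (simp add: summable_real_powr_iff)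
  then have "summable (\<lambda>n. real (Suc n) powr (-\<sigma>))" by (subst summable_Suc_iff)
  then have s1: "(\<lambda>n. real (Suc n) powr (-\<sigma>)) summable_on UNIV"
    by (intro summable_nonneg_imp_summable_on) auto
  have "(\<lambda>a::int. (1 + \<bar>of_int a\<bar>) powr (-\<sigma>)) summable_on range int"
    by (subst summable_on_reindex) (use s1 in \<open>auto simp: o_def add.commute\<close>)
  moreover have "(\<lambda>a::int. (1 + \<bar>of_int a\<bar>) powr (-\<sigma>)) summable_on range (\<lambda>n. - int (Suc n))"
  proof (subst summable_on_reindex)
    show "inj (\<lambda>n. - int (Suc n))" by (auto simp: inj_on_def)
    show "((\<lambda>a::int. (1 + \<bar>of_int a\<bar>) powr (-\<sigma>)) \<circ> (\<lambda>n. - int (Suc n))) summable_on UNIV"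
      by (rule summable_on_comparison_test[OF s1]) (use assms in \<open>auto intro!: powr_mono2'\<close>)
  qed
  moreover have "range int \<inter> range (\<lambda>n. - int (Suc n)) = {}" by auto
  ultimately have "(\<lambda>a::int. (1 + \<bar>of_int a\<bar>) powr (-\<sigma>)) summable_on (range int \<union> range (\<lambda>n. - int (Suc n)))"
    by (rule summable_on_Un_disjoint)
  moreover have "range int \<union> range (\<lambda>n. - int (Suc n)) = UNIV"
  proof -
    have "a \<in> range int \<union> range (\<lambda>n. - int (Suc n))" for a
      by (cases a rule: int_cases) auto
    then show ?thesis by blast
  qed
  ultimately show ?thesis by simp
qed

lemma bij_betw_GI: "bij_betw (\<lambda>(a, b). Complex (of_int a) (of_int b)) UNIV GI"
  unfolding bij_betw_def
proof
  show "inj (\<lambda>(a, b). Complex (real_of_int a) (real_of_int b))" by (auto simp: inj_on_def)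
  show "range (\<lambda>(a, b). Complex (real_of_int a) (real_of_int b)) = GI"
    using GI_Complex by (auto simp: image_iff)
qed

text \<open>The inequality (1 + |a|)(1 + |b|) <= 4 (a^2 + b^2) for (a, b) nonzero bounds the double
  series by a product of two series over the integers.\<close>

lemma summable_on_GI_powr:
  assumes "\<sigma> > (1::real)"
  shows "(\<lambda>z. (cmod z)\<^sup>2 powr (-\<sigma>)) summable_on GI"
proof -
  define f where "f a = (1 + \<bar>of_int a\<bar>) powr (-\<sigma>)" for a :: int
  have sf: "f summable_on UNIV" unfolding f_def by (rule summable_on_int_powr[OF assms])
  have "(\<lambda>(a, b). f a * f b) summable_on (SIGMA a:UNIV. UNIV)"
  proof (rule summable_on_SigmaI)
    show "((\<lambda>b. case (a, b) of (a, b) \<Rightarrow> f a * f b) has_sum (f a * infsum f UNIV)) UNIV" for a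
      using has_sum_cmult_right[OF has_sum_infsum[OF sf], of "f a"] by simp
    show "(\<lambda>a. f a * infsum f UNIV) summable_on UNIV" by (rule summable_on_cmult_left[OF sf])
  qed (auto simp: f_def)
  then have "(\<lambda>(a, b). f a * f b) summable_on UNIV" by simp
  from summable_on_cmult_right[OF this, of "4 powr \<sigma>"]
  have s: "(\<lambda>p. 4 powr \<sigma> * (case p of (a, b) \<Rightarrow> f a * f b)) summable_on UNIV" .
  have "(\<lambda>p. (cmod (case p of (a, b) \<Rightarrow> Complex (of_int a) (of_int b)))\<^sup>2 powr (-\<sigma>)) summable_on UNIV"
  proof (rule summable_on_comparison_test[OF s])
    fix p :: "int \<times> int"
    obtain a b where p: "p = (a, b)" by (cases p)
    show "(cmod (case p of (a, b) \<Rightarrow> Complex (of_int a) (of_int b)))\<^sup>2 powr (-\<sigma>) \<le> 4 powr \<sigma> * (case p of (a, b) \<Rightarrow> f a * f b)"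
    proof (cases "a = 0 \<and> b = 0")
      case True
      moreover have "Complex 0 0 = 0" by (simp add: complex_eq_iff)
      ultimately show ?thesis by (simp add: p f_def)
    next
      case False
      define x y where "x = \<bar>real_of_int a\<bar>" and "y = \<bar>real_of_int b\<bar>"
      have ge: "x \<ge> 1 \<or> y \<ge> 1" "x \<ge> 0" "y \<ge> 0" using False by (auto simp: x_def y_def)
      then have q: "x\<^sup>2 + y\<^sup>2 \<ge> 1"
        by (metis add_increasing add_increasing2 one_le_power zero_le_power2)
      have "(1 + x) * (1 + y) \<le> 4 * (x\<^sup>2 + y\<^sup>2)"
        using q sum_squares_bound[of x y] sum_squares_bound[of x 1] sum_squares_bound[of y 1]
        by (simp add: algebra_simps power2_eq_square)
      then have "(4 * (x\<^sup>2 + y\<^sup>2)) powr (-\<sigma>) \<le> ((1 + x) * (1 + y)) powr (-\<sigma>)"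
        using ge assms by (intro powr_mono2') (auto intro!: mult_pos_pos)
      moreover have "(4 * (x\<^sup>2 + y\<^sup>2)) powr (-\<sigma>) = 4 powr (-\<sigma>) * (x\<^sup>2 + y\<^sup>2) powr (-\<sigma>)"
        by (subst powr_mult) auto
      moreover have "((1 + x) * (1 + y)) powr (-\<sigma>) = f a * f b" using ge
        by (simp add: powr_mult f_def x_def y_def)
      ultimately have "4 powr (-\<sigma>) * (x\<^sup>2 + y\<^sup>2) powr (-\<sigma>) \<le> f a * f b" by simp
      then have "4 powr \<sigma> * (4 powr (-\<sigma>) * (x\<^sup>2 + y\<^sup>2) powr (-\<sigma>)) \<le> 4 powr \<sigma> * (f a * f b)"
        by (intro mult_left_mono) auto
      then show ?thesis by (simp add: p cmod_power2 x_def y_def powr_minus mult.assoc[symmetric])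
    qed
  qed auto
  then show ?thesis
    using summable_on_reindex_bij_betw[OF bij_betw_GI, of "\<lambda>z. (cmod z)\<^sup>2 powr (-\<sigma>)"] by simp
qed

text \<open>The exponent is a multiple of 4 so that the value depends only on the ideal generated by
  z. The kernel uses m = 0, 1, 2, but nonvanishing for m also involves 2 m, so all m are
  treated.\<close>

definition gchi :: "nat \<Rightarrow> complex \<Rightarrow> complex" where
  "gchi m z = (z / of_real (cmod z)) ^ (4 * m)"

text \<open>Since \<open>0 powr s = 0\<close>, the term at \<open>z = 0\<close> vanishes and may be kept in lattice sums.\<close>

definition gterm :: "nat \<Rightarrow> complex \<Rightarrow> complex \<Rightarrow> complex" where
  "gterm m s z = gchi m z * of_real ((cmod z)\<^sup>2) powr (- s)"

lemma gterm_0 [simp]: "gterm m s 0 = 0"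
  by (simp add: gterm_def)

lemma norm_gchi: "z \<noteq> 0 \<Longrightarrow> cmod (gchi m z) = 1"
  by (simp add: gchi_def norm_power norm_divide)

lemma gchi_mult: "gchi m (z * w) = gchi m z * gchi m w"
  by (simp add: gchi_def norm_mult flip: power_mult_distrib)

lemma gchi_0 [simp]: "gchi 0 z = 1"
  by (simp add: gchi_def)

lemma gchi_double: "gchi (2 * m) z = (gchi m z)\<^sup>2"
  by (simp add: gchi_def mult_ac flip: power_mult)

lemma gchi_unit: "gunit e \<Longrightarrow> gchi m e = 1"
  by (auto simp: gunit_iff gchi_def power_mult)

lemma norm_gterm: "cmod (gterm m s z) = (cmod z)\<^sup>2 powr (- Re s)"
proof (cases "z = 0")
  case False
  have "cmod (of_real ((cmod z)\<^sup>2) powr (- s)) = (cmod z)\<^sup>2 powr (- Re s)"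
    by (subst norm_powr_real_powr) auto
  then show ?thesis using False by (simp add: gterm_def norm_mult norm_gchi)
qed auto

lemma gterm_mult: "gterm m s (z * w) = gterm m s z * gterm m s w"
proof -
  have "of_real ((cmod (z * w))\<^sup>2) powr (- s) = of_real ((cmod z)\<^sup>2) powr (- s) * of_real ((cmod w)\<^sup>2) powr (- s)"
    using powr_times_real[of "of_real ((cmod z)\<^sup>2)" "of_real ((cmod w)\<^sup>2)" "-s"]
    by (simp add: norm_mult power_mult_distrib)
  then show ?thesis by (simp add: gterm_def gchi_mult mult_ac)
qed

lemma gterm_abs_summable: "Re s > 1 \<Longrightarrow> (\<lambda>z. norm (gterm m s z)) summable_on GI"
  using summable_on_GI_powr[of "Re s"] by (simp add: norm_gterm)

section \<open>The Hecke series and their logarithmic derivatives\<close>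

definition gL :: "nat \<Rightarrow> complex \<Rightarrow> complex" where
  "gL m s = (\<Sum>\<^sub>\<infinity>z\<in>GI. gterm m s z)"

text \<open>Where \<open>gL m\<close> does not vanish this is -4 times its logarithmic derivative,
  by \<open>gL_has_field_derivative\<close>. A simple pole of \<open>gL 0\<close> at 1 therefore
  gives \<open>gP 0\<close> residue 4 there.\<close>

definition gP :: "nat \<Rightarrow> complex \<Rightarrow> complex" where
  "gP m s = (\<Sum>\<^sub>\<infinity>z\<in>GI - {0}. of_real (gmangoldt z) * gterm m s z)"

lemma ln_powr_bound_GI:
  assumes z: "z \<in> GI" "z \<noteq> 0" and d: "\<delta> > 0"
  shows "ln ((cmod z)\<^sup>2) \<le> (cmod z)\<^sup>2 powr \<delta> / \<delta>"
proof -
  have "(cmod z)\<^sup>2 \<ge> 1" using GI_cmod_ge_1[OF z] by simp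
  then show ?thesis using ln_powr_bound[of "(cmod z)\<^sup>2" \<delta>] d by simp
qed

lemma summable_on_GI_ln_powr:
  assumes "\<sigma> > (1::real)"
  shows "(\<lambda>z. ln ((cmod z)\<^sup>2) * (cmod z)\<^sup>2 powr (-\<sigma>)) summable_on GI - {0}"
proof -
  define \<delta> where "\<delta> = (\<sigma> - 1) / 2"
  have d: "\<delta> > 0" "\<sigma> - \<delta> > 1" using assms by (auto simp: \<delta>_def field_simps)
  have "(\<lambda>z. (1 / \<delta>) * (cmod z)\<^sup>2 powr (-(\<sigma> - \<delta>))) summable_on GI - {0}"
    by (intro summable_on_cmult_right summable_on_subset_banach[OF summable_on_GI_powr[OF d(2)]]) auto
  then show ?thesis
  proof (rule summable_on_comparison_test)
    fix z assume z: "z \<in> GI - {0}"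
    have "ln ((cmod z)\<^sup>2) * (cmod z)\<^sup>2 powr (-\<sigma>) \<le> (cmod z)\<^sup>2 powr \<delta> / \<delta> * (cmod z)\<^sup>2 powr (-\<sigma>)"
      using ln_powr_bound_GI[of z \<delta>] z d by (intro mult_right_mono) auto
    also have "\<dots> = (1 / \<delta>) * (cmod z)\<^sup>2 powr (-(\<sigma> - \<delta>))" by (simp add: powr_add[symmetric])
    finally show "ln ((cmod z)\<^sup>2) * (cmod z)\<^sup>2 powr (-\<sigma>) \<le> (1 / \<delta>) * (cmod z)\<^sup>2 powr (-(\<sigma> - \<delta>))" .
    show "0 \<le> ln ((cmod z)\<^sup>2) * (cmod z)\<^sup>2 powr (-\<sigma>)"
      using GI_cmod_ge_1[of z] z by (intro mult_nonneg_nonneg ln_ge_zero) auto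
  qed
qed

lemma gmangoldt_powr_summable:
  assumes "\<sigma> > (1::real)"
  shows "(\<lambda>z. gmangoldt z * (cmod z)\<^sup>2 powr (-\<sigma>)) summable_on GI - {0}"
  by (rule summable_on_comparison_test[OF summable_on_GI_ln_powr[OF assms]])
     (auto intro!: mult_right_mono mult_nonneg_nonneg gmangoldt_bounds)

lemma gP_abs_summable:
  assumes "Re s > 1" shows "(\<lambda>z. norm (of_real (gmangoldt z) * gterm m s z)) summable_on GI - {0}"
proof -
  have "(\<lambda>z. norm (of_real (gmangoldt z) * gterm m s z)) summable_on GI - {0}
    \<longleftrightarrow> (\<lambda>z. gmangoldt z * (cmod z)\<^sup>2 powr (- Re s)) summable_on GI - {0}"
    by (rule summable_on_cong) (auto simp: norm_mult norm_gterm gmangoldt_bounds)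
  then show ?thesis using gmangoldt_powr_summable[OF assms] by simp
qed

lemma gL_nonzero_sum: "gL m s = (\<Sum>\<^sub>\<infinity>z\<in>GI - {0}. gterm m s z)"
  unfolding gL_def by (rule infsum_cong_neutral) auto

text \<open>All associates are counted, which accounts for the factor 4.\<close>

lemma gP_times_gL:
  assumes s: "Re s > 1"
  shows "gP m s * gL m s = 4 * (\<Sum>\<^sub>\<infinity>z\<in>GI - {0}. of_real (ln ((cmod z)\<^sup>2)) * gterm m s z)"
proof -
  let ?G = "GI - {0}"
  define a where "a z = of_real (gmangoldt z) * gterm m s z" for z
  define b where "b z = gterm m s z" for z
  have sa: "(\<lambda>z. norm (a z)) summable_on ?G" unfolding a_def by (rule gP_abs_summable[OF s])
  have sb: "(\<lambda>z. norm (b z)) summable_on ?G" unfolding b_def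
    by (rule summable_on_subset_banach[OF gterm_abs_summable[OF s]]) auto
  have "(\<lambda>p. norm (case p of (x, y) \<Rightarrow> a x * b y)) summable_on (?G \<times> ?G)"
    unfolding Infinite_Sum.abs_summable_on_Sigma_iff
  proof (intro conjI ballI)
    fix x show "(\<lambda>y. norm (case (x, y) of (x, y) \<Rightarrow> a x * b y)) summable_on ?G"
      using summable_on_cmult_right[OF sb, of "norm (a x)"] by (simp add: norm_mult)
  next
    have "(\<Sum>\<^sub>\<infinity>y\<in>?G. norm (case (x, y) of (x, y) \<Rightarrow> a x * b y)) = norm (a x) * (\<Sum>\<^sub>\<infinity>y\<in>?G. norm (b y))" for x
      by (simp add: norm_mult infsum_cmult_right[OF sb])
    moreover have "(\<lambda>x. norm (norm (a x) * (\<Sum>\<^sub>\<infinity>y\<in>?G. norm (b y)))) summable_on ?G"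
      using summable_on_cmult_left[OF sa, of "\<bar>\<Sum>\<^sub>\<infinity>y\<in>?G. norm (b y)\<bar>"] by (simp add: abs_mult)
    ultimately show "(\<lambda>x. norm (\<Sum>\<^sub>\<infinity>y\<in>?G. norm (case (x, y) of (x, y) \<Rightarrow> a x * b y))) summable_on ?G" by simp
  qed
  then have sab: "(\<lambda>(x, y). a x * b y) summable_on (?G \<times> ?G)" by (rule abs_summable_summable)
  have "gP m s * gL m s = (\<Sum>\<^sub>\<infinity>x\<in>?G. a x) * (\<Sum>\<^sub>\<infinity>y\<in>?G. b y)"
    by (simp add: gP_def gL_nonzero_sum a_def b_def)
  also have "\<dots> = (\<Sum>\<^sub>\<infinity>x\<in>?G. \<Sum>\<^sub>\<infinity>y\<in>?G. a x * b y)"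
    using abs_summable_summable[OF sa] abs_summable_summable[OF sb]
    by (simp add: infsum_cmult_left infsum_cmult_right)
  also have "\<dots> = (\<Sum>\<^sub>\<infinity>p\<in>?G \<times> ?G. case p of (x, y) \<Rightarrow> a x * b y)"
    using infsum_Sigma'_banach[OF sab] by simp
  \<comment> \<open>Dirichlet convolution: a pair of factors (x, y) is recorded as the product z = x
    y together with its divisor d = x.\<close>
  also have "\<dots> = (\<Sum>\<^sub>\<infinity>p\<in>(SIGMA z:?G. gdivs z). case p of (z, d) \<Rightarrow> of_real (gmangoldt d) * gterm m s z)"
  proof (rule infsum_reindex_bij_witness[where i = "\<lambda>(z, d). (d, z / d)" and j = "\<lambda>(x, y). (x * y, x)"])
    fix p assume "p \<in> ?G \<times> ?G"
    then obtain x y where p: "p = (x, y)" "x \<in> GI" "y \<in> GI" "x \<noteq> 0" "y \<noteq> 0" by auto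
    then show "(case (case p of (x, y) \<Rightarrow> (x * y, x)) of (z, d) \<Rightarrow> (d, z / d)) = p"
      "(case p of (x, y) \<Rightarrow> (x * y, x)) \<in> (SIGMA z:?G. gdivs z)"
      by (auto simp: gdivs_def gdvd_def)
    show "(case case p of (x, y) \<Rightarrow> (x * y, x) of (z, d) \<Rightarrow> of_real (gmangoldt d) * gterm m s z) = (case p of (x, y) \<Rightarrow> a x * b y)"
      by (simp add: p a_def b_def gterm_mult)
  next
    fix p assume "p \<in> (SIGMA z:?G. gdivs z)"
    then obtain z d where p0: "p = (z, d)" "z \<in> GI" "z \<noteq> 0" "d \<in> gdivs z" by auto
    then obtain w where w: "w \<in> GI" "z = d * w" "d \<in> GI" by (auto simp: gdivs_def gdvd_def)
    note p = p0(1-3) w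
    from this show "(case (case p of (z, d) \<Rightarrow> (d, z / d)) of (x, y) \<Rightarrow> (x * y, x)) = p"
      "(case p of (z, d) \<Rightarrow> (d, z / d)) \<in> ?G \<times> ?G"
      by auto
  qed
  also have "\<dots> = (\<Sum>\<^sub>\<infinity>z\<in>?G. \<Sum>\<^sub>\<infinity>d\<in>gdivs z. of_real (gmangoldt d) * gterm m s z)"
  proof -
    have "(\<lambda>(z, d). of_real (gmangoldt d) * gterm m s z) summable_on (SIGMA z:?G. gdivs z) \<longleftrightarrow>
        (\<lambda>(x, y). a x * b y) summable_on (?G \<times> ?G)"
    proof (rule summable_on_reindex_bij_witness[where j = "\<lambda>(z, d). (d, z / d)" and i = "\<lambda>(x, y). (x * y, x)"])
      fix p assume "p \<in> ?G \<times> ?G"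
      then obtain x y where p: "p = (x, y)" "x \<in> GI" "y \<in> GI" "x \<noteq> 0" "y \<noteq> 0" by auto
      then show "(case (case p of (x, y) \<Rightarrow> (x * y, x)) of (z, d) \<Rightarrow> (d, z / d)) = p"
        "(case p of (x, y) \<Rightarrow> (x * y, x)) \<in> (SIGMA z:?G. gdivs z)"
        by (auto simp: gdivs_def gdvd_def)
    next
      fix p assume "p \<in> (SIGMA z:?G. gdivs z)"
      then obtain z d where p0: "p = (z, d)" "z \<in> GI" "z \<noteq> 0" "d \<in> gdivs z" by auto
      then obtain w where w: "w \<in> GI" "z = d * w" "d \<in> GI" by (auto simp: gdivs_def gdvd_def)
      note p = p0(1-3) w
      from this show "(case (case p of (z, d) \<Rightarrow> (d, z / d)) of (x, y) \<Rightarrow> (x * y, x)) = p"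
        "(case p of (z, d) \<Rightarrow> (d, z / d)) \<in> ?G \<times> ?G"
        by auto
      show "(case case p of (z, d) \<Rightarrow> (d, z / d) of (x, y) \<Rightarrow> a x * b y) = (case p of (z, d) \<Rightarrow> of_real (gmangoldt d) * gterm m s z)"
        using p by (auto simp: a_def b_def gterm_mult)
    qed
    then show ?thesis using sab by (subst infsum_Sigma'_banach) auto
  qed
  also have "\<dots> = (\<Sum>\<^sub>\<infinity>z\<in>?G. 4 * (of_real (ln ((cmod z)\<^sup>2)) * gterm m s z))"
  proof (rule infsum_cong)
    fix z assume z: "z \<in> ?G"
    have "(\<Sum>\<^sub>\<infinity>d\<in>gdivs z. of_real (gmangoldt d) * gterm m s z) = of_real (\<Sum>d\<in>gdivs z. gmangoldt d) * gterm m s z"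
      using finite_gdivs[of z] z by (simp add: sum_distrib_right)
    then show "(\<Sum>\<^sub>\<infinity>d\<in>gdivs z. of_real (gmangoldt d) * gterm m s z) = 4 * (of_real (ln ((cmod z)\<^sup>2)) * gterm m s z)"
      using gmangoldt_sum[of z] z by (simp del: of_real_sum)
  qed
  also have "\<dots> = 4 * (\<Sum>\<^sub>\<infinity>z\<in>?G. of_real (ln ((cmod z)\<^sup>2)) * gterm m s z)"
    by (rule infsum_cmult_right')
  finally show ?thesis .
qed

text \<open>Only the terms themselves need a majorant, not their derivatives: a uniform limit of
  holomorphic functions may be differentiated termwise.\<close>

lemma infsum_has_field_derivative:
  fixes f f' :: "'a \<Rightarrow> complex \<Rightarrow> complex"
  assumes r: "r > 0" and M: "M summable_on A"
    and bound: "\<And>z s. z \<in> A \<Longrightarrow> s \<in> cball s0 r \<Longrightarrow> norm (f z s) \<le> M z"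
    and der: "\<And>z s. z \<in> A \<Longrightarrow> s \<in> cball s0 r \<Longrightarrow> (f z has_field_derivative f' z s) (at s)"
  obtains D where "((\<lambda>s. \<Sum>\<^sub>\<infinity>z\<in>A. f z s) has_field_derivative D) (at s0)" "((\<lambda>z. f' z s0) has_sum D) A"
proof -
  have ul: "uniform_limit (cball s0 r) (\<lambda>X s. \<Sum>z\<in>X. f z s) (\<lambda>s. \<Sum>\<^sub>\<infinity>z\<in>A. f z s) (finite_subsets_at_top A)"
    by (rule Weierstrass_m_test_general[where M = M]) (use bound M in auto)
  have "\<forall>\<^sub>F X in finite_subsets_at_top A. continuous_on (cball s0 r) (\<lambda>s. \<Sum>z\<in>X. f z s) \<and>
      (\<forall>w\<in>ball s0 r. ((\<lambda>s. \<Sum>z\<in>X. f z s) has_field_derivative (\<Sum>z\<in>X. f' z w)) (at w))"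
  proof (rule eventually_finite_subsets_at_top_weakI, intro conjI ballI)
    fix X assume X: "finite X" "X \<subseteq> A"
    show "continuous_on (cball s0 r) (\<lambda>s. \<Sum>z\<in>X. f z s)"
    proof (intro continuous_intros)
      fix z assume "z \<in> X"
      then show "continuous_on (cball s0 r) (f z)"
        using X der by (intro continuous_at_imp_continuous_on ballI) (blast intro: DERIV_isCont)
    qed
    show "((\<lambda>s. \<Sum>z\<in>X. f z s) has_field_derivative (\<Sum>z\<in>X. f' z w)) (at w)" if "w \<in> ball s0 r" for w
      using X that by (intro DERIV_sum der) auto
  qed
  from has_complex_derivative_uniform_limit[OF this ul _ r]
  obtain g' where g': "\<And>w. w \<in> ball s0 r \<Longrightarrow> ((\<lambda>s. \<Sum>\<^sub>\<infinity>z\<in>A. f z s) has_field_derivative (g' w)) (at w) \<and>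
      ((\<lambda>X. \<Sum>z\<in>X. f' z w) \<longlongrightarrow> g' w) (finite_subsets_at_top A)"
    by auto
  show ?thesis using g'[of s0] r that[of "g' s0"] by (auto simp: has_sum_def)
qed

lemma gterm_has_field_derivative:
  assumes "z \<noteq> 0"
  shows "((\<lambda>s. gterm m s z) has_field_derivative (- (of_real (ln ((cmod z)\<^sup>2)) * gterm m s z))) (at s)"
proof -
  have p: "(cmod z)\<^sup>2 > 0" using assms by simp
  have "complex_of_real ((cmod z)\<^sup>2) \<noteq> 0" using assms by simp
  then show ?thesis unfolding gterm_def powr_def using p Ln_of_real[OF p]
    by (auto intro!: derivative_eq_intros simp: mult_ac simp del: of_real_power)
qed

lemma gL_has_field_derivative:
  assumes s: "Re s > 1"
  shows "(gL m has_field_derivative (- (gP m s * gL m s / 4))) (at s)"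
proof -
  define r where "r = (Re s - 1) / 2"
  have r: "r > 0" "Re s - r > 1" using s by (auto simp: r_def field_simps)
  obtain D where D: "((\<lambda>s. \<Sum>\<^sub>\<infinity>z\<in>GI - {0}. gterm m s z) has_field_derivative D) (at s)"
    "((\<lambda>z. - (of_real (ln ((cmod z)\<^sup>2)) * gterm m s z)) has_sum D) (GI - {0})"
  proof (rule infsum_has_field_derivative[OF r(1), where A = "GI - {0}" and f = "\<lambda>z s. gterm m s z"
      and f' = "\<lambda>z s. - (of_real (ln ((cmod z)\<^sup>2)) * gterm m s z)" and M = "\<lambda>z. (cmod z)\<^sup>2 powr (- (Re s - r))"])
    show "(\<lambda>z. (cmod z)\<^sup>2 powr (- (Re s - r))) summable_on GI - {0}"
      by (rule summable_on_subset_banach[OF summable_on_GI_powr[OF r(2)]]) auto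
    fix z w assume z: "z \<in> GI - {0}" and w: "w \<in> cball s r"
    have "Re s - r \<le> Re w" using w abs_Re_le_cmod[of "s - w"] by (auto simp: dist_norm)
    then show "norm (gterm m w z) \<le> (cmod z)\<^sup>2 powr (- (Re s - r))"
      unfolding norm_gterm using GI_cmod_ge_1[of z] z by (intro powr_mono) auto
    show "((\<lambda>s. gterm m s z) has_field_derivative (- (of_real (ln ((cmod z)\<^sup>2)) * gterm m w z))) (at w)"
      using z by (intro gterm_has_field_derivative) auto
  qed blast
  have "D = - (\<Sum>\<^sub>\<infinity>z\<in>GI - {0}. of_real (ln ((cmod z)\<^sup>2)) * gterm m s z)"
    using infsumI[OF D(2)] by (simp add: infsum_uminus)
  also have "\<dots> = - (gP m s * gL m s / 4)" using gP_times_gL[OF s, of m] by simp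
  finally show ?thesis using D(1) by (simp add: gL_nonzero_sum[abs_def])
qed

section \<open>Continuation beyond the half-plane of convergence\<close>

definition gw :: "nat \<Rightarrow> complex" where "gw c = of_nat c + \<i>"

lemma gw_GI [simp]: "gw c \<in> GI" by (simp add: gw_def)

lemma cmod_gw: "(cmod (gw c))\<^sup>2 = real (c\<^sup>2 + 1)"
  by (simp add: gw_def cmod_power2)

lemma cmod_gw_ge_1: "cmod (gw c) \<ge> 1"
  by (rule GI_cmod_ge_1) (auto simp: gw_def complex_eq_iff)

text \<open>Modulo c + i one has i = -c, so a + b i is congruent to the rational integer a - b c,
  and its class depends only on a - b c modulo the norm c^2 + 1.\<close>

lemma gw_residues:
  "bij_betw (\<lambda>(z, r). gw c * z + of_nat r) (GI \<times> {..c\<^sup>2}) GI"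
proof -
  define M :: int where "M = int c ^ 2 + 1"
  have M: "M > 0" by (simp add: M_def add_nonneg_pos)
  have "inj_on (\<lambda>(z, r). gw c * z + of_nat r) (GI \<times> {..c\<^sup>2})"
  proof (rule inj_onI)
    fix p p'
    assume p: "p \<in> GI \<times> {..c\<^sup>2}" "p' \<in> GI \<times> {..c\<^sup>2}"
      "(case p of (z, r) \<Rightarrow> gw c * z + of_nat r) = (case p' of (z, r) \<Rightarrow> gw c * z + of_nat r)"
    obtain z r z' r' where pp: "p = (z, r)" "p' = (z', r')" by (cases p; cases p') auto
    have z: "z \<in> GI" "z' \<in> GI" and r: "r \<in> {..c\<^sup>2}" "r' \<in> {..c\<^sup>2}"
      and eq: "gw c * z + of_nat r = gw c * z' + of_nat r'"
      using p by (auto simp: pp)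
    obtain x y x' y' where xy: "z = Complex (of_int x) (of_int y)" "z' = Complex (of_int x') (of_int y')"
      using z GI_Complex by metis
    have "real_of_int (int c * x - y + int r) = real_of_int (int c * x' - y' + int r')"
      "real_of_int (x + int c * y) = real_of_int (x' + int c * y')"
      using arg_cong[OF eq, of Re] arg_cong[OF eq, of Im] by (simp_all add: xy gw_def)
    then have e: "int c * x - y + int r = int c * x' - y' + int r'" "x + int c * y = x' + int c * y'"
      unfolding of_int_eq_iff by auto
    then have x: "x - x' = int c * (y' - y)" by (simp add: algebra_simps)
    have "int r - int r' = int c * (x' - x) + (y - y')" using e(1) by (simp add: algebra_simps)
    also have "x' - x = int c * (y - y')" using x by (simp add: algebra_simps)
    finally have d: "int r - int r' = M * (y - y')" by (simp add: M_def algebra_simps power2_eq_square)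
    have "int r \<le> M - 1" "int r' \<le> M - 1" using r by (auto simp: M_def simp flip: of_nat_power)
    then have "\<bar>int r - int r'\<bar> < M" by linarith
    then have "M * \<bar>y - y'\<bar> < M * 1" unfolding d using M by (simp add: abs_mult)
    then have "y = y'" using M by (simp only: mult_less_cancel_left_pos)
    then show "p = p'" using x d xy pp by simp
  qed
  moreover have "(\<lambda>(z, r). gw c * z + of_nat r) ` (GI \<times> {..c\<^sup>2}) = GI"
  proof
    show "(\<lambda>(z, r). gw c * z + of_nat r) ` (GI \<times> {..c\<^sup>2}) \<subseteq> GI" by auto
    show "GI \<subseteq> (\<lambda>(z, r). gw c * z + of_nat r) ` (GI \<times> {..c\<^sup>2})"
    proof
      fix u assume "u \<in> GI"
      then obtain a b where u: "u = Complex (of_int a) (of_int b)" using GI_Complex by auto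
      \<comment> \<open>Comparing real and imaginary parts of a + b i = (c + i)(x + y i) + r gives b
        = x + c y and a - c b = r - M y. So r is the remainder and -y the quotient of a - c b by
        M.\<close>
      define y where "y = - ((a - int c * b) div M)"
      define r where "r = nat ((a - int c * b) mod M)"
      define x where "x = b - int c * y"
      have rM: "int r = (a - int c * b) mod M" using M by (simp add: r_def)
      have "int r < M" unfolding rM using M by simp
      then have "int r \<le> int (c\<^sup>2)" by (simp add: M_def)
      then have r: "r \<in> {..c\<^sup>2}" by (simp only: atMost_iff of_nat_le_iff)
      have "a - int c * b = M * (- y) + int r" unfolding rM y_def by simp
      then have a: "a = int c * x - y + int r" by (simp add: x_def M_def algebra_simps power2_eq_square)
      have b: "b = x + int c * y" by (simp add: x_def)
      have "u = gw c * Complex (of_int x) (of_int y) + of_nat r"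
        unfolding u by (simp add: complex_eq_iff gw_def a b)
      moreover have "Complex (of_int x) (of_int y) \<in> GI" using GI_Complex by blast
      ultimately show "u \<in> (\<lambda>(z, r). gw c * z + of_nat r) ` (GI \<times> {..c\<^sup>2})"
        using r by (intro rev_image_eqI[of "(Complex (of_int x) (of_int y), r)"]) auto
    qed
  qed
  ultimately show ?thesis by (simp add: bij_betw_def)
qed

text \<open>Mean value inequality on the ray from t to infinity, where the derivative of z^(-s) is
  largest in absolute value at t.\<close>

lemma norm_powr_diff_le:
  assumes x: "x \<ge> t" and y: "y \<ge> t" and t: "t > 0" and s: "Re s \<ge> 0"
  shows "norm ((of_real x :: complex) powr (- s) - of_real y powr (- s)) \<le> norm s * t powr (- Re s - 1) * \<bar>x - y\<bar>"
proof -
  let ?S = "complex_of_real ` {t..}"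
  have "norm ((of_real x :: complex) powr (- s) - of_real y powr (- s)) \<le>
      norm s * t powr (- Re s - 1) * norm (complex_of_real x - of_real y)"
  proof (rule field_differentiable_bound[where S = ?S and f' = "\<lambda>z. - s * z powr (- s - 1)"])
    show "convex ?S" by (rule convex_linear_image) (auto simp: linear_of_real)
    fix z assume "z \<in> ?S"
    then obtain v where v: "z = of_real v" "v \<ge> t" by auto
    have "z \<notin> \<real>\<^sub>\<le>\<^sub>0" using v t by (auto simp: complex_nonpos_Reals_iff)
    then show "((\<lambda>z. z powr (- s)) has_field_derivative (- s * z powr (- s - 1))) (at z within ?S)"
      by (rule has_field_derivative_at_within[OF has_field_derivative_powr])
    have "norm (z powr (- s - 1)) = v powr (- Re s - 1)"
      using v t by (subst norm_powr_real_powr) auto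
    also have "\<dots> \<le> t powr (- Re s - 1)" using v t s by (intro powr_mono2') auto
    finally show "norm (- s * z powr (- s - 1)) \<le> norm s * t powr (- Re s - 1)"
      by (simp add: norm_mult mult_left_mono)
  qed (use x y in auto)
  also have "norm (complex_of_real x - of_real y) = \<bar>x - y\<bar>"
    by (metis norm_of_real of_real_diff)
  finally show ?thesis .
qed

lemma norm_sgn_diff_le:
  fixes u v :: complex
  assumes "u \<noteq> 0" "v \<noteq> 0"
  shows "norm (v / of_real (cmod v) - u / of_real (cmod u)) \<le> 2 * norm (v - u) / norm u"
proof -
  have "v / of_real (cmod v) - u / of_real (cmod u)
      = (v * of_real (cmod u - cmod v) + of_real (cmod v) * (v - u)) / (of_real (cmod v) * of_real (cmod u))"
    using assms by (simp add: field_simps)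
  also have "norm \<dots> = norm (v * of_real (cmod u - cmod v) + of_real (cmod v) * (v - u)) / (norm v * norm u)"
    by (simp add: norm_divide norm_mult)
  also have "\<dots> \<le> (norm v * norm (v - u) + norm v * norm (v - u)) / (norm v * norm u)"
  proof (rule divide_right_mono)
    have "norm (v * of_real (cmod u - cmod v)) \<le> norm v * norm (v - u)"
      unfolding norm_mult norm_of_real
      by (intro mult_left_mono) (auto simp: norm_minus_commute intro: norm_triangle_ineq3)
    moreover have "norm (of_real (cmod v) * (v - u)) = norm v * norm (v - u)" by (simp add: norm_mult)
    ultimately show "norm (v * of_real (cmod u - cmod v) + of_real (cmod v) * (v - u)) \<le> norm v * norm (v - u) + norm v * norm (v - u)"
      by (intro order.trans[OF norm_triangle_ineq]) auto
  qed auto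
  also have "\<dots> = 2 * norm (v - u) / norm u" using assms by (simp add: field_simps)
  finally show ?thesis .
qed

text \<open>A bounded shift changes the direction and the relative size of u by O(1/|u|), which
  gains one factor |u| over the size of the term. The resulting exponent is summable over the
  lattice as soon as \<sigma>1 > 1/2.\<close>

lemma gterm_shift_bound:
  fixes a \<sigma>1 \<sigma>2 B :: real
  assumes \<sigma>1: "\<sigma>1 > 0" and a: "a > 0"
  obtains C where "C \<ge> 0" "\<And>s u v. \<sigma>1 \<le> Re s \<Longrightarrow> Re s \<le> \<sigma>2 \<Longrightarrow> norm s \<le> B \<Longrightarrow> u \<in> GI \<Longrightarrow> u \<noteq> 0 \<Longrightarrow>
     v \<in> GI \<Longrightarrow> norm (v - u) \<le> a \<Longrightarrow> norm (gterm m s v - gterm m s u) \<le> C * norm u powr (- 2 * \<sigma>1 - 1)"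
proof -
  \<comment> \<open>\<open>C1\<close> accounts for the change of the character and \<open>C2\<close>
    for the change of the norm power when |u| >= 2 a; \<open>C3\<close> covers smaller u, where each
    of the two terms has absolute value at most 1.\<close>
  define C1 where "C1 = real (4 * m) * (2 * a) * 4 powr \<sigma>2"
  define C2 where "C2 = \<bar>B\<bar> * 4 powr (\<sigma>2 + 1) * (3 * a)"
  define C3 where "C3 = 2 * (2 * a) powr (2 * \<sigma>1 + 1)"
  have nn: "C1 \<ge> 0" "C2 \<ge> 0" "C3 \<ge> 0" using a by (auto simp: C1_def C2_def C3_def)
  show ?thesis
  proof (rule that[of "C1 + C2 + C3"])
    show "C1 + C2 + C3 \<ge> 0" using nn by simp
    fix s u v
    assume s: "\<sigma>1 \<le> Re s" "Re s \<le> \<sigma>2" "norm s \<le> B" and u: "u \<in> GI" "u \<noteq> 0" and v: "v \<in> GI" "norm (v - u) \<le> a"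
    define d where "d = norm u powr (- 2 * \<sigma>1 - 1)"
    have d0: "d \<ge> 0" by (simp add: d_def)
    have u1: "norm u \<ge> 1" using GI_cmod_ge_1 u by blast
    show "norm (gterm m s v - gterm m s u) \<le> (C1 + C2 + C3) * norm u powr (- 2 * \<sigma>1 - 1)"
    proof (cases "norm u < 2 * a")
      case True
      have g1: "norm (gterm m s z) \<le> 1" if "z \<in> GI" for z
      proof (cases "z = 0")
        case False
        then have "(cmod z)\<^sup>2 \<ge> 1" using GI_cmod_ge_1 that by simp
        then have "(cmod z)\<^sup>2 powr (- Re s) \<le> (cmod z)\<^sup>2 powr 0" using s \<sigma>1 by (intro powr_mono) auto
        then show ?thesis using False by (simp add: norm_gterm)
      qed auto
      have "norm (gterm m s v - gterm m s u) \<le> 2"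
        using norm_triangle_ineq4[of "gterm m s v" "gterm m s u"] g1[OF u(1)] g1[OF v(1)] by linarith
      also have "\<dots> = C3 * (2 * a) powr (- 2 * \<sigma>1 - 1)"
        using a by (simp add: C3_def powr_add[symmetric] mult.assoc)
      also have "\<dots> \<le> C3 * d" unfolding d_def using True u1 \<sigma>1 nn by (intro mult_left_mono powr_mono2') auto
      also have "\<dots> \<le> (C1 + C2 + C3) * d" using nn d0 by (intro mult_right_mono) auto
      finally show ?thesis by (simp add: d_def)
    next
      case False
      have vu: "norm v \<ge> norm u / 2" "norm v \<le> 3 / 2 * norm u"
        using False v(2) norm_triangle_ineq2[of u v] norm_triangle_ineq2[of v u] by (simp_all add: norm_minus_commute)
      have v0: "v \<noteq> 0" using vu u1 by auto
      define t where "t = (norm u / 2)\<^sup>2"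
      have t: "t > 0" "(norm v)\<^sup>2 \<ge> t" "(norm u)\<^sup>2 \<ge> t"
        using u1 vu unfolding t_def by (auto intro!: power_mono)
      have t4: "t = norm u powr 2 / 4" using u1 by (simp add: t_def power_divide)
      have tp: "t powr x = (norm u) powr (2 * x) * 4 powr (- x)" for x
        unfolding t4 by (subst powr_divide) (simp_all add: powr_powr powr_minus divide_inverse del: powr_numeral)
      have e1: "norm (gchi m v - gchi m u) \<le> real (4 * m) * (2 * a / norm u)"
      proof -
        have "norm (gchi m v - gchi m u) \<le> real (4 * m) * norm (v / of_real (cmod v) - u / of_real (cmod u))"
          unfolding gchi_def by (rule norm_power_diff) (use v0 u in \<open>auto simp: norm_divide\<close>)
        also have "\<dots> \<le> real (4 * m) * (2 * norm (v - u) / norm u)"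
          by (intro mult_left_mono norm_sgn_diff_le) (use v0 u in auto)
        also have "\<dots> \<le> real (4 * m) * (2 * a / norm u)"
          using v u1 by (intro mult_left_mono divide_right_mono) auto
        finally show ?thesis .
      qed
      have e2: "norm (of_real ((norm v)\<^sup>2) powr (- s)) \<le> 4 powr \<sigma>2 * norm u powr (- 2 * \<sigma>1)"
      proof -
        have "norm (of_real ((norm v)\<^sup>2) powr (- s)) = (norm v)\<^sup>2 powr (- Re s)"
          by (subst norm_powr_real_powr) auto
        also have "\<dots> \<le> t powr (- Re s)" using t s \<sigma>1 by (intro powr_mono2') auto
        also have "\<dots> = 4 powr (Re s) * norm u powr (- 2 * Re s)" by (simp add: tp)
        also have "\<dots> \<le> 4 powr \<sigma>2 * norm u powr (- 2 * \<sigma>1)" using s u1 by (intro mult_mono[OF powr_mono powr_mono]) auto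
        finally show ?thesis .
      qed
      have e3: "norm (of_real ((norm v)\<^sup>2) powr (- s) - of_real ((norm u)\<^sup>2) powr (- s)) \<le> C2 * d"
      proof -
        have "\<bar>(norm v)\<^sup>2 - (norm u)\<^sup>2\<bar> = \<bar>norm v - norm u\<bar> * (norm v + norm u)"
          by (simp add: power2_eq_square square_diff_square_factored abs_mult mult.commute)
        also have "\<dots> \<le> a * (3 * norm u)"
          using norm_triangle_ineq3[of v u] v vu a by (intro mult_mono) auto
        finally have du: "\<bar>(norm v)\<^sup>2 - (norm u)\<^sup>2\<bar> \<le> a * (3 * norm u)" .
        have "norm (of_real ((norm v)\<^sup>2) powr (- s) - of_real ((norm u)\<^sup>2) powr (- s))
            \<le> norm s * t powr (- Re s - 1) * \<bar>(norm v)\<^sup>2 - (norm u)\<^sup>2\<bar>"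
          by (rule norm_powr_diff_le) (use t s \<sigma>1 in auto)
        also have "\<dots> \<le> \<bar>B\<bar> * t powr (- Re s - 1) * (a * (3 * norm u))"
          using du s by (intro mult_mono) auto
        also have "t powr (- Re s - 1) = norm u powr (2 * (- Re s - 1)) * 4 powr (Re s + 1)"
          by (simp add: tp add.commute)
        also have "\<bar>B\<bar> * (norm u powr (2 * (- Re s - 1)) * 4 powr (Re s + 1)) * (a * (3 * norm u))
           = \<bar>B\<bar> * 4 powr (Re s + 1) * (3 * a) * (norm u powr (2 * (- Re s - 1)) * norm u powr 1)"
          using u1 by simp
        also have "norm u powr (2 * (- Re s - 1)) * norm u powr 1 = norm u powr (- 2 * Re s - 1)"
          by (subst powr_add[symmetric], rule arg_cong2[of _ _ _ _ "(powr)"]) simp_all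
        also have "\<bar>B\<bar> * 4 powr (Re s + 1) * (3 * a) * norm u powr (- 2 * Re s - 1) \<le> C2 * d"
          unfolding C2_def d_def using s u1 a by (intro mult_mono powr_mono) auto
        finally show ?thesis .
      qed
      have "gterm m s v - gterm m s u = (gchi m v - gchi m u) * of_real ((norm v)\<^sup>2) powr (- s)
          + gchi m u * (of_real ((norm v)\<^sup>2) powr (- s) - of_real ((norm u)\<^sup>2) powr (- s))"
        by (simp add: gterm_def algebra_simps)
      also have "norm \<dots> \<le> real (4 * m) * (2 * a / norm u) * (4 powr \<sigma>2 * norm u powr (- 2 * \<sigma>1)) + 1 * (C2 * d)"
        by (rule order.trans[OF norm_triangle_ineq], unfold norm_mult, rule add_mono;
            (rule mult_mono; (rule e1 e2 e3)?; (use a u1 norm_gchi[OF u(2)] in simp)?))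
      also have "real (4 * m) * (2 * a / norm u) * (4 powr \<sigma>2 * norm u powr (- 2 * \<sigma>1)) = C1 * (norm u powr (- 2 * \<sigma>1) * norm u powr (-1))"
        using u1 by (simp add: C1_def powr_minus field_simps)
      also have "norm u powr (- 2 * \<sigma>1) * norm u powr (-1) = d" unfolding d_def by (subst powr_add[symmetric]) simp
      finally have "norm (gterm m s v - gterm m s u) \<le> (C1 + C2) * d" by (simp add: algebra_simps)
      also have "\<dots> \<le> (C1 + C2 + C3) * d" using nn d0 by (intro mult_right_mono) auto
      finally show ?thesis by (simp add: d_def)
    qed
  qed
qed

text \<open>The \<open>c\<^sup>2 + 1\<close> translates of \<open>(c + i)\<int>[i]\<close> by \<open>0, \<dots>, c\<^sup>2\<close> cover the lattice. Replacing a translate by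
  the sublattice itself gains a factor \<open>1/|z|\<close> in each term, so the total error converges for \<open>Re s > 1/2\<close>.\<close>

definition gH :: "nat \<Rightarrow> nat \<Rightarrow> complex \<Rightarrow> complex" where
  "gH m c s = (\<Sum>\<^sub>\<infinity>z\<in>GI. \<Sum>r\<le>c\<^sup>2. gterm m s (gw c * z + of_nat r) - gterm m s (gw c * z))"

text \<open>The translates together give the full series. Each of the c^2 + 1 copies of the
  sublattice gives \<open>gterm m s (gw c)\<close> times the series by multiplicativity, and c^2 + 1
  is the norm N of c + i, whence N * N^(-s) = N^(1-s).\<close>

lemma gH_eq:
  assumes s: "Re s > 1"
  shows "gH m c s = (1 - gchi m (gw c) * of_real ((cmod (gw c))\<^sup>2) powr (1 - s)) * gL m s"
proof -
  have sm: "gterm m s summable_on GI" by (rule abs_summable_summable[OF gterm_abs_summable[OF s]])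
  have bij: "bij_betw (\<lambda>(z, r). gw c * z + of_nat r) (GI \<times> {..c\<^sup>2}) GI" by (rule gw_residues)
  have sm2: "(\<lambda>p. gterm m s (case p of (z, r) \<Rightarrow> gw c * z + of_nat r)) summable_on (GI \<times> {..c\<^sup>2})"
    using summable_on_reindex_bij_betw[OF bij, of "gterm m s"] sm by simp
  then have sm2': "(\<lambda>(z, r). gterm m s (gw c * z + of_nat r)) summable_on (GI \<times> {..c\<^sup>2})"
    by (simp add: case_prod_unfold)
  have "gL m s = (\<Sum>\<^sub>\<infinity>p\<in>GI \<times> {..c\<^sup>2}. gterm m s (case p of (z, r) \<Rightarrow> gw c * z + of_nat r))"
    unfolding gL_def using infsum_reindex_bij_betw[OF bij, of "gterm m s"] by simp
  also have "\<dots> = (\<Sum>\<^sub>\<infinity>(z, r)\<in>GI \<times> {..c\<^sup>2}. gterm m s (gw c * z + of_nat r))"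
    by (simp add: case_prod_unfold)
  also have "\<dots> = (\<Sum>\<^sub>\<infinity>z\<in>GI. \<Sum>\<^sub>\<infinity>r\<in>{..c\<^sup>2}. gterm m s (gw c * z + of_nat r))"
    using infsum_Sigma'_banach[OF sm2'] by simp
  finally have A: "gL m s = (\<Sum>\<^sub>\<infinity>z\<in>GI. \<Sum>r\<le>c\<^sup>2. gterm m s (gw c * z + of_nat r))" by simp
  have smA: "(\<lambda>z. \<Sum>r\<le>c\<^sup>2. gterm m s (gw c * z + of_nat r)) summable_on GI"
    using summable_on_Sigma_banach[OF sm2'] by simp
  have B: "(\<lambda>z. \<Sum>r\<le>c\<^sup>2. gterm m s (gw c * z)) = (\<lambda>z. (of_nat (c\<^sup>2 + 1) * gterm m s (gw c)) * gterm m s z)"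
    by (simp add: gterm_mult mult.assoc)
  have smB: "(\<lambda>z. \<Sum>r\<le>c\<^sup>2. gterm m s (gw c * z)) summable_on GI"
    unfolding B by (rule summable_on_cmult_right[OF sm])
  have N: "complex_of_real ((cmod (gw c))\<^sup>2) = of_nat (c\<^sup>2 + 1)"
    unfolding cmod_gw by (rule of_real_of_nat_eq)
  have p1: "of_nat (c\<^sup>2 + 1) * gterm m s (gw c) = gchi m (gw c) * of_real ((cmod (gw c))\<^sup>2) powr (1 - s)"
    unfolding gterm_def N by (simp add: powr_diff powr_minus field_simps del: of_nat_add of_nat_power)
  have "gH m c s = gL m s - (\<Sum>\<^sub>\<infinity>z\<in>GI. \<Sum>r\<le>c\<^sup>2. gterm m s (gw c * z))"
    unfolding gH_def A sum_subtractf unfolding diff_conv_add_uminus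
    by (rule infsumI, intro has_sum_add has_sum_infsum smA has_sum_uminusI smB)
  also have "(\<Sum>\<^sub>\<infinity>z\<in>GI. \<Sum>r\<le>c\<^sup>2. gterm m s (gw c * z)) = (of_nat (c\<^sup>2 + 1) * gterm m s (gw c)) * gL m s"
    unfolding B gL_def by (rule infsum_cmult_right')
  finally show ?thesis unfolding p1 by (simp add: algebra_simps)
qed

lemma gterm_field_differentiable: "\<exists>D. ((\<lambda>s. gterm m s z) has_field_derivative D) (at s)"
proof (cases "z = 0")
  case True
  then show ?thesis by (auto intro!: exI[of _ 0])
next
  case False
  then show ?thesis using gterm_has_field_derivative by blast
qed

text \<open>By \<open>gterm_shift_bound\<close> the terms are dominated by a multiple of the norm to
  the power -(\<sigma>1 + 1/2), locally uniformly in s, and this exponent is below -1.\<close>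

lemma gH_holomorphic: "gH m c holomorphic_on {s. Re s > 1 / 2}"
proof (rule holomorphic_onI)
  fix s0 assume "s0 \<in> {s. Re s > 1 / 2}"
  then have s0: "Re s0 > 1 / 2" by simp
  define r where "r = (Re s0 - 1 / 2) / 2"
  define \<sigma>1 where "\<sigma>1 = Re s0 - r"
  have r: "r > 0" "\<sigma>1 > 1 / 2" using s0 by (auto simp: r_def \<sigma>1_def field_simps)
  define a where "a = real (c\<^sup>2 + 1)"
  obtain C where C: "C \<ge> 0" "\<And>s u v. \<sigma>1 \<le> Re s \<Longrightarrow> Re s \<le> Re s0 + r \<Longrightarrow> norm s \<le> norm s0 + r \<Longrightarrow> u \<in> GI \<Longrightarrow> u \<noteq> 0 \<Longrightarrow>
     v \<in> GI \<Longrightarrow> norm (v - u) \<le> a \<Longrightarrow> norm (gterm m s v - gterm m s u) \<le> C * norm u powr (- 2 * \<sigma>1 - 1)"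
    by (rule gterm_shift_bound[of \<sigma>1 a "Re s0 + r" "norm s0 + r" m]) (use r in \<open>auto simp: a_def add_pos_nonneg\<close>)
  define f where "f z s = (\<Sum>r\<le>c\<^sup>2. gterm m s (gw c * z + of_nat r) - gterm m s (gw c * z))" for z s
  obtain g' where g': "\<And>z s. ((\<lambda>s. gterm m s z) has_field_derivative g' z s) (at s)"
    using gterm_field_differentiable[of m] by metis
  define f' where "f' z s = (\<Sum>r\<le>c\<^sup>2. g' (gw c * z + of_nat r) s - g' (gw c * z) s)" for z s
  have f': "(f z has_field_derivative f' z s) (at s)" for z s
    unfolding f_def f'_def by (intro DERIV_sum DERIV_diff g')
  define K where "K = real (c\<^sup>2 + 1) * C"
  have K: "K \<ge> 0" using C by (simp add: K_def)
  \<comment> \<open>The shift bound says nothing at z = 0. There every summand has absolute value at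
    most 1, which gives the separate value c^2 + 1.\<close>
  define M where "M z = (if z = 0 then real (c\<^sup>2 + 1) else K * (cmod z)\<^sup>2 powr (- (\<sigma>1 + 1 / 2)))" for z
  have "(\<lambda>z. K * (cmod z)\<^sup>2 powr (- (\<sigma>1 + 1 / 2))) summable_on GI - {0}"
    by (intro summable_on_cmult_right summable_on_subset_banach[OF summable_on_GI_powr]) (use r in auto)
  then have "M summable_on GI - {0}"
    by (rule summable_on_cong[THEN iffD1, rotated]) (auto simp: M_def)
  then have "M summable_on insert 0 (GI - {0})" by (subst summable_on_insert_iff)
  then have M: "M summable_on GI" by (simp add: insert_absorb)
  obtain D where "((\<lambda>s. \<Sum>\<^sub>\<infinity>z\<in>GI. f z s) has_field_derivative D) (at s0)"
  proof (rule infsum_has_field_derivative[OF r(1) M, of s0 f f'])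
    fix z s assume z: "z \<in> GI" and s: "s \<in> cball s0 r"
    have Res: "\<sigma>1 \<le> Re s" "Re s \<le> Re s0 + r" using s abs_Re_le_cmod[of "s0 - s"] by (auto simp: dist_norm \<sigma>1_def)
    have ns: "norm s \<le> norm s0 + r" using s norm_triangle_ineq2[of s s0] by (auto simp: dist_norm norm_minus_commute)
    show "norm (f z s) \<le> M z"
    proof (cases "z = 0")
      case True
      have "norm (gterm m s (of_nat r)) \<le> 1" for r :: nat
      proof (cases "r = 0")
        case False
        then have "(cmod (of_nat r))\<^sup>2 powr (- Re s) \<le> (cmod (of_nat r))\<^sup>2 powr 0"
          using Res r by (intro powr_mono) auto
        then show ?thesis using False by (simp add: norm_gterm)
      qed auto
      then have "norm (f z s) \<le> (\<Sum>r\<le>c\<^sup>2. 1)" unfolding f_def True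
        by (intro order.trans[OF norm_sum] sum_mono) auto
      then show ?thesis by (simp add: M_def True)
    next
      case False
      define u where "u = gw c * z"
      have u: "u \<in> GI" "u \<noteq> 0" "norm u \<ge> norm z" "norm z \<ge> 1"
        using False z cmod_gw_ge_1[of c] GI_cmod_ge_1[of z] by (auto simp: u_def norm_mult mult_le_cancel_right1)
      have "norm (gterm m s (u + of_nat r) - gterm m s u) \<le> C * norm u powr (- 2 * \<sigma>1 - 1)" if "r \<le> c\<^sup>2" for r :: nat
        using that by (intro C(2) Res ns u) (use u in \<open>auto simp: a_def simp flip: of_nat_power\<close>)
      then have "norm (f z s) \<le> (\<Sum>r\<le>c\<^sup>2. C * norm u powr (- 2 * \<sigma>1 - 1))" unfolding f_def u_def[symmetric]
        by (intro order.trans[OF norm_sum] sum_mono) auto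
      also have "\<dots> = K * norm u powr (- 2 * \<sigma>1 - 1)" by (simp add: K_def algebra_simps)
      also have "\<dots> \<le> K * norm z powr (- 2 * \<sigma>1 - 1)"
        using u r K by (intro mult_left_mono powr_mono2') auto
      also have "norm z powr (- 2 * \<sigma>1 - 1) = (norm z powr 2) powr (- (\<sigma>1 + 1 / 2))"
        by (simp add: powr_powr algebra_simps del: powr_numeral)
      also have "norm z powr 2 = (cmod z)\<^sup>2" using u by simp
      finally show ?thesis using False by (simp add: M_def)
    qed
  qed (use f' in auto)
  then have "(gH m c has_field_derivative D) (at s0)" by (simp add: f_def gH_def[abs_def])
  then show "gH m c field_differentiable (at s0 within {s. Re s > 1 / 2})"
    using field_differentiable_at_within field_differentiable_def by blast
qed

text \<open>The square of 2 + i is 3 + 4 i, and 3 + 4 i is idempotent modulo 5. Hence the imaginary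
  part of a positive even power is never 0.\<close>

lemma two_plus_i_power:
  assumes "n > 0"
  shows "\<exists>a b :: int. (2 + \<i>) ^ (2 * n) = Complex (of_int a) (of_int b) \<and> [a = 3] (mod 5) \<and> [b = 4] (mod 5)"
  using assms
proof (induction n rule: nat_induct_non_zero)
  case 1
  show ?case by (intro exI[of _ 3] exI[of _ 4]) (simp add: power2_eq_square complex_eq_iff)
next
  case (Suc n)
  then obtain a b :: int where ab: "(2 + \<i>) ^ (2 * n) = Complex (of_int a) (of_int b)" "[a = 3] (mod 5)" "[b = 4] (mod 5)"
    by auto
  have "(2 + \<i>) ^ (2 * Suc n) = Complex (of_int a) (of_int b) * (2 + \<i>)\<^sup>2"
    by (simp add: ab(1)[symmetric] power_add[symmetric])
  also have "\<dots> = Complex (of_int (3 * a - 4 * b)) (of_int (4 * a + 3 * b))"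
    by (simp add: complex_eq_iff power2_eq_square)
  finally have "(2 + \<i>) ^ (2 * Suc n) = Complex (of_int (3 * a - 4 * b)) (of_int (4 * a + 3 * b))" .
  moreover have "[3 * a - 4 * b = 3 * 3 - 4 * 4] (mod 5)" by (intro cong_diff cong_mult cong_refl ab)
  moreover have "[4 * a + 3 * b = 4 * 3 + 3 * 4] (mod 5)" by (intro cong_add cong_mult cong_refl ab)
  ultimately have "(2 + \<i>) ^ (2 * Suc n) = Complex (of_int (3 * a - 4 * b)) (of_int (4 * a + 3 * b))"
      "[3 * a - 4 * b = 3] (mod 5)" "[4 * a + 3 * b = 4] (mod 5)"
    by (simp_all add: cong_def)
  then show ?case by blast
qed

lemma gchi_2_plus_i: assumes "m > 0" shows "gchi m (2 + \<i>) \<noteq> 1"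
proof
  assume "gchi m (2 + \<i>) = 1"
  then have "(2 + \<i>) ^ (4 * m) = complex_of_real (cmod (2 + \<i>) ^ (4 * m))"
    by (simp add: gchi_def power_divide complex_eq_iff)
  then have "Im ((2 + \<i>) ^ (4 * m)) = 0" by (simp only: Im_complex_of_real)
  moreover obtain a b :: int where "(2 + \<i>) ^ (2 * (2 * m)) = Complex (of_int a) (of_int b)" "[b = 4] (mod 5)"
    using two_plus_i_power[of "2 * m"] assms by auto
  moreover have "2 * (2 * m) = 4 * m" by simp
  ultimately have "[0 = (4::int)] (mod 5)" by simp
  then show False by (simp add: cong_def)
qed

text \<open>For nonzero t the quotient of ln 2 and ln 5 would be rational, and a positive power of 2
  would equal a power of 5.\<close>

lemma powers_of_2_and_5_powr_I:
  fixes t :: real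
  assumes "cis (t * ln 2) = 1" "cis (t * ln 5) = 1" shows "t = 0"
proof (rule ccontr)
  assume t: "t \<noteq> 0"
  obtain j where j: "t * ln 2 = of_int (2 * j) * pi"
    using assms(1) unfolding cis_conv_exp exp_eq_1 by auto
  obtain k where k: "t * ln 5 = of_int (2 * k) * pi"
    using assms(2) unfolding cis_conv_exp exp_eq_1 by auto
  have "t * ln 2 * of_int k = t * ln 5 * of_int j" unfolding j k by simp
  then have e: "ln 2 * of_int k = ln 5 * (of_int j :: real)" using t by simp
  have "k \<noteq> 0" using k t by auto
  have "ln (2::real) > 0" "ln (5::real) > 0" by auto
  then have "ln 2 * \<bar>of_int k\<bar> = ln 5 * \<bar>of_int j :: real\<bar>" using arg_cong[OF e, of abs] by (simp add: abs_mult)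
  then have "ln 2 * real (nat \<bar>k\<bar>) = ln 5 * real (nat \<bar>j\<bar>)" by simp
  then have "ln ((2::real) ^ nat \<bar>k\<bar>) = ln (5 ^ nat \<bar>j\<bar>)" by (simp add: ln_realpow mult.commute)
  then have "(2::real) ^ nat \<bar>k\<bar> = 5 ^ nat \<bar>j\<bar>" using arg_cong[of _ _ exp] by fastforce
  then have "real (2 ^ nat \<bar>k\<bar>) = real (5 ^ nat \<bar>j\<bar>)" by simp
  then have "(2::nat) ^ nat \<bar>k\<bar> = 5 ^ nat \<bar>j\<bar>" by (simp only: of_nat_eq_iff)
  then have "even ((5::nat) ^ nat \<bar>j\<bar>)" using \<open>k \<noteq> 0\<close> by (metis dvd_power zero_less_nat_eq zero_less_abs_iff)
  then show False by simp
qed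

text \<open>On \<open>s = 1 + it\<close>, the norms 2, 5, 10 and the relation \<open>3 + i = (1 + i)(2 - i)\<close> turn simultaneous equality
  for \<open>c = 1, 2, 3\<close> into \<open>4\<^bsup>it\<^esup> = 25\<^bsup>it\<^esup> = 1\<close>, so \<open>t = 0\<close>; then use that no power of \<open>2 + i\<close> is real.\<close>

lemma gw_not_all_one:
  assumes s: "Re s \<ge> 1" and ms: "m \<noteq> 0 \<or> s \<noteq> 1"
  shows "\<exists>c. gchi m (gw c) * of_real ((cmod (gw c))\<^sup>2) powr (1 - s) \<noteq> 1"
proof (rule ccontr)
  assume "\<not> ?thesis"
  then have all: "gchi m (gw c) * of_real ((cmod (gw c))\<^sup>2) powr (1 - s) = 1" for c by blast
  have a: "gchi m (gw 1) * 2 powr (1 - s) = 1" "gchi m (gw 2) * 5 powr (1 - s) = 1" "gchi m (gw 3) * 10 powr (1 - s) = 1"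
    using all[of 1] all[of 2] all[of 3] unfolding cmod_gw by simp_all
  have gw_ne: "gw c \<noteq> 0" for c by (simp add: gw_def complex_eq_iff)
  \<comment> \<open>Absolute values in the case c = 1 already force Re s = 1.\<close>
  have "norm (gchi m (gw 1) * 2 powr (1 - s)) = 1" using a(1) by simp
  then have "norm ((2::complex) powr (1 - s)) = 1" by (simp add: norm_mult norm_gchi gw_ne)
  moreover have "norm ((2::complex) powr (1 - s)) = 2 powr (1 - Re s)" by (subst norm_powr_real_powr) auto
  ultimately have "(2::real) powr (1 - Re s) = 2 powr 0" by simp
  then have "Re s = 1" by (simp only: powr_inj)
  define t where "t = - Im s"
  have s1: "1 - s = \<i> * of_real t" using \<open>Re s = 1\<close> by (simp add: complex_eq_iff t_def)
  have pw: "(of_real x :: complex) powr (1 - s) = cis (t * ln x)" if "x > 0" for x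
    using that unfolding s1 by (simp add: powr_def Ln_of_real cis_conv_exp mult_ac)
  have a': "gchi m (gw 1) * cis (t * ln 2) = 1" "gchi m (gw 2) * cis (t * ln 5) = 1" "gchi m (gw 3) * cis (t * ln 10) = 1"
    using a pw[of 2] pw[of 5] pw[of 10] by simp_all
  have l10: "cis (t * ln 10) = cis (t * ln 2) * cis (t * ln 5)"
    using ln_mult[of 2 "5::real"] by (simp add: cis_mult ring_distribs)
  \<comment> \<open>(1 + i)^2 = 2 i is a unit times a positive integer, and the character is trivial
    on both.\<close>
  have w1: "(gchi m (gw 1))\<^sup>2 = 1"
  proof -
    have "gw 1 * gw 1 = \<i> * of_nat 2" by (simp add: gw_def complex_eq_iff)
    then have "(gchi m (gw 1))\<^sup>2 = gchi m (\<i> * of_nat 2)" by (simp add: power2_eq_square gchi_mult[symmetric])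
    also have "\<dots> = 1" using gchi_unit[of \<i> m] by (simp add: gchi_mult gunit_iff) (simp add: gchi_def)
    finally show ?thesis .
  qed
  have w3: "gchi m (gw 3) * gchi m (gw 2) = gchi m (gw 1)"
  proof -
    have "gw 3 * gw 2 = gw 1 * of_nat 5" by (simp add: gw_def complex_eq_iff)
    then have "gchi m (gw 3) * gchi m (gw 2) = gchi m (gw 1 * of_nat 5)" by (simp add: gchi_mult[symmetric])
    also have "\<dots> = gchi m (gw 1)" by (simp add: gchi_mult) (simp add: gchi_def)
    finally show ?thesis .
  qed
  define X Y where "X = cis (t * ln 2)" and "Y = cis (t * ln 5)"
  have nz: "X \<noteq> 0" "Y \<noteq> 0" by (auto simp: X_def Y_def)
  have g: "gchi m (gw 1) = 1 / X" "gchi m (gw 2) = 1 / Y" "gchi m (gw 3) = 1 / (X * Y)"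
    using a' nz unfolding l10 X_def[symmetric] Y_def[symmetric] by (simp_all add: field_simps)
  have X2: "X\<^sup>2 = 1" using w1 nz unfolding g by (simp add: power_divide)
  have "1 / (X * Y) * (1 / Y) = 1 / X" using w3 unfolding g .
  then have Y2: "Y\<^sup>2 = 1" using nz by (simp add: field_simps power2_eq_square)
  have "cis (2 * t * ln 2) = 1" "cis (2 * t * ln 5) = 1"
    using X2 Y2 unfolding X_def Y_def Complex.DeMoivre by (simp_all add: mult_ac)
  then have "2 * t = 0" by (rule powers_of_2_and_5_powr_I)
  then have t0: "t = 0" by simp
  then have "gchi m (2 + \<i>) = 1" using g(2) by (simp add: Y_def gw_def)
  then have "m = 0" using gchi_2_plus_i[of m] by auto
  moreover have "s = 1" using s1 t0 by simp
  ultimately show False using ms by blast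
qed

text \<open>The quotients \<open>gH m c\<close> / e c are glued over all c. On Re s >= 1 the
  multipliers have a common zero only for m = 0 and s = 1, and there the zero has been divided out
  of e c.\<close>

theorem gL_extension:
  obtains U F where "open U" "{s. Re s \<ge> 1} \<subseteq> U" "F holomorphic_on U"
    "\<And>s. Re s > 1 \<Longrightarrow> F s = (if m = 0 then s - 1 else 1) * gL m s"
proof -
  define f where "f s = (if m = 0 then s - 1 else 1) * gL m s" for s
  have "\<exists>e. e holomorphic_on {s. Re s > 1 / 2} \<and>
      (\<forall>s. (if m = 0 then s - 1 else 1) * e s = 1 - gchi m (gw c) * of_real ((cmod (gw c))\<^sup>2) powr (1 - s)) \<and>
      (m = 0 \<longrightarrow> c > 0 \<longrightarrow> e 1 \<noteq> 0)" for c
  proof (cases "m = 0")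
    case True
    show ?thesis
    proof (cases "c = 0")
      case c: True
      \<comment> \<open>For c = 0 the sublattice is the whole lattice, so the multiplier is
        identically 0 and this index contributes nothing to the covering.\<close>
      have "gw 0 = \<i>" by (simp add: gw_def)
      then show ?thesis using True c by (intro exI[of _ "\<lambda>_. 0"]) auto
    next
      case False
      then have "(cmod (gw c))\<^sup>2 > 1" by (simp add: cmod_gw)
      then obtain e where "e holomorphic_on UNIV" "\<And>s. (s - 1) * e s = 1 - of_real ((cmod (gw c))\<^sup>2) powr (1 - s)" "e 1 \<noteq> 0"
        using entire_quotient_one_minus_powr by metis
      then show ?thesis using True by (intro exI[of _ e]) (auto intro: holomorphic_on_subset)
    qed
  next
    case False
    have "complex_of_real ((cmod (gw c))\<^sup>2) \<noteq> 0" by (simp add: gw_def complex_eq_iff)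
    then show ?thesis using False
      by (intro exI[of _ "\<lambda>s. 1 - gchi m (gw c) * of_real ((cmod (gw c))\<^sup>2) powr (1 - s)"])
         (auto intro!: holomorphic_intros simp: powr_def simp del: of_real_power)
  qed
  then obtain e where e: "\<And>c. e c holomorphic_on {s. Re s > 1 / 2}"
      "\<And>c s. (if m = 0 then s - 1 else 1) * e c s = 1 - gchi m (gw c) * of_real ((cmod (gw c))\<^sup>2) powr (1 - s)"
      "\<And>c. m = 0 \<Longrightarrow> c > 0 \<Longrightarrow> e c 1 \<noteq> 0"
    by metis
  obtain U F where "open U" "{s. Re s \<ge> 1} \<subseteq> U" "F holomorphic_on U" "\<And>s. s \<in> {s. Re s > 1} \<Longrightarrow> F s = f s"
  proof (rule holomorphic_extension_by_quotients[of "{s. Re s > 1 / 2}" "{s. Re s > 1}" "{s. Re s \<ge> 1}" "gH m" e f])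
    show "open {s. Re s > 1 / 2}" "open {s. Re s > 1}" by (rule open_halfspace_Re_gt)+
    show "connected {s. Re s > 1 / 2}" by (intro convex_connected convex_halfspace_Re_gt)
    have "(2::complex) \<in> {s. Re s > 1}" by simp
    then show "{s. Re s > 1} \<noteq> {}" by blast
    show "gH m j holomorphic_on {s. Re s > 1 / 2}" for j by (rule gH_holomorphic)
    show "e j s * f s = gH m j s" if "s \<in> {s. Re s > 1}" for j s
    proof -
      have "e j s * f s = ((if m = 0 then s - 1 else 1) * e j s) * gL m s" by (simp add: f_def)
      then show ?thesis unfolding e(2) using gH_eq[of s m j] that by simp
    qed
    show "\<exists>j. e j s \<noteq> 0" if "s \<in> {s. Re s \<ge> 1}" for s
    proof (cases "m = 0 \<and> s = 1")
      case True
      then show ?thesis using e(3)[of 1] by (intro exI[of _ 1]) auto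
    next
      case False
      then have "Re s \<ge> 1" "m \<noteq> 0 \<or> s \<noteq> 1" using that by auto
      from gw_not_all_one[OF this]
      obtain c where "gchi m (gw c) * of_real ((cmod (gw c))\<^sup>2) powr (1 - s) \<noteq> 1" by blast
      then show ?thesis using e(2)[of s c] by (intro exI[of _ c]) auto
    qed
  qed (use e in auto)
  then show ?thesis using that by (auto simp: f_def)
qed

section \<open>Nonvanishing on the line of absolute convergence\<close>

lemma gL_holomorphic: "gL m holomorphic_on {s. Re s > 1}"
proof (rule holomorphic_onI)
  fix s assume "s \<in> {s. Re s > 1}"
  then have "gL m field_differentiable (at s)"
    using gL_has_field_derivative[of s m] unfolding field_differentiable_def by auto
  then show "gL m field_differentiable (at s within {s. Re s > 1})" by (rule field_differentiable_at_within)
qed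

text \<open>At s = n + 2 the four units contribute 4. All other nonzero norms are at least 2, so the
  rest is at most 2^(-n) times a fixed constant. This makes orders of vanishing finite.\<close>

lemma gL_not_identically_zero: "\<exists>s. Re s > 1 \<and> gL m s \<noteq> 0"
proof (rule ccontr)
  assume "\<not> ?thesis"
  then have zero: "gL m s = 0" if "Re s > 1" for s using that by blast
  define A where "A = {e. gunit e}"
  define R where "R = GI - {0} - A"
  have A: "finite A" "A \<subseteq> GI - {0}"
    using card_gunit by (auto simp: A_def gunit_def intro: card_ge_0_finite)
  define S where "S = (\<Sum>\<^sub>\<infinity>z\<in>R. (cmod z)\<^sup>2 powr (- 2))"
  have sR: "(\<lambda>z. (cmod z)\<^sup>2 powr (- \<sigma>)) summable_on R" if "\<sigma> > 1" for \<sigma>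
    by (rule summable_on_subset_banach[OF summable_on_GI_powr[OF that]]) (auto simp: R_def)
  have "4 * 2 ^ n \<le> S" for n :: nat
  proof -
    define \<sigma> where "\<sigma> = real n + 2"
    define s where "s = complex_of_real \<sigma>"
    have s: "Re s > 1" by (simp add: s_def \<sigma>_def)
    have sm: "gterm m s summable_on GI - {0}"
      by (rule abs_summable_summable[OF summable_on_subset_banach[OF gterm_abs_summable[OF s]]]) auto
    have smR: "gterm m s summable_on R"
      by (rule summable_on_subset_banach[OF sm]) (auto simp: R_def)
    have "0 = (\<Sum>\<^sub>\<infinity>z\<in>A \<union> R. gterm m s z)"
    proof -
      have "A \<union> R = GI - {0}" using A by (auto simp: R_def)
      then show ?thesis using zero[OF s] gL_nonzero_sum by simp
    qed
    also have "\<dots> = (\<Sum>\<^sub>\<infinity>z\<in>A. gterm m s z) + (\<Sum>\<^sub>\<infinity>z\<in>R. gterm m s z)"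
      by (rule infsum_Un_disjoint) (use A smR in \<open>auto simp: R_def\<close>)
    also have "(\<Sum>\<^sub>\<infinity>z\<in>A. gterm m s z) = (\<Sum>z\<in>A. 1)"
      unfolding infsum_finite[OF A(1)]
      by (rule sum.cong) (auto simp: A_def gterm_def gchi_unit gunit_def)
    also have "\<dots> = 4" using card_gunit by (simp add: A_def)
    finally have "(\<Sum>\<^sub>\<infinity>z\<in>R. gterm m s z) = - 4" by (simp add: eq_neg_iff_add_eq_0 add.commute)
    then have "4 = norm (\<Sum>\<^sub>\<infinity>z\<in>R. gterm m s z)" by simp
    also have "\<dots> \<le> (\<Sum>\<^sub>\<infinity>z\<in>R. norm (gterm m s z))"
      by (rule norm_infsum_bound) (use sR[of \<sigma>] s in \<open>simp add: norm_gterm s_def\<close>)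
    also have "\<dots> \<le> (\<Sum>\<^sub>\<infinity>z\<in>R. 2 powr (- real n) * (cmod z)\<^sup>2 powr (- 2))"
    proof (rule infsum_mono)
      show "(\<lambda>z. norm (gterm m s z)) summable_on R" using sR[of \<sigma>] s by (simp add: norm_gterm s_def)
      show "(\<lambda>z. 2 powr (- real n) * (cmod z)\<^sup>2 powr (- 2)) summable_on R"
        by (intro summable_on_cmult_right sR) auto
      fix z assume z: "z \<in> R"
      then have zG: "z \<in> GI" "z \<noteq> 0" "cmod z \<noteq> 1" by (auto simp: R_def A_def gunit_def)
      obtain k :: nat where k: "(cmod z)\<^sup>2 = real k" using GI_cmod_square_nat zG by blast
      have "cmod z > 1" using GI_cmod_ge_1 zG by force
      then have "(cmod z)\<^sup>2 > 1" by (simp add: one_less_power)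
      then have "k \<ge> 2" unfolding k by simp
      then have k2: "real k \<ge> 2" by simp
      have "norm (gterm m s z) = real k powr (- real n) * real k powr (- 2)"
        unfolding norm_gterm k s_def \<sigma>_def by (simp add: powr_add[symmetric])
      also have "\<dots> \<le> 2 powr (- real n) * real k powr (- 2)"
        using k2 by (intro mult_right_mono powr_mono2') auto
      finally show "norm (gterm m s z) \<le> 2 powr (- real n) * (cmod z)\<^sup>2 powr (- 2)" by (simp add: k)
    qed
    also have "\<dots> = 2 powr (- real n) * S" unfolding S_def by (rule infsum_cmult_right')
    finally show "4 * 2 ^ n \<le> S" by (simp add: powr_minus powr_realpow field_simps)
  qed
  moreover obtain n where "S < 2 ^ n" using real_arch_pow[of 2 S] by auto
  ultimately have "4 * 2 ^ n < (2::real) ^ n" by (meson le_less_trans)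
  then show False by simp
qed

definition gpref :: "nat \<Rightarrow> complex \<Rightarrow> complex" where
  "gpref m s = (if m = 0 then s - 1 else 1)"

lemma gF_deriv:
  assumes "open U" "{s. Re s \<ge> 1} \<subseteq> U" "F holomorphic_on U"
    and F: "\<And>s. Re s > 1 \<Longrightarrow> F s = gpref m s * gL m s" and s: "Re s > 1"
  shows "deriv F s = F s * ((if m = 0 then 1 / (s - 1) else 0) - gP m s / 4)"
proof -
  have s1: "s - 1 \<noteq> 0" using s by auto
  have "((\<lambda>s. gpref m s * gL m s) has_field_derivative
     ((if m = 0 then 1 else 0) * gL m s + gpref m s * (- (gP m s * gL m s / 4)))) (at s)"
    using gL_has_field_derivative[OF s, of m] unfolding gpref_def
    by (cases "m = 0") (auto intro!: derivative_eq_intros)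
  then have "(F has_field_derivative
     ((if m = 0 then 1 else 0) * gL m s + gpref m s * (- (gP m s * gL m s / 4)))) (at s)"
  proof (rule has_field_derivative_transform_within_open)
    show "open {s. Re s > 1}" by (rule open_halfspace_Re_gt)
    show "s \<in> {s. Re s > 1}" using s by simp
    show "gpref m x * gL m x = F x" if "x \<in> {s. Re s > 1}" for x using F[of x] that by simp
  qed
  then have "deriv F s = (if m = 0 then 1 else 0) * gL m s + gpref m s * (- (gP m s * gL m s / 4))"
    by (rule DERIV_imp_deriv)
  also have "\<dots> = F s * ((if m = 0 then 1 / (s - 1) else 0) - gP m s / 4)"
  proof -
    define q where "q = s - 1"
    have "F s = (if m = 0 then q else 1) * gL m s" "q \<noteq> 0" using F[OF s] s1 by (simp_all add: gpref_def q_def)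
    then show ?thesis unfolding gpref_def q_def[symmetric]
      by (cases "m = 0") (simp_all add: right_diff_distrib)
  qed
  finally show ?thesis .
qed

text \<open>The number \<open>n\<close> is the order of vanishing of \<open>F\<close> at \<open>s0\<close>.\<close>

lemma gP_limit:
  assumes U: "open U" "{s. Re s \<ge> 1} \<subseteq> U" "F holomorphic_on U"
    and F: "\<And>s. Re s > 1 \<Longrightarrow> F s = gpref m s * gL m s" and s0: "Re s0 \<ge> 1"
  shows "\<exists>n::nat. (n = 0 \<longleftrightarrow> F s0 \<noteq> 0) \<and>
    ((\<lambda>\<epsilon>. of_real \<epsilon> * gP m (s0 + of_real \<epsilon>)) \<longlongrightarrow> (if m = 0 \<and> s0 = 1 then 4 else 0) - 4 * of_nat n) (at_right 0)"
proof -
  have "s0 \<in> U" using U(2) s0 by auto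
  then obtain r where r: "r > 0" "ball s0 r \<subseteq> U" using U(1) open_contains_ball by blast
  have hol: "F holomorphic_on ball s0 r" using U(3) r(2) by (rule holomorphic_on_subset)
  \<comment> \<open>If F vanished on the ball, \<open>gL m\<close> would vanish on the nonempty open
    part of it with Re s > 1, hence on the whole half-plane.\<close>
  have nz: "\<exists>w\<in>ball s0 r. F w \<noteq> 0"
  proof (rule ccontr)
    assume "\<not> ?thesis"
    then have z: "F w = 0" if "w \<in> ball s0 r" for w using that by blast
    define S where "S = ball s0 r \<inter> {s. Re s > 1}"
    have S1: "open S" unfolding S_def by (intro open_Int open_ball open_halfspace_Re_gt)
    have "s0 + of_real (r / 2) \<in> S" using r s0 by (auto simp: S_def dist_norm)
    then have S2: "S \<noteq> {}" by blast
    have gz: "gL m w = 0" if "w \<in> S" for w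
    proof -
      have "gpref m w * gL m w = 0" "gpref m w \<noteq> 0" using z[of w] F[of w] that by (auto simp: S_def gpref_def)
      then show ?thesis by simp
    qed
    have "gL m s = 0" if "Re s > 1" for s
    proof (rule analytic_continuation_open[of S "{s. Re s > 1}" "gL m" "\<lambda>_. 0" s])
      show "connected {s. Re s > 1}" by (intro convex_connected convex_halfspace_Re_gt)
      show "open {s. Re s > 1}" by (rule open_halfspace_Re_gt)
      show "S \<subseteq> {s. Re s > 1}" by (auto simp: S_def)
    qed (use that gL_holomorphic S1 S2 gz in auto)
    then show False using gL_not_identically_zero by blast
  qed
  obtain n where n: "((\<lambda>\<epsilon>. of_real \<epsilon> * (deriv F (s0 + of_real \<epsilon>) / F (s0 + of_real \<epsilon>))) \<longlongrightarrow> of_nat n) (at_right 0)"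
    "n = 0 \<longleftrightarrow> F s0 \<noteq> 0" "\<forall>\<^sub>F \<epsilon> in at_right 0. F (s0 + of_real \<epsilon>) \<noteq> 0"
    using log_deriv_order[OF hol r(1) nz] by metis
  define d where "d \<epsilon> = (if m = 0 then of_real \<epsilon> / (s0 + of_real \<epsilon> - 1) else 0)" for \<epsilon> :: real
  have ev: "\<forall>\<^sub>F \<epsilon> in at_right (0::real). \<epsilon> > 0" by (simp add: eventually_at_right_less)
  have dlim: "(d \<longlongrightarrow> (if m = 0 \<and> s0 = 1 then 1 else 0)) (at_right 0)"
  proof (cases "m = 0 \<and> s0 = 1")
    case True
    have "\<forall>\<^sub>F \<epsilon> in at_right 0. 1 = d \<epsilon>" using ev by eventually_elim (simp add: d_def True)
    then have "(d \<longlongrightarrow> 1) (at_right 0)" by (rule Lim_transform_eventually[OF tendsto_const])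
    then show ?thesis using True by simp
  next
    case False
    have "(d \<longlongrightarrow> (if m = 0 then of_real 0 / (s0 + of_real 0 - 1) else 0)) (at_right 0)"
      using False unfolding d_def by (cases "m = 0") (auto intro!: tendsto_eq_intros)
    then show ?thesis using False by (auto split: if_splits)
  qed
  have "((\<lambda>\<epsilon>. 4 * d \<epsilon> - 4 * (of_real \<epsilon> * (deriv F (s0 + of_real \<epsilon>) / F (s0 + of_real \<epsilon>)))) \<longlongrightarrow>
      4 * (if m = 0 \<and> s0 = 1 then 1 else 0) - 4 * of_nat n) (at_right 0)"
    by (intro tendsto_intros dlim n(1))
  moreover have "\<forall>\<^sub>F \<epsilon> in at_right 0. 4 * d \<epsilon> - 4 * (of_real \<epsilon> * (deriv F (s0 + of_real \<epsilon>) / F (s0 + of_real \<epsilon>)))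
      = of_real \<epsilon> * gP m (s0 + of_real \<epsilon>)"
    using ev n(3)
  proof eventually_elim
    case (elim \<epsilon>)
    have R: "Re (s0 + of_real \<epsilon>) > 1" using elim s0 by simp
    define c where "c = (if m = 0 then 1 / (s0 + of_real \<epsilon> - 1) else 0)"
    have q: "deriv F (s0 + of_real \<epsilon>) / F (s0 + of_real \<epsilon>) = c - gP m (s0 + of_real \<epsilon>) / 4"
      using gF_deriv[OF U F R] elim by (simp add: c_def)
    have "d \<epsilon> = of_real \<epsilon> * c" by (simp add: d_def c_def)
    then show ?case unfolding q by (simp add: algebra_simps)
  qed
  ultimately have "((\<lambda>\<epsilon>. of_real \<epsilon> * gP m (s0 + of_real \<epsilon>)) \<longlongrightarrow>
      4 * (if m = 0 \<and> s0 = 1 then 1 else 0) - 4 * of_nat n) (at_right 0)"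
    by (rule Lim_transform_eventually)
  moreover have "4 * (if m = 0 \<and> s0 = 1 then 1 else 0) = (if m = 0 \<and> s0 = 1 then 4 else (0::complex))" by simp
  ultimately show ?thesis using n(2) by (intro exI[of _ n]) (simp only: simp_thms)
qed

section \<open>Positivity and the behaviour at the pole\<close>

lemma gP_has_sum:
  assumes "Re s > 1"
  shows "((\<lambda>z. of_real (gmangoldt z) * gterm m s z) has_sum gP m s) (GI - {0})"
  unfolding gP_def by (rule has_sum_infsum[OF abs_summable_summable[OF gP_abs_summable[OF assms]]])

text \<open>The witness x is the character value times N^(-it), where N is the norm of z. The three
  series of the 3-4-1 inequality then have weights 1, x and x^2, and 3 + 4 Re x + Re (x^2) = 2 (1 +
  Re x)^2.\<close>

lemma gterm_real_shift:
  assumes "z \<noteq> 0"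
  shows "\<exists>x. cmod x = 1 \<and> gterm 0 (of_real \<sigma>) z = of_real ((cmod z)\<^sup>2 powr (- \<sigma>)) \<and>
    gterm m (of_real \<sigma> + \<i> * of_real t) z = of_real ((cmod z)\<^sup>2 powr (- \<sigma>)) * x \<and>
    gterm (2 * m) (of_real \<sigma> + \<i> * of_real (2 * t)) z = of_real ((cmod z)\<^sup>2 powr (- \<sigma>)) * x\<^sup>2"
proof -
  define N where "N = (cmod z)\<^sup>2"
  have N: "N > 0" using assms by (simp add: N_def)
  define y where "y = (of_real N :: complex) powr (- (\<i> * of_real t))"
  have y: "cmod y = 1" unfolding y_def using N by (subst norm_powr_real_powr) auto
  have y2: "(of_real N :: complex) powr (- (\<i> * of_real (2 * t))) = y\<^sup>2"
    using N by (simp add: y_def powr_def power2_eq_square exp_add[symmetric] algebra_simps)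
  have "(of_real N :: complex) powr (- (of_real \<sigma> + w)) = of_real (N powr (- \<sigma>)) * of_real N powr (- w)" for w
    using N by (simp add: powr_of_real[symmetric] powr_add[symmetric])
  note pw = this
  have N\<sigma>: "(of_real N :: complex) powr (- of_real \<sigma>) = of_real (N powr (- \<sigma>))"
    using N powr_of_real[of N "- \<sigma>"] by simp
  have "gterm (2 * m) (of_real \<sigma> + \<i> * of_real (2 * t)) z = gchi (2 * m) z * (of_real (N powr (- \<sigma>)) * y\<^sup>2)"
    by (simp only: gterm_def N_def[symmetric] pw y2)
  also have "\<dots> = of_real (N powr (- \<sigma>)) * (gchi m z * y)\<^sup>2"
    unfolding gchi_double power_mult_distrib by (simp only: mult_ac)
  finally have 3: "gterm (2 * m) (of_real \<sigma> + \<i> * of_real (2 * t)) z = of_real (N powr (- \<sigma>)) * (gchi m z * y)\<^sup>2" .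
  have "gterm m (of_real \<sigma> + \<i> * of_real t) z = gchi m z * (of_real (N powr (- \<sigma>)) * y)"
    by (simp only: gterm_def N_def[symmetric] pw y_def)
  then have 2: "gterm m (of_real \<sigma> + \<i> * of_real t) z = of_real (N powr (- \<sigma>)) * (gchi m z * y)"
    by (simp only: mult_ac)
  have 1: "gterm 0 (of_real \<sigma>) z = of_real (N powr (- \<sigma>))"
    by (simp add: gterm_def N_def[symmetric] N\<sigma>)
  have "cmod (gchi m z * y) = 1" using norm_gchi[OF assms, of m] y by (simp add: norm_mult)
  with 1 2 3 show ?thesis unfolding N_def by blast
qed

lemma gP_341:
  assumes "\<sigma> > 1"
  shows "0 \<le> Re (3 * gP 0 (of_real \<sigma>) + 4 * gP m (of_real \<sigma> + \<i> * of_real t) + gP (2 * m) (of_real \<sigma> + \<i> * of_real (2 * t)))"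
proof -
  let ?f = "\<lambda>z. 3 * (of_real (gmangoldt z) * gterm 0 (of_real \<sigma>) z)
      + 4 * (of_real (gmangoldt z) * gterm m (of_real \<sigma> + \<i> * of_real t) z)
      + of_real (gmangoldt z) * gterm (2 * m) (of_real \<sigma> + \<i> * of_real (2 * t)) z"
  have "(?f has_sum (3 * gP 0 (of_real \<sigma>) + 4 * gP m (of_real \<sigma> + \<i> * of_real t) + gP (2 * m) (of_real \<sigma> + \<i> * of_real (2 * t)))) (GI - {0})"
    by (intro has_sum_add has_sum_cmult_right gP_has_sum) (use assms in auto)
  then have "((\<lambda>z. Re (?f z)) has_sum Re (3 * gP 0 (of_real \<sigma>) + 4 * gP m (of_real \<sigma> + \<i> * of_real t) + gP (2 * m) (of_real \<sigma> + \<i> * of_real (2 * t)))) (GI - {0})"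
    by (rule has_sum_Re)
  then show ?thesis
  proof (rule has_sum_nonneg)
    fix z assume z: "z \<in> GI - {0}"
    define N where "N = (cmod z)\<^sup>2 powr (- \<sigma>)"
    obtain x where x: "cmod x = 1" "gterm 0 (of_real \<sigma>) z = of_real N"
      "gterm m (of_real \<sigma> + \<i> * of_real t) z = of_real N * x"
      "gterm (2 * m) (of_real \<sigma> + \<i> * of_real (2 * t)) z = of_real N * x\<^sup>2"
      using gterm_real_shift[of z \<sigma> m t] z unfolding N_def by blast
    have "(Re x)\<^sup>2 + (Im x)\<^sup>2 = 1" using x(1) by (simp add: cmod_def)
    then have "3 + 4 * Re x + Re (x\<^sup>2) = 2 * (1 + Re x)\<^sup>2"
      by (simp add: power2_eq_square algebra_simps)
    then have "3 + 4 * Re x + Re (x\<^sup>2) \<ge> 0" by simp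
    moreover have "?f z = of_real (gmangoldt z * N) * (3 + 4 * x + x\<^sup>2)"
      unfolding x by (simp add: algebra_simps)
    then have "Re (?f z) = (gmangoldt z * N) * (3 + 4 * Re x + Re (x\<^sup>2))" by simp
    moreover have "gmangoldt z * N \<ge> 0" using gmangoldt_bounds z by (simp add: N_def)
    ultimately show "0 \<le> Re (?f z)" by simp
  qed
qed

text \<open>On the triangle 1 <= b <= a each of the a points in column a contributes at least 1 / (2
  a^2), so the partial sums dominate half the harmonic numbers.\<close>

lemma GI_reciprocal_norms_not_summable:
  "\<not> (\<lambda>z. 1 / (cmod z)\<^sup>2) summable_on GI - {0}"
proof
  assume sm: "(\<lambda>z. 1 / (cmod z)\<^sup>2) summable_on GI - {0}"
  define S where "S = (\<Sum>\<^sub>\<infinity>z\<in>GI - {0}. 1 / (cmod z)\<^sup>2)"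
  have "harm n \<le> 2 * S" for n
  proof -
    let ?I = "SIGMA a:{1..n}. {1..a}"
    let ?h = "\<lambda>(a, b). Complex (real a) (real b)"
    have inj: "inj_on ?h ?I" by (auto simp: inj_on_def)
    have sub: "?h ` ?I \<subseteq> GI - {0}" by (auto simp: GI_def complex_eq_iff)
    have "harm n = (\<Sum>a\<in>{1..n}. \<Sum>b\<in>{1..a}. 1 / (real a)\<^sup>2)"
      by (simp add: harm_def power2_eq_square divide_inverse mult.assoc[symmetric])
    also have "\<dots> \<le> (\<Sum>a\<in>{1..n}. \<Sum>b\<in>{1..a}. 2 * (1 / (cmod (Complex (real a) (real b)))\<^sup>2))"
    proof (intro sum_mono)
      fix a b assume ab: "a \<in> {1..n}" "b \<in> {1..a}"
      have "(real b)\<^sup>2 \<le> (real a)\<^sup>2" using ab by (intro power_mono) auto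
      moreover have "(real a)\<^sup>2 > 0" using ab by simp
      ultimately show "1 / (real a)\<^sup>2 \<le> 2 * (1 / (cmod (Complex (real a) (real b)))\<^sup>2)"
        by (simp add: cmod_power2 divide_simps add_pos_nonneg)
    qed
    also have "\<dots> = 2 * (\<Sum>p\<in>?I. 1 / (cmod (?h p))\<^sup>2)"
      by (subst sum.Sigma) (auto simp: sum_distrib_left case_prod_unfold)
    also have "(\<Sum>p\<in>?I. 1 / (cmod (?h p))\<^sup>2) = (\<Sum>z\<in>?h ` ?I. 1 / (cmod z)\<^sup>2)"
      by (subst sum.reindex[OF inj]) (simp add: o_def)
    also have "\<dots> \<le> S" unfolding S_def
      by (rule finite_sum_le_infsum[OF sm _ sub]) auto
    finally show ?thesis by simp
  qed
  moreover have "filterlim (\<lambda>n. harm n :: real) at_top sequentially" by (rule harm_at_top)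
  then obtain n where "harm n > 2 * S"
    by (metis (mono_tags, lifting) eventually_gt_at_top filterlim_iff eventually_sequentially order_refl)
  ultimately show False by (meson not_less)
qed

text \<open>A zero of F at 1 would keep \<open>gL 0\<close> bounded as s decreases to 1. Its terms
  are nonnegative at real s, so the finite partial sums of the reciprocal norms would be bounded
  too.\<close>

lemma gL_0_pole:
  assumes U: "open U" "{s. Re s \<ge> 1} \<subseteq> U" "F holomorphic_on U"
    and F: "\<And>s. Re s > 1 \<Longrightarrow> F s = (s - 1) * gL 0 s"
  shows "F 1 \<noteq> 0"
proof
  assume F1: "F 1 = 0"
  have "1 \<in> U" using U by auto
  then obtain D where D: "(F has_field_derivative D) (at 1)"
    using U(1,3) by (meson holomorphic_on_imp_differentiable_at field_differentiable_def)
  have "((\<lambda>w. (F w - F 1) / (w - 1)) \<longlongrightarrow> D) (at 1)" using D by (simp add: has_field_derivative_iff)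
  moreover have "filterlim (\<lambda>\<epsilon>. 1 + complex_of_real \<epsilon>) (at 1) (at_right 0)"
  proof (rule filterlim_atI)
    show "((\<lambda>\<epsilon>. 1 + complex_of_real \<epsilon>) \<longlongrightarrow> 1) (at_right 0)" by (auto intro!: tendsto_eq_intros)
    show "\<forall>\<^sub>F \<epsilon> in at_right 0. 1 + complex_of_real \<epsilon> \<noteq> 1"
      using eventually_at_right_less[of "0::real"] by eventually_elim auto
  qed
  ultimately have "((\<lambda>\<epsilon>. (F (1 + complex_of_real \<epsilon>) - F 1) / ((1 + complex_of_real \<epsilon>) - 1)) \<longlongrightarrow> D) (at_right 0)"
    by (rule filterlim_compose)
  then have "((\<lambda>\<epsilon>. norm ((F (1 + complex_of_real \<epsilon>) - F 1) / ((1 + complex_of_real \<epsilon>) - 1))) \<longlongrightarrow> norm D) (at_right 0)"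
    by (rule tendsto_norm)
  then have "\<forall>\<^sub>F \<epsilon> in at_right 0. norm ((F (1 + complex_of_real \<epsilon>) - F 1) / ((1 + complex_of_real \<epsilon>) - 1)) < norm D + 1"
    by (rule order_tendstoD) simp
  then have bd: "\<forall>\<^sub>F \<epsilon> in at_right 0. norm (gL 0 (of_real (1 + \<epsilon>))) < norm D + 1"
    using eventually_at_right_less[of "0::real"]
  proof eventually_elim
    case (elim \<epsilon>)
    have "F (1 + complex_of_real \<epsilon>) = complex_of_real \<epsilon> * gL 0 (1 + complex_of_real \<epsilon>)"
      using F[of "1 + complex_of_real \<epsilon>"] elim by simp
    then show ?case using elim F1 by simp
  qed
  have "(\<lambda>z. 1 / (cmod z)\<^sup>2) summable_on GI - {0}"
  proof (rule nonneg_bdd_above_summable_on)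
    show "bdd_above (sum (\<lambda>z. 1 / (cmod z)\<^sup>2) ` {A. A \<subseteq> GI - {0} \<and> finite A})"
    proof (rule bdd_aboveI2)
      fix A assume "A \<in> {A. A \<subseteq> GI - {0} \<and> finite A}"
      then have A: "A \<subseteq> GI - {0}" "finite A" by auto
      have "((\<lambda>\<epsilon>. \<Sum>z\<in>A. (cmod z)\<^sup>2 powr (- (1 + \<epsilon>))) \<longlongrightarrow> (\<Sum>z\<in>A. (cmod z)\<^sup>2 powr (- (1 + 0)))) (at_right 0)"
        using A(1) by (intro tendsto_intros) auto
      moreover have "\<forall>\<^sub>F \<epsilon> in at_right 0. (\<Sum>z\<in>A. (cmod z)\<^sup>2 powr (- (1 + \<epsilon>))) \<le> norm D + 1"
        using bd eventually_at_right_less[of "0::real"]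
      proof eventually_elim
        case (elim \<epsilon>)
        have s: "Re (of_real (1 + \<epsilon>)) > 1" using elim by simp
        have sm: "(\<lambda>z. (cmod z)\<^sup>2 powr (- (1 + \<epsilon>))) summable_on GI - {0}"
          by (rule summable_on_subset_banach[OF summable_on_GI_powr]) (use elim in auto)
        have t: "gterm 0 (of_real (1 + \<epsilon>)) z = of_real ((cmod z)\<^sup>2 powr (- (1 + \<epsilon>)))" for z
          unfolding gterm_def by (subst powr_of_real[symmetric]) auto
        have "gL 0 (of_real (1 + \<epsilon>)) = of_real (\<Sum>\<^sub>\<infinity>z\<in>GI - {0}. (cmod z)\<^sup>2 powr (- (1 + \<epsilon>)))"
          unfolding gL_nonzero_sum t by (rule infsumI[OF has_sum_of_real[OF has_sum_infsum[OF sm]]])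
        moreover have "(\<Sum>z\<in>A. (cmod z)\<^sup>2 powr (- (1 + \<epsilon>))) \<le> (\<Sum>\<^sub>\<infinity>z\<in>GI - {0}. (cmod z)\<^sup>2 powr (- (1 + \<epsilon>)))"
          by (rule finite_sum_le_infsum[OF sm A(2,1)]) auto
        ultimately show ?case using elim by (simp del: of_real_add)
      qed
      ultimately have "(\<Sum>z\<in>A. (cmod z)\<^sup>2 powr (- (1 + 0))) \<le> norm D + 1"
        by (rule tendsto_upperbound) simp
      moreover have "(\<Sum>z\<in>A. (cmod z)\<^sup>2 powr (- (1 + 0))) = (\<Sum>z\<in>A. 1 / (cmod z)\<^sup>2)"
        by (rule sum.cong) (use A in \<open>auto simp: powr_minus divide_inverse\<close>)
      ultimately show "(\<Sum>z\<in>A. 1 / (cmod z)\<^sup>2) \<le> norm D + 1" by simp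
    qed
  qed auto
  then show False using GI_reciprocal_norms_not_summable by blast
qed

lemma gP_bounded: assumes "Re s \<ge> \<sigma>" "\<sigma> > 1"
  shows "norm (gP m s) \<le> (\<Sum>\<^sub>\<infinity>z\<in>GI - {0}. gmangoldt z * (cmod z)\<^sup>2 powr (- \<sigma>))"
proof -
  have s: "Re s > 1" using assms by simp
  have "norm (gP m s) \<le> (\<Sum>\<^sub>\<infinity>z\<in>GI - {0}. norm (of_real (gmangoldt z) * gterm m s z))"
    unfolding gP_def by (rule norm_infsum_bound[OF gP_abs_summable[OF s]])
  also have "\<dots> \<le> (\<Sum>\<^sub>\<infinity>z\<in>GI - {0}. gmangoldt z * (cmod z)\<^sup>2 powr (- \<sigma>))"
  proof (rule infsum_mono[OF gP_abs_summable[OF s] gmangoldt_powr_summable[OF assms(2)]])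
    fix z assume z: "z \<in> GI - {0}"
    then have "(cmod z)\<^sup>2 \<ge> 1" using GI_cmod_ge_1 by simp
    then show "norm (of_real (gmangoldt z) * gterm m s z) \<le> gmangoldt z * (cmod z)\<^sup>2 powr (- \<sigma>)"
      using z gmangoldt_bounds[of z] assms
      by (auto simp: norm_mult norm_gterm intro!: mult_left_mono powr_mono)
  qed
  finally show ?thesis .
qed

text \<open>The crucial case is Re s0 = 1 away from the pole, settled by the 3-4-1 inequality. For
  Re s0 > 1 boundedness of \<open>gP\<close> forces order 0, and at the pole
  \<open>gL_0_pole\<close> applies. Once F has no zeros, D is -4 F'/F.\<close>

theorem gP_continuous_extension:
  obtains D where "continuous_on {s. Re s \<ge> 1} D"
    "\<And>s. Re s > 1 \<Longrightarrow> gP m s = (if m = 0 then 4 / (s - 1) else 0) + D s"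
proof -
  have "\<exists>U F. open U \<and> {s. Re s \<ge> 1} \<subseteq> U \<and> F holomorphic_on U \<and> (\<forall>s. Re s > 1 \<longrightarrow> F s = gpref m s * gL m s)" for m
    using gL_extension[of m] unfolding gpref_def by metis
  then obtain U F where U: "\<And>m. open (U m)" "\<And>m. {s. Re s \<ge> 1} \<subseteq> U m" "\<And>m. F m holomorphic_on U m"
    and F: "\<And>m s. Re s > 1 \<Longrightarrow> F m s = gpref m s * gL m s" by metis
  have lim: "\<exists>n::nat. (n = 0 \<longleftrightarrow> F m s0 \<noteq> 0) \<and>
      ((\<lambda>\<epsilon>. of_real \<epsilon> * gP m (s0 + of_real \<epsilon>)) \<longlongrightarrow> (if m = 0 \<and> s0 = 1 then 4 else 0) - 4 * of_nat n) (at_right 0)"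
    if s0r: "Re s0 \<ge> 1" for m s0
    by (rule gP_limit[OF U F s0r])
  have ev: "\<forall>\<^sub>F \<epsilon> in at_right (0::real). \<epsilon> > 0" by (rule eventually_at_right_less)
  have nz: "F m s0 \<noteq> 0" if s0: "Re s0 \<ge> 1" for m s0
  proof (cases "Re s0 > 1")
    case True
    obtain n where n: "n = 0 \<longleftrightarrow> F m s0 \<noteq> 0"
      "((\<lambda>\<epsilon>. of_real \<epsilon> * gP m (s0 + of_real \<epsilon>)) \<longlongrightarrow> (if m = 0 \<and> s0 = 1 then 4 else 0) - 4 * of_nat n) (at_right 0)"
      using lim[OF s0] by metis
    define B where "B = (\<Sum>\<^sub>\<infinity>z\<in>GI - {0}. gmangoldt z * (cmod z)\<^sup>2 powr (- Re s0))"
    have "((\<lambda>\<epsilon>. of_real \<epsilon> * gP m (s0 + of_real \<epsilon>)) \<longlongrightarrow> 0) (at_right 0)"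
    proof (rule Lim_null_comparison)
      show "\<forall>\<^sub>F \<epsilon> in at_right 0. norm (of_real \<epsilon> * gP m (s0 + of_real \<epsilon>)) \<le> \<epsilon> * B"
        using ev
      proof eventually_elim
        case (elim \<epsilon>)
        then show ?case using gP_bounded[of "Re s0" "s0 + of_real \<epsilon>" m] True
          by (simp add: norm_mult B_def mult_left_mono)
      qed
      have "((\<lambda>\<epsilon>. \<epsilon> * B) \<longlongrightarrow> 0 * B) (at_right 0)" by (intro tendsto_intros)
      then show "((\<lambda>\<epsilon>. \<epsilon> * B) \<longlongrightarrow> 0) (at_right 0)" by simp
    qed
    from tendsto_unique[OF _ n(2) this] have "(if m = 0 \<and> s0 = 1 then 4 else 0) - 4 * complex_of_nat n = 0" by simp
    moreover have "s0 \<noteq> 1" using True by auto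
    ultimately show ?thesis using n(1) by simp
  next
    case False
    then have Re1: "Re s0 = 1" using s0 by simp
    show ?thesis
    proof (cases "m = 0 \<and> s0 = 1")
      case True
      then show ?thesis using gL_0_pole[OF U(1,2,3)[of 0]] F[of _ 0] by (auto simp: gpref_def)
    next
      case False
      define t where "t = Im s0"
      have s0t: "s0 = 1 + \<i> * of_real t" using Re1 by (simp add: complex_eq_iff t_def)
      define s2 where "s2 = 1 + \<i> * of_real (2 * t)"
      \<comment> \<open>Doubling never produces the trivial character at s = 1 unless the case m =
        0, t = 0 was already present. So the difficulty posed by quadratic characters does not
        arise.\<close>
      have ne: "\<not> (m = 0 \<and> s0 = 1)" "\<not> (2 * m = 0 \<and> s2 = 1)" using False by (auto simp: s0t s2_def complex_eq_iff)
      have Re2: "Re 1 \<ge> 1" "Re s2 \<ge> 1" by (simp_all add: s2_def)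
      have lim0: "\<exists>n::nat. (n = 0 \<longleftrightarrow> F 0 1 \<noteq> 0) \<and> ((\<lambda>\<epsilon>. of_real \<epsilon> * gP 0 (1 + of_real \<epsilon>)) \<longlongrightarrow> 4 - 4 * of_nat n) (at_right 0)"
        using lim[OF Re2(1), of 0] unfolding if_P[OF conjI[OF refl refl]] .
      have lim1: "\<exists>n::nat. (n = 0 \<longleftrightarrow> F m s0 \<noteq> 0) \<and> ((\<lambda>\<epsilon>. of_real \<epsilon> * gP m (s0 + of_real \<epsilon>)) \<longlongrightarrow> 0 - 4 * of_nat n) (at_right 0)"
        using lim[OF s0, of m] unfolding if_not_P[OF ne(1)] .
      have lim2: "\<exists>n::nat. (n = 0 \<longleftrightarrow> F (2 * m) s2 \<noteq> 0) \<and> ((\<lambda>\<epsilon>. of_real \<epsilon> * gP (2 * m) (s2 + of_real \<epsilon>)) \<longlongrightarrow> 0 - 4 * of_nat n) (at_right 0)"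
        using lim[OF Re2(2), of "2 * m"] unfolding if_not_P[OF ne(2)] .
      obtain n0 :: nat where n0: "((\<lambda>\<epsilon>. of_real \<epsilon> * gP 0 (1 + of_real \<epsilon>)) \<longlongrightarrow> 4 - 4 * of_nat n0) (at_right 0)"
        using lim0 by (elim exE conjE)
      obtain n :: nat where n: "n = 0 \<longleftrightarrow> F m s0 \<noteq> 0"
        "((\<lambda>\<epsilon>. of_real \<epsilon> * gP m (s0 + of_real \<epsilon>)) \<longlongrightarrow> 0 - 4 * of_nat n) (at_right 0)"
        using lim1 by (elim exE conjE)
      obtain n2 :: nat where n2: "((\<lambda>\<epsilon>. of_real \<epsilon> * gP (2 * m) (s2 + of_real \<epsilon>)) \<longlongrightarrow> 0 - 4 * of_nat n2) (at_right 0)"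
        using lim2 by (elim exE conjE)
      have "((\<lambda>\<epsilon>. Re (3 * (of_real \<epsilon> * gP 0 (1 + of_real \<epsilon>)) + 4 * (of_real \<epsilon> * gP m (s0 + of_real \<epsilon>)) +
          of_real \<epsilon> * gP (2 * m) (s2 + of_real \<epsilon>))) \<longlongrightarrow>
          Re (3 * (4 - 4 * of_nat n0) + 4 * (0 - 4 * of_nat n) + (0 - 4 * of_nat n2))) (at_right 0)"
        by (intro tendsto_intros n0 n(2) n2)
      then have "0 \<le> Re (3 * (4 - 4 * of_nat n0) + 4 * (0 - 4 * complex_of_nat n) + (0 - 4 * of_nat n2))"
      proof (rule tendsto_lowerbound)
        show "\<forall>\<^sub>F \<epsilon> in at_right 0. 0 \<le> Re (3 * (of_real \<epsilon> * gP 0 (1 + of_real \<epsilon>)) + 4 * (of_real \<epsilon> * gP m (s0 + of_real \<epsilon>)) +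
          of_real \<epsilon> * gP (2 * m) (s2 + of_real \<epsilon>))"
          using ev
        proof eventually_elim
          case (elim \<epsilon>)
          have "0 \<le> \<epsilon> * Re (3 * gP 0 (of_real (1 + \<epsilon>)) + 4 * gP m (of_real (1 + \<epsilon>) + \<i> * of_real t) + gP (2 * m) (of_real (1 + \<epsilon>) + \<i> * of_real (2 * t)))"
            using gP_341[of "1 + \<epsilon>" m t] elim by (intro mult_nonneg_nonneg) auto
          also have "\<dots> = Re (of_real \<epsilon> * (3 * gP 0 (1 + of_real \<epsilon>) + 4 * gP m (s0 + of_real \<epsilon>) + gP (2 * m) (s2 + of_real \<epsilon>)))"
            by (simp add: s0t s2_def add_ac)
          finally show ?case by (simp add: algebra_simps)
        qed
      qed simp
      \<comment> \<open>The real part equals 12 - 12 n0 - 16 n - 4 n2. A zero would weigh 16 against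
        at most 12 from the pole.\<close>
      then have "16 * real n \<le> 12" by simp
      then have "n = 0" by simp
      then show ?thesis using n(1) by simp
    qed
  qed
  define D where "D s = - 4 * (deriv (F m) s / F m s)" for s
  show ?thesis
  proof (rule that[of D])
    have "deriv (F m) holomorphic_on U m" using U(3,1) by (rule holomorphic_deriv)
    then have "continuous_on {s. Re s \<ge> 1} (deriv (F m))" "continuous_on {s. Re s \<ge> 1} (F m)"
      using U(2,3) by (meson continuous_on_subset holomorphic_on_imp_continuous_on)+
    then show "continuous_on {s. Re s \<ge> 1} D" unfolding D_def using nz by (intro continuous_intros) auto
    fix s :: complex assume s: "Re s > 1"
    define c where "c = (if m = 0 then 1 / (s - 1) else 0)"
    have q: "deriv (F m) s / F m s = c - gP m s / 4"
      using gF_deriv[OF U F s, of m] nz[of s m] s by (simp add: c_def)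
    have "gP m s = 4 * c + D s" unfolding D_def q by simp
    also have "4 * c = (if m = 0 then 4 / (s - 1) else 0)" by (simp add: c_def)
    finally show "gP m s = (if m = 0 then 4 / (s - 1) else 0) + D s" .
  qed
qed

section \<open>Localization by band-limited functions\<close>

text \<open>The Fourier coefficient at frequency \<tau> of the weighted prime powers on the
  logarithmic scale, recentred at Y. Pairing \<tau> with -\<tau> leaves cosines and real parts of
  characters, see \<open>gW_has_sum\<close>.\<close>

definition gW :: "nat \<Rightarrow> real \<Rightarrow> real \<Rightarrow> real \<Rightarrow> real" where
  "gW m \<sigma> \<tau> Y = Re (cis (\<tau> * Y) * gP m (of_real \<sigma> + \<i> * of_real \<tau>) + cis (- (\<tau> * Y)) * gP m (of_real \<sigma> - \<i> * of_real \<tau>)) / 2"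

definition gwt :: "real \<Rightarrow> complex \<Rightarrow> real" where
  "gwt \<sigma> z = gmangoldt z * (cmod z)\<^sup>2 powr (- \<sigma>)"

lemma gwt_nonneg: "z \<in> GI - {0} \<Longrightarrow> gwt \<sigma> z \<ge> 0"
  using gmangoldt_bounds by (simp add: gwt_def)

lemma gterm_vertical:
  assumes "z \<noteq> 0"
  shows "gterm m (of_real \<sigma> + \<i> * of_real \<tau>) z = gchi m z * of_real ((cmod z)\<^sup>2 powr (- \<sigma>)) * cis (- (\<tau> * ln ((cmod z)\<^sup>2)))"
proof -
  define N where "N = (cmod z)\<^sup>2"
  have N: "N > 0" using assms by (simp add: N_def)
  have "(of_real N :: complex) powr (- (of_real \<sigma> + \<i> * of_real \<tau>)) = of_real (N powr (- \<sigma>)) * cis (- (\<tau> * ln N))"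
  proof -
    have "(of_real N :: complex) powr (- (of_real \<sigma> + \<i> * of_real \<tau>)) = exp (of_real (- \<sigma> * ln N)) * exp (\<i> * of_real (- (\<tau> * ln N)))"
      using N by (simp add: powr_def Ln_of_real exp_add[symmetric] algebra_simps)
    also have "\<dots> = of_real (N powr (- \<sigma>)) * cis (- (\<tau> * ln N))"
      using N unfolding cis_conv_exp by (simp only: exp_of_real powr_def) simp
    finally show ?thesis .
  qed
  then show ?thesis unfolding gterm_def N_def[symmetric] by (simp add: mult.assoc)
qed

lemma gW_has_sum:
  assumes "\<sigma> > 1"
  shows "((\<lambda>z. gwt \<sigma> z * Re (gchi m z) * cos (\<tau> * (ln ((cmod z)\<^sup>2) - Y))) has_sum gW m \<sigma> \<tau> Y) (GI - {0})"
proof -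
  let ?f = "\<lambda>z. cis (\<tau> * Y) * (of_real (gmangoldt z) * gterm m (of_real \<sigma> + \<i> * of_real \<tau>) z)
     + cis (- (\<tau> * Y)) * (of_real (gmangoldt z) * gterm m (of_real \<sigma> - \<i> * of_real \<tau>) z)"
  have "(?f has_sum (cis (\<tau> * Y) * gP m (of_real \<sigma> + \<i> * of_real \<tau>) + cis (- (\<tau> * Y)) * gP m (of_real \<sigma> - \<i> * of_real \<tau>))) (GI - {0})"
    by (intro has_sum_add has_sum_cmult_right gP_has_sum) (use assms in auto)
  then have "((\<lambda>z. (1/2) * Re (?f z)) has_sum ((1/2) * Re (cis (\<tau> * Y) * gP m (of_real \<sigma> + \<i> * of_real \<tau>) + cis (- (\<tau> * Y)) * gP m (of_real \<sigma> - \<i> * of_real \<tau>)))) (GI - {0})"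
    by (intro has_sum_cmult_right has_sum_Re)
  moreover have "(1/2) * Re (?f z) = gwt \<sigma> z * Re (gchi m z) * cos (\<tau> * (ln ((cmod z)\<^sup>2) - Y))" if z: "z \<in> GI - {0}" for z
  proof -
    define L where "L = ln ((cmod z)\<^sup>2)"
    define n where "n = (cmod z)\<^sup>2 powr (- \<sigma>)"
    have z0: "z \<noteq> 0" using z by auto
    have g1: "gterm m (of_real \<sigma> + \<i> * of_real \<tau>) z = gchi m z * of_real n * cis (- (\<tau> * L))"
      using gterm_vertical[OF z0] by (simp add: n_def L_def)
    have g2: "gterm m (of_real \<sigma> - \<i> * of_real \<tau>) z = gchi m z * of_real n * cis (\<tau> * L)"
      using gterm_vertical[OF z0, of m \<sigma> "- \<tau>"] by (simp add: n_def L_def)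
    define th where "th = \<tau> * (L - Y)"
    have c1: "cis (\<tau> * Y) * cis (- (\<tau> * L)) = cis (- th)" "cis (- (\<tau> * Y)) * cis (\<tau> * L) = cis th"
      unfolding cis_mult th_def by (simp_all add: algebra_simps)
    have "?f z = of_real (gmangoldt z * n) * gchi m z * (cis (\<tau> * Y) * cis (- (\<tau> * L)) + cis (- (\<tau> * Y)) * cis (\<tau> * L))"
      unfolding g1 g2 by (simp add: algebra_simps)
    also have "\<dots> = of_real (gmangoldt z * n) * gchi m z * of_real (2 * cos th)"
      unfolding c1 by (simp add: complex_eq_iff)
    also have "Re \<dots> = gmangoldt z * n * Re (gchi m z) * (2 * cos th)"
      by (simp only: Re_complex_of_real of_real_mult[symmetric] times_complex.sel Im_complex_of_real) simp
    finally show ?thesis by (simp add: gwt_def n_def th_def L_def)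
  qed
  ultimately show ?thesis unfolding gW_def
    using has_sum_cong[of "GI - {0}" "\<lambda>z. (1/2) * Re (?f z)"] by simp
qed

lemma gwt_summable: "\<sigma> > 1 \<Longrightarrow> gwt \<sigma> summable_on (GI - {0})"
  unfolding gwt_def by (rule gmangoldt_powr_summable)

lemma abs_Re_gchi_le: "\<bar>Re (gchi m z)\<bar> \<le> 1"
proof (cases "z = 0")
  case True
  then show ?thesis by (cases "m = 0") (simp_all add: gchi_def power_0_left)
next
  case False
  then show ?thesis using abs_Re_le_cmod[of "gchi m z"] norm_gchi[of z m] by simp
qed

text \<open>The series for \<open>gW\<close> converges uniformly in the frequency because \<sigma> >
  1, so it may be integrated termwise against a bounded weight.\<close>

lemma gW_fourier:
  assumes \<sigma>: "\<sigma> > 1" and \<phi>: "continuous_on {0..2} \<phi>"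
  shows "((\<lambda>z. gwt \<sigma> z * Re (gchi m z) * integral {0..2} (\<lambda>t. \<phi> t * cos (T * t * (ln ((cmod z)\<^sup>2) - Y)))) has_sum
     integral {0..2} (\<lambda>t. \<phi> t * gW m \<sigma> (T * t) Y)) (GI - {0})"
proof -
  obtain M where M: "\<And>t. t \<in> {0..2} \<Longrightarrow> \<bar>\<phi> t\<bar> \<le> M"
    using compact_imp_bounded[OF compact_continuous_image[OF \<phi>]] by (force simp: bounded_iff)
  have M0: "M \<ge> 0" using M[of 0] by auto
  define f where "f z t = gwt \<sigma> z * Re (gchi m z) * (\<phi> t * cos (T * t * (ln ((cmod z)\<^sup>2) - Y)))" for z t
  have cf: "continuous_on {0..2} (f z)" for z unfolding f_def by (intro continuous_intros \<phi>)
  have ul: "uniform_limit {0..2} (\<lambda>X t. \<Sum>z\<in>X. f z t) (\<lambda>t. \<phi> t * gW m \<sigma> (T * t) Y) (finite_subsets_at_top (GI - {0}))"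
  proof (rule Weierstrass_m_test_general')
    show "(\<lambda>z. gwt \<sigma> z * M) summable_on GI - {0}" by (rule summable_on_cmult_left[OF gwt_summable[OF \<sigma>]])
    show "norm (f z t) \<le> gwt \<sigma> z * M" if "z \<in> GI - {0}" "t \<in> {0..2}" for z t
    proof -
      have "norm (f z t) = gwt \<sigma> z * (\<bar>Re (gchi m z)\<bar> * (\<bar>\<phi> t\<bar> * \<bar>cos (T * t * (ln ((cmod z)\<^sup>2) - Y))\<bar>))"
        using gwt_nonneg[OF that(1), of \<sigma>] by (simp add: f_def abs_mult)
      also have "\<dots> \<le> gwt \<sigma> z * (1 * (M * 1))"
        using M[OF that(2)] M0 gwt_nonneg[OF that(1), of \<sigma>] abs_Re_gchi_le
        by (intro mult_left_mono mult_mono) auto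
      finally show ?thesis by simp
    qed
    show "((\<lambda>z. f z t) has_sum \<phi> t * gW m \<sigma> (T * t) Y) (GI - {0})" for t
      using has_sum_cmult_right[OF gW_has_sum[OF \<sigma>, of m "T * t" Y], of "\<phi> t"] by (simp add: f_def mult_ac)
  qed
  have cs: "continuous_on {0..2} (\<lambda>t. \<Sum>z\<in>X. f z t)" for X by (intro continuous_intros cf)
  obtain I J where IJ: "\<And>X. ((\<lambda>t. \<Sum>z\<in>X. f z t) has_integral I X) {0..2}"
    "((\<lambda>t. \<phi> t * gW m \<sigma> (T * t) Y) has_integral J) {0..2}" "(I \<longlongrightarrow> J) (finite_subsets_at_top (GI - {0}))"
    using uniform_limit_integral[OF ul cs finite_subsets_at_top_neq_bot] by blast
  have "I X = (\<Sum>z\<in>X. integral {0..2} (f z))" for X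
  proof (cases "finite X")
    case True
    have "I X = integral {0..2} (\<lambda>t. \<Sum>z\<in>X. f z t)" using integral_unique[OF IJ(1)] by simp
    also have "\<dots> = (\<Sum>z\<in>X. integral {0..2} (f z))"
      by (rule integral_sum[OF True]) (intro integrable_continuous_real cf)
    finally show ?thesis .
  next
    case False
    then show ?thesis using IJ(1)[of X] by simp
  qed
  then have "I = (\<lambda>X. \<Sum>z\<in>X. integral {0..2} (f z))" by blast
  then have "((\<lambda>z. integral {0..2} (f z)) has_sum J) (GI - {0})" using IJ(3) by (simp add: has_sum_def)
  moreover have "integral {0..2} (f z) = gwt \<sigma> z * Re (gchi m z) * integral {0..2} (\<lambda>t. \<phi> t * cos (T * t * (ln ((cmod z)\<^sup>2) - Y)))" for z
    unfolding f_def by (rule integral_mult_right)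
  ultimately show ?thesis using integral_unique[OF IJ(2)] by simp
qed

text \<open>The polar terms at the two conjugate points contribute equally; together they give four
  times the real part of e^(i \<tau> Y) / (\<epsilon> + i \<tau>). What remains involves only
  D.\<close>

lemma gW_decomposition:
  assumes D: "\<And>s. Re s > 1 \<Longrightarrow> gP m s = (if m = 0 then 4 / (s - 1) else 0) + D s" and \<epsilon>: "\<epsilon> > 0"
  shows "gW m (1 + \<epsilon>) \<tau> Y = (if m = 0 then 4 * (\<epsilon> * cos (\<tau> * Y) + \<tau> * sin (\<tau> * Y)) / (\<epsilon>\<^sup>2 + \<tau>\<^sup>2) else 0) +
     Re (cis (\<tau> * Y) * (D (of_real (1 + \<epsilon>) + \<i> * of_real \<tau>) + cnj (D (of_real (1 + \<epsilon>) - \<i> * of_real \<tau>)))) / 2"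
proof -
  have cn: "Re (cis (- x) * w) = Re (cis x * cnj w)" for x w by simp
  have s: "Re (of_real (1 + \<epsilon>) + \<i> * of_real \<tau>) > 1" "Re (of_real (1 + \<epsilon>) - \<i> * of_real \<tau>) > 1" using \<epsilon> by auto
  have p: "\<epsilon>\<^sup>2 + \<tau>\<^sup>2 > 0" using \<epsilon> by (simp add: add_pos_nonneg)
  define q where "q = Complex \<epsilon> \<tau>"
  have q: "of_real (1 + \<epsilon>) + \<i> * of_real \<tau> - 1 = q" "of_real (1 + \<epsilon>) - \<i> * of_real \<tau> - 1 = cnj q" "cmod q ^ 2 = \<epsilon>\<^sup>2 + \<tau>\<^sup>2"
    by (simp_all add: q_def complex_eq_iff cmod_power2)
  have iq: "4 / q = Complex (4 * \<epsilon> / (\<epsilon>\<^sup>2 + \<tau>\<^sup>2)) (- (4 * \<tau>) / (\<epsilon>\<^sup>2 + \<tau>\<^sup>2))"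
    using p by (simp add: q_def complex_eq_iff Re_divide Im_divide)
  have r: "Re (cis (\<tau> * Y) * (4 / q)) = 4 * (\<epsilon> * cos (\<tau> * Y) + \<tau> * sin (\<tau> * Y)) / (\<epsilon>\<^sup>2 + \<tau>\<^sup>2)"
    unfolding iq by (simp add: add_divide_distrib[symmetric] algebra_simps)
  have "4 / cnj q = cnj (4 / q)" by simp
  then have r': "Re (cis (- (\<tau> * Y)) * (4 / cnj q)) = Re (cis (\<tau> * Y) * (4 / q))" using cn[of "\<tau> * Y" "4 / cnj q"] by simp
  have e: "gW m (1 + \<epsilon>) \<tau> Y = (Re (cis (\<tau> * Y) * gP m (of_real (1 + \<epsilon>) + \<i> * of_real \<tau>)) + Re (cis (- (\<tau> * Y)) * gP m (of_real (1 + \<epsilon>) - \<i> * of_real \<tau>))) / 2"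
    by (simp only: gW_def plus_complex.sel)
  show ?thesis
  proof (cases "m = 0")
    case True
    have "gW m (1 + \<epsilon>) \<tau> Y = (2 * Re (cis (\<tau> * Y) * (4 / q)) + (Re (cis (\<tau> * Y) * D (of_real (1 + \<epsilon>) + \<i> * of_real \<tau>)) + Re (cis (- (\<tau> * Y)) * D (of_real (1 + \<epsilon>) - \<i> * of_real \<tau>)))) / 2"
      unfolding e D[OF s(1)] D[OF s(2)] q using True r' by (simp only: if_True distrib_left plus_complex.sel) simp
    then show ?thesis using True unfolding r cn[of "\<tau> * Y"] by (simp only: if_True distrib_left plus_complex.sel) simp
  next
    case False
    have "gW m (1 + \<epsilon>) \<tau> Y = (Re (cis (\<tau> * Y) * D (of_real (1 + \<epsilon>) + \<i> * of_real \<tau>)) + Re (cis (- (\<tau> * Y)) * D (of_real (1 + \<epsilon>) - \<i> * of_real \<tau>))) / 2"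
      unfolding e D[OF s(1)] D[OF s(2)] using False by simp
    then show ?thesis using False unfolding cn[of "\<tau> * Y"] by (simp only: if_False distrib_left plus_complex.sel)
  qed
qed

text \<open>What D contributes to the smoothed sum at distance \<epsilon> from the line. Only the
  frequencies from 0 to 2 T occur, so for bounded \<epsilon> the values of D are taken on a compact
  set.\<close>

definition regular_part :: "(complex \<Rightarrow> complex) \<Rightarrow> (real \<Rightarrow> real) \<Rightarrow> real \<Rightarrow> real \<Rightarrow> real \<Rightarrow> real" where
  "regular_part D \<phi> T \<epsilon> Y = integral {0..2} (\<lambda>t. \<phi> t *
     (Re (cis (T * t * Y) * (D (of_real (1 + \<epsilon>) + \<i> * of_real (T * t)) + cnj (D (of_real (1 + \<epsilon>) - \<i> * of_real (T * t))))) / 2))"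

lemma continuous_on_regular_integrand:
  assumes D: "continuous_on {s. Re s \<ge> 1} D" and \<phi>: "continuous_on {0..2} \<phi>"
  shows "continuous_on ({0..} \<times> {0..2}) (\<lambda>(\<epsilon>, t). \<phi> t *
     (Re (cis (T * t * Y) * (D (of_real (1 + \<epsilon>) + \<i> * of_real (T * t)) + cnj (D (of_real (1 + \<epsilon>) - \<i> * of_real (T * t))))) / 2))"
proof -
  have c: "continuous_on ({0..} \<times> {0..2}) (\<lambda>p. D (f p))"
    if "continuous_on ({0..} \<times> {0..2}) f" "\<And>p. p \<in> {0..} \<times> {0..2} \<Longrightarrow> Re (f p) \<ge> 1" for f :: "real \<times> real \<Rightarrow> complex"
    by (rule continuous_on_compose2[OF D that(1)]) (use that(2) in auto)
  have c\<phi>: "continuous_on ({0..} \<times> {0..2}) (\<lambda>p :: real \<times> real. \<phi> (snd p))"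
    by (rule continuous_on_compose2[OF \<phi>]) (auto intro!: continuous_intros)
  show ?thesis unfolding case_prod_unfold
    by (intro continuous_on_mult c\<phi> continuous_on_divide continuous_on_Re continuous_on_add continuous_on_cnj c continuous_on_cis)
       (auto intro!: continuous_intros)
qed

text \<open>The order of limits matters: first \<epsilon> tends to 0 with Y fixed, by continuity of
  D up to the line; then Y tends to infinity, by the Riemann-Lebesgue lemma on the line
  itself.\<close>

lemma regular_part_limits:
  assumes D: "continuous_on {s. Re s \<ge> 1} D" and \<phi>: "continuous_on {0..2} \<phi>" and T: "T > 0"
  shows "(\<lambda>n. regular_part D \<phi> T (1 / real (Suc n)) Y) \<longlonglongrightarrow> regular_part D \<phi> T 0 Y"
    and "((\<lambda>Y. regular_part D \<phi> T 0 Y) \<longlongrightarrow> 0) at_top"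
proof -
  have "continuous_on {0..} (\<lambda>\<epsilon>. regular_part D \<phi> T \<epsilon> Y)"
    unfolding regular_part_def
    by (rule integral_continuous_on_param[where a = 0 and b = "2::real", unfolded box_real])
       (rule continuous_on_regular_integrand[OF D \<phi>])
  moreover have "(\<lambda>n. 1 / real (Suc n)) \<longlonglongrightarrow> 0" using LIMSEQ_inverse_real_of_nat by (simp add: inverse_eq_divide)
  ultimately show "(\<lambda>n. regular_part D \<phi> T (1 / real (Suc n)) Y) \<longlonglongrightarrow> regular_part D \<phi> T 0 Y"
    by (rule continuous_on_tendsto_compose) auto
  define G where "G t = of_real (\<phi> t) * (D (1 + \<i> * of_real (T * t)) + cnj (D (1 - \<i> * of_real (T * t)))) / 2" for t
  have cG: "continuous_on {0..2} G"
    unfolding G_def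
    by (intro continuous_on_mult continuous_on_divide continuous_on_of_real \<phi> continuous_on_add continuous_on_cnj
        continuous_on_compose2[OF D]) (auto intro!: continuous_intros)
  have eq: "regular_part D \<phi> T 0 Y = Re (integral {0..2} (\<lambda>t. G t * exp (\<i> * of_real (T * Y * t))))" for Y
  proof -
    have int: "(\<lambda>t. G t * exp (\<i> * of_real (T * Y * t))) integrable_on {0..2}"
      by (intro integrable_continuous_real continuous_intros cG)
    have pt: "Re (G t * exp (\<i> * of_real (T * Y * t))) = \<phi> t *
       (Re (cis (T * t * Y) * (D (of_real (1 + 0) + \<i> * of_real (T * t)) + cnj (D (of_real (1 + 0) - \<i> * of_real (T * t))))) / 2)" for t
    proof -
      define W where "W = D (1 + \<i> * of_real (T * t)) + cnj (D (1 - \<i> * of_real (T * t)))"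
      have "G t * exp (\<i> * of_real (T * Y * t)) = of_real (\<phi> t / 2) * (cis (T * t * Y) * W)"
        by (simp add: G_def W_def cis_conv_exp mult_ac)
      also have "Re \<dots> = \<phi> t / 2 * Re (cis (T * t * Y) * W)"
        by (simp only: times_complex.sel Re_complex_of_real Im_complex_of_real)
      finally show ?thesis by (simp add: W_def)
    qed
    show ?thesis unfolding regular_part_def pt[symmetric]
      by (rule integral_unique[OF has_integral_Re[OF integrable_integral[OF int]]])
  qed
  have "((\<lambda>X. integral {0..2} (\<lambda>t. G t * exp (\<i> * of_real (X * t)))) \<longlongrightarrow> 0) at_top"
    by (rule riemann_lebesgue[OF cG]) simp
  moreover have "filterlim (\<lambda>Y. T * Y) at_top at_top"
    using T by (intro filterlim_tendsto_pos_mult_at_top[OF tendsto_const] filterlim_ident)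
  ultimately have "((\<lambda>Y. integral {0..2} (\<lambda>t. G t * exp (\<i> * of_real (T * Y * t)))) \<longlongrightarrow> 0) at_top"
    by (rule filterlim_compose)
  then have "((\<lambda>Y. Re (integral {0..2} (\<lambda>t. G t * exp (\<i> * of_real (T * Y * t))))) \<longlongrightarrow> Re 0) at_top"
    by (rule tendsto_Re)
  then show "((\<lambda>Y. regular_part D \<phi> T 0 Y) \<longlongrightarrow> 0) at_top" by (simp add: eq)
qed

section \<open>The contribution of the pole\<close>

lemma Si_integral:
  assumes "X > 0"
  shows "integral {0..2} (\<lambda>t. X * sinc (X * t)) = Si (2 * X)"
proof -
  have H: "((\<lambda>t. X * sinc (X * t)) has_integral (Si (X * 2) - Si (X * 0))) {0..2}"
  proof (rule fundamental_theorem_of_calculus)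
    fix t :: real
    have "((\<lambda>t. Si (X * t)) has_real_derivative (sinc (X * t) * X)) (at t within {0..2})"
      by (rule DERIV_chain2[OF DERIV_Si]) (auto intro!: derivative_eq_intros)
    then show "((\<lambda>t. Si (X * t)) has_vector_derivative X * sinc (X * t)) (at t within {0..2})"
      by (simp only: has_real_derivative_iff_has_vector_derivative mult.commute)
  qed simp
  have "Si 0 = 0" by (simp add: Si_alt_def zero_ereal_def[symmetric])
  then show ?thesis using integral_unique[OF H] by (simp only: mult_zero_right diff_zero mult.commute[of X 2])
qed

text \<open>The cosine part \<open>f1\<close> is an approximate identity at t = 0. Its limit is not
  computed: its weight is positive near 0, and elsewhere it is O(\<epsilon>), so it costs nothing in
  a lower bound. The sine part \<open>f2\<close> converges dominatedly to (4/T) \<phi>(t) sin(T Y t)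
  / t. Writing \<phi> as its value at 0 plus t \<psi> isolates the sine integral.\<close>

lemma pole_part_lower:
  fixes \<phi> \<psi> :: "real \<Rightarrow> real"
  assumes \<phi>: "continuous_on {0..2} \<phi>" and \<psi>: "continuous_on {0..2} \<psi>"
    and dec: "\<And>t. t \<in> {0..2} \<Longrightarrow> \<phi> t = \<phi> 0 + t * \<psi> t" and pos: "\<phi> 0 > 0" and T: "T > 0" and Y: "Y > 0"
  obtains J' where
    "J' \<longlonglongrightarrow> (4 / T) * (\<phi> 0 * Si (2 * (T * Y)) + integral {0..2} (\<lambda>t. \<psi> t * sin (T * Y * t)))"
    "\<And>n. J' n \<le> integral {0..2} (\<lambda>t. \<phi> t * (4 * ((1 / real (Suc n)) * cos (T * t * Y) + (T * t) * sin (T * t * Y)) / ((1 / real (Suc n))\<^sup>2 + (T * t)\<^sup>2)))"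
proof -
  define X where "X = T * Y"
  have X: "X > 0" using T Y by (simp add: X_def)
  define \<epsilon> where "\<epsilon> n = 1 / real (Suc n)" for n
  have \<epsilon>: "\<epsilon> n > 0" for n by (simp add: \<epsilon>_def)
  have \<epsilon>0: "\<epsilon> \<longlonglongrightarrow> 0" unfolding \<epsilon>_def using LIMSEQ_inverse_real_of_nat by (simp add: inverse_eq_divide)
  obtain M where M: "\<And>t. t \<in> {0..2} \<Longrightarrow> \<bar>\<phi> t\<bar> \<le> M"
    using compact_imp_bounded[OF compact_continuous_image[OF \<phi>]] by (force simp: bounded_iff)
  have M0: "M \<ge> 0" using M[of 0] by auto
  define w where "w t = \<phi> t * cos (X * t)" for t
  have cw: "continuous_on {0..2} w" unfolding w_def by (intro continuous_intros \<phi>)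
  have "w 0 > 0" using pos by (simp add: w_def)
  then obtain \<delta> where \<delta>: "\<delta> > 0" "\<And>t. t \<in> {0..2} \<Longrightarrow> dist t 0 < \<delta> \<Longrightarrow> dist (w t) (w 0) < w 0"
    using cw[unfolded continuous_on_iff, rule_format, of 0 "w 0"] by auto
  have dn: "(\<epsilon> n)\<^sup>2 + (T * t)\<^sup>2 > 0" for n t using \<epsilon>[of n] by (simp add: add_pos_nonneg)
  have dn0: "(\<epsilon> n)\<^sup>2 + (T * t)\<^sup>2 \<noteq> 0" for n t using dn[of n t] by linarith
  define f1 where "f1 n t = w t * (4 * \<epsilon> n / ((\<epsilon> n)\<^sup>2 + (T * t)\<^sup>2))" for n t
  define f2 where "f2 n t = \<phi> t * sin (X * t) * (4 * (T * t) / ((\<epsilon> n)\<^sup>2 + (T * t)\<^sup>2))" for n t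
  have c1: "continuous_on {0..2} (f1 n)" for n unfolding f1_def by (intro continuous_intros cw) (use dn0 in auto)
  have c2: "continuous_on {0..2} (f2 n)" for n unfolding f2_def by (intro continuous_intros \<phi>) (use dn0 in auto)
  define g where "g t = (4 / T) * (\<phi> 0 * (X * sinc (X * t)) + \<psi> t * sin (X * t))" for t
  have cg: "continuous_on {0..2} g" unfolding g_def by (intro continuous_intros \<psi>)
  \<comment> \<open>At t = 0 every \<open>f2 n\<close> vanishes whereas g need not, so the pointwise
    limit differs from g at this single point.\<close>
  define g0 where "g0 t = (if t = 0 then 0 else g t)" for t
  have f2g: "(\<lambda>n. f2 n t) \<longlonglongrightarrow> g0 t" if t: "t \<in> {0..2}" for t
  proof (cases "t = 0")
    case True
    then show ?thesis by (simp add: f2_def g0_def)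
  next
    case False
    then have t0: "t > 0" using t by auto
    have "(\<lambda>n. f2 n t) \<longlonglongrightarrow> \<phi> t * sin (X * t) * (4 * (T * t) / (0\<^sup>2 + (T * t)\<^sup>2))"
      unfolding f2_def by (intro tendsto_intros \<epsilon>0) (use t0 T in auto)
    also have "\<phi> t * sin (X * t) * (4 * (T * t) / (0\<^sup>2 + (T * t)\<^sup>2)) = (4 / T) * ((\<phi> 0 + t * \<psi> t) * sin (X * t) / t)"
      using t0 T dec[OF t] by (simp add: power2_eq_square field_simps)
    also have "\<dots> = g0 t" using t0 X False by (simp add: g0_def g_def field_simps)
    finally show ?thesis .
  qed
  have f2b: "norm (f2 n t) \<le> 4 * M * X / T" if t: "t \<in> {0..2}" for n t
  proof (cases "t = 0")
    case True
    then show ?thesis using M0 X T by (simp add: f2_def)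
  next
    case False
    then have t0: "t > 0" using t by auto
    have "norm (f2 n t) = \<bar>\<phi> t\<bar> * \<bar>sin (X * t)\<bar> * (4 * (T * t) / ((\<epsilon> n)\<^sup>2 + (T * t)\<^sup>2))"
      using t0 T dn[of n t] by (simp add: f2_def abs_mult)
    also have "\<dots> \<le> M * (X * t) * (4 * (T * t) / (T * t)\<^sup>2)"
    proof (intro mult_mono)
      show "\<bar>sin (X * t)\<bar> \<le> X * t" using abs_sin_x_le_abs_x[of "X * t"] X t0 by (simp add: abs_mult)
      show "4 * (T * t) / ((\<epsilon> n)\<^sup>2 + (T * t)\<^sup>2) \<le> 4 * (T * t) / (T * t)\<^sup>2"
        using T t0 by (intro divide_left_mono) (auto intro!: mult_pos_pos add_nonneg_pos)
    qed (use M[OF t] M0 X t0 T in auto)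
    also have "\<dots> = 4 * M * X / T" using t0 T by (simp add: power2_eq_square field_simps)
    finally show ?thesis .
  qed
  have lim2: "(\<lambda>n. integral {0..2} (f2 n)) \<longlonglongrightarrow> integral {0..2} g0"
    by (rule dominated_convergence(2)[where h = "\<lambda>_. 4 * M * X / T"])
       (use f2b f2g in \<open>auto intro!: integrable_continuous_real c2\<close>)
  have "integral {0..2} g0 = integral {0..2} g"
    by (rule integral_spike[of "{0}"]) (auto simp: g0_def)
  also have "\<dots> = (4 / T) * (\<phi> 0 * integral {0..2} (\<lambda>t. X * sinc (X * t)) + integral {0..2} (\<lambda>t. \<psi> t * sin (X * t)))"
  proof -
    have i1: "(\<lambda>t. \<phi> 0 * (X * sinc (X * t))) integrable_on {0..2}" "(\<lambda>t. \<psi> t * sin (X * t)) integrable_on {0..2}"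
      by (intro integrable_continuous_real continuous_intros \<psi>)+
    show ?thesis unfolding g_def integral_mult_right integral_add[OF i1] ..
  qed
  finally have g0i: "integral {0..2} g0 = (4 / T) * (\<phi> 0 * Si (2 * X) + integral {0..2} (\<lambda>t. \<psi> t * sin (X * t)))"
    unfolding Si_integral[OF X] .
  define C where "C = 4 * M / (T * \<delta>)\<^sup>2"
  have C0: "C \<ge> 0" using M0 by (simp add: C_def)
  have f1b: "f1 n t \<ge> - (C * \<epsilon> n)" if t: "t \<in> {0..2}" for n t
  proof (cases "t < \<delta>")
    case True
    then have "w t \<ge> 0" using \<delta>(2)[OF t] t by (auto simp: dist_real_def)
    then have "f1 n t \<ge> 0" unfolding f1_def using \<epsilon>[of n] dn[of n t] by (intro mult_nonneg_nonneg divide_nonneg_pos) auto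
    moreover have "C * \<epsilon> n \<ge> 0" using C0 \<epsilon>[of n] by simp
    ultimately show ?thesis by linarith
  next
    case False
    have "\<bar>f1 n t\<bar> = \<bar>w t\<bar> * (4 * \<epsilon> n / ((\<epsilon> n)\<^sup>2 + (T * t)\<^sup>2))"
      using \<epsilon>[of n] dn[of n t] by (simp add: f1_def abs_mult)
    also have "\<dots> \<le> M * (4 * \<epsilon> n / (T * \<delta>)\<^sup>2)"
    proof (intro mult_mono divide_left_mono)
      have "\<bar>w t\<bar> \<le> \<bar>\<phi> t\<bar> * 1" unfolding w_def abs_mult by (intro mult_left_mono) auto
      then show "\<bar>w t\<bar> \<le> M" using M[OF t] by simp
      have "(T * \<delta>)\<^sup>2 \<le> (T * t)\<^sup>2" using False T \<delta>(1) by (intro power_mono mult_left_mono) auto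
      then show "(T * \<delta>)\<^sup>2 \<le> (\<epsilon> n)\<^sup>2 + (T * t)\<^sup>2" by (simp add: add_increasing)
    qed (use M0 \<epsilon>[of n] dn[of n t] T \<delta>(1) in auto)
    also have "\<dots> = C * \<epsilon> n" by (simp add: C_def)
    finally show ?thesis by linarith
  qed
  have i1: "integral {0..2} (f1 n) \<ge> - (2 * C) * \<epsilon> n" for n
  proof -
    have "integral {0..2} (\<lambda>t::real. - (C * \<epsilon> n)) \<le> integral {0..2} (f1 n)"
      by (rule integral_le) (auto intro!: integrable_continuous_real c1 f1b)
    then show ?thesis by simp
  qed
  show ?thesis
  proof (rule that[of "\<lambda>n. - (2 * C) * \<epsilon> n + integral {0..2} (f2 n)"])
    have "(\<lambda>n. - (2 * C) * \<epsilon> n + integral {0..2} (f2 n)) \<longlonglongrightarrow> - (2 * C) * 0 + integral {0..2} g0"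
      by (intro tendsto_intros \<epsilon>0 lim2)
    then show "(\<lambda>n. - (2 * C) * \<epsilon> n + integral {0..2} (f2 n)) \<longlonglongrightarrow>
        (4 / T) * (\<phi> 0 * Si (2 * (T * Y)) + integral {0..2} (\<lambda>t. \<psi> t * sin (T * Y * t)))"
      unfolding g0i X_def by simp
    fix n
    have "integral {0..2} (\<lambda>t. \<phi> t * (4 * ((1 / real (Suc n)) * cos (T * t * Y) + (T * t) * sin (T * t * Y)) / ((1 / real (Suc n))\<^sup>2 + (T * t)\<^sup>2)))
       = integral {0..2} (\<lambda>t. f1 n t + f2 n t)"
    proof (rule integral_cong)
      fix t :: real
      have e: "T * t * Y = X * t" by (simp add: X_def)
      show "\<phi> t * (4 * ((1 / real (Suc n)) * cos (T * t * Y) + (T * t) * sin (T * t * Y)) / ((1 / real (Suc n))\<^sup>2 + (T * t)\<^sup>2)) = f1 n t + f2 n t"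
        unfolding e \<epsilon>_def[symmetric] f1_def f2_def w_def by (simp add: add_divide_distrib algebra_simps)
    qed
    also have "\<dots> = integral {0..2} (f1 n) + integral {0..2} (f2 n)"
      by (intro integral_add integrable_continuous_real c1 c2)
    finally show "- (2 * C) * \<epsilon> n + integral {0..2} (f2 n) \<le> integral {0..2} (\<lambda>t. \<phi> t * (4 * ((1 / real (Suc n)) * cos (T * t * Y) + (T * t) * sin (T * t * Y)) / ((1 / real (Suc n))\<^sup>2 + (T * t)\<^sup>2)))"
      using i1[of n] by linarith
  qed
qed

lemma has_sum_sum_lessThan:
  fixes f :: "nat \<Rightarrow> 'a \<Rightarrow> real"
  assumes "\<And>i. (f i has_sum s i) A"
  shows "((\<lambda>x. \<Sum>i<n. f i x) has_sum (\<Sum>i<n. s i)) A"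
proof (induction n)
  case (Suc n)
  then show ?case using has_sum_add[OF Suc assms[of n]] by simp
qed simp

text \<open>Each \<phi> m is integrated over a bounded range of frequencies, so this is a
  band-limited function of ln |z|^2 with trigonometric polynomial dependence on the angle.\<close>

definition gkernel :: "(nat \<Rightarrow> real \<Rightarrow> real) \<Rightarrow> real \<Rightarrow> real \<Rightarrow> complex \<Rightarrow> real" where
  "gkernel \<phi> T Y z = (\<Sum>m<3. Re (gchi m z) * integral {0..2} (\<lambda>t. \<phi> m t * cos (T * t * (ln ((cmod z)\<^sup>2) - Y))))"

text \<open>Outside \<open>G Y\<close> the kernel is nonpositive and the weights are nonnegative, so
  dropping these terms can only increase the sum; inside, the kernel is at most M. The full sum is
  computed spectrally: after \<epsilon> and then Y go to their limits, only the pole survives, with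
  at least (4/T) (\<pi>/2) times the value of \<phi> 0 at 0.\<close>

theorem gmangoldt_localized_lower_bound:
  fixes \<phi> :: "nat \<Rightarrow> real \<Rightarrow> real" and G :: "real \<Rightarrow> complex set"
  assumes \<phi>: "\<And>m. continuous_on {0..2} (\<phi> m)" and \<psi>: "continuous_on {0..2} \<psi>"
    and dec: "\<And>t. t \<in> {0..2} \<Longrightarrow> \<phi> 0 t = \<phi> 0 0 + t * \<psi> t" and pos: "\<phi> 0 0 > 0" and T: "T > 0"
    and G: "\<And>Y. finite (G Y)" "\<And>Y. G Y \<subseteq> GI - {0}"
    and K: "\<And>Y z. z \<in> GI - {0} \<Longrightarrow> gkernel \<phi> T Y z \<le> M" "\<And>Y z. z \<in> GI - {0} - G Y \<Longrightarrow> gkernel \<phi> T Y z \<le> 0"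
    and M: "M > 0"
  shows "\<exists>c>0. \<forall>\<^sub>F Y in at_top. (\<Sum>z\<in>G Y. gmangoldt z / (cmod z)\<^sup>2) \<ge> c"
proof -
  have "\<exists>D. continuous_on {s. Re s \<ge> 1} D \<and> (\<forall>s. Re s > 1 \<longrightarrow> gP m s = (if m = 0 then 4 / (s - 1) else 0) + D s)" for m
    using gP_continuous_extension[of m] by blast
  then obtain D where D: "\<And>m. continuous_on {s. Re s \<ge> 1} (D m)"
    "\<And>m s. Re s > 1 \<Longrightarrow> gP m s = (if m = 0 then 4 / (s - 1) else 0) + D m s" by metis
  define S where "S Y = (\<Sum>z\<in>G Y. gmangoldt z / (cmod z)\<^sup>2)" for Y
  define reg where "reg Y = (\<Sum>m<3. regular_part (D m) (\<phi> m) T 0 Y)" for Y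
  define main where "main Y = (4 / T) * (\<phi> 0 0 * Si (2 * (T * Y)) + integral {0..2} (\<lambda>t. \<psi> t * sin (T * Y * t)))" for Y
  have bound: "main Y + reg Y \<le> M * S Y" if Y: "Y > 0" for Y
  proof -
    obtain J' where J': "J' \<longlonglongrightarrow> main Y"
      "\<And>n. J' n \<le> integral {0..2} (\<lambda>t. \<phi> 0 t * (4 * ((1 / real (Suc n)) * cos (T * t * Y) + (T * t) * sin (T * t * Y)) / ((1 / real (Suc n))\<^sup>2 + (T * t)\<^sup>2)))"
      using pole_part_lower[OF \<phi> \<psi> dec pos T Y] unfolding main_def by blast
    have le: "J' n + (\<Sum>m<3. regular_part (D m) (\<phi> m) T (1 / real (Suc n)) Y) \<le> M * S Y" for n
    proof -
      define \<epsilon> where "\<epsilon> = 1 / real (Suc n)"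
      have \<epsilon>: "\<epsilon> > 0" by (simp add: \<epsilon>_def)
      define \<sigma> where "\<sigma> = 1 + \<epsilon>"
      have \<sigma>: "\<sigma> > 1" using \<epsilon> by (simp add: \<sigma>_def)
      define pole where "pole t = \<phi> 0 t * (4 * (\<epsilon> * cos (T * t * Y) + (T * t) * sin (T * t * Y)) / (\<epsilon>\<^sup>2 + (T * t)\<^sup>2))" for t
      define rg where "rg m t = \<phi> m t * (Re (cis (T * t * Y) * (D m (of_real (1 + \<epsilon>) + \<i> * of_real (T * t)) + cnj (D m (of_real (1 + \<epsilon>) - \<i> * of_real (T * t))))) / 2)" for m t
      have dn0: "\<epsilon>\<^sup>2 + (T * t)\<^sup>2 \<noteq> 0" for t using \<epsilon> by (simp add: sum_power2_eq_zero_iff)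
      have cpole: "continuous_on {0..2} pole" unfolding pole_def by (intro continuous_intros \<phi>) (use dn0 in auto)
      have crg: "continuous_on {0..2} (rg m)" for m
      proof -
        have "continuous_on {0..2} (Pair \<epsilon>)" by (auto intro!: continuous_intros)
        moreover have "Pair \<epsilon> ` {0..2} \<subseteq> {0..} \<times> {0..2}" using \<epsilon> by auto
        ultimately have "continuous_on {0..2} (\<lambda>t. case Pair \<epsilon> t of (\<epsilon>, t) \<Rightarrow> \<phi> m t * (Re (cis (T * t * Y) * (D m (of_real (1 + \<epsilon>) + \<i> * of_real (T * t)) + cnj (D m (of_real (1 + \<epsilon>) - \<i> * of_real (T * t))))) / 2))"
          by (rule continuous_on_compose2[OF continuous_on_regular_integrand[OF D(1)[of m] \<phi>[of m], of T Y]])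
        then show ?thesis unfolding rg_def by (simp only: prod.case)
      qed
      have I0: "integral {0..2} (\<lambda>t. \<phi> m t * gW m \<sigma> (T * t) Y) = (if m = 0 then integral {0..2} pole else 0) + regular_part (D m) (\<phi> m) T \<epsilon> Y" for m
      proof -
        have e: "\<phi> m t * gW m \<sigma> (T * t) Y = (if m = 0 then pole t else 0) + rg m t" for t
        proof -
          note w = gW_decomposition[of m "D m" \<epsilon> "T * t" Y, OF D(2) \<epsilon>]
          show ?thesis
          proof (cases "m = 0")
            case True
            have w': "gW m (1 + \<epsilon>) (T * t) Y = 4 * (\<epsilon> * cos (T * t * Y) + (T * t) * sin (T * t * Y)) / (\<epsilon>\<^sup>2 + (T * t)\<^sup>2) +
               Re (cis (T * t * Y) * (D m (of_real (1 + \<epsilon>) + \<i> * of_real (T * t)) + cnj (D m (of_real (1 + \<epsilon>) - \<i> * of_real (T * t))))) / 2"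
              using w unfolding if_P[OF True] .
            have p: "pole t = \<phi> m t * (4 * (\<epsilon> * cos (T * t * Y) + (T * t) * sin (T * t * Y)) / (\<epsilon>\<^sup>2 + (T * t)\<^sup>2))"
              unfolding pole_def True ..
            show ?thesis unfolding \<sigma>_def w' rg_def if_P[OF True] p by (rule distrib_left)
          next
            case False
            have w': "gW m (1 + \<epsilon>) (T * t) Y =
               Re (cis (T * t * Y) * (D m (of_real (1 + \<epsilon>) + \<i> * of_real (T * t)) + cnj (D m (of_real (1 + \<epsilon>) - \<i> * of_real (T * t))))) / 2"
              using w unfolding if_not_P[OF False] add_0_left .
            show ?thesis unfolding \<sigma>_def w' rg_def if_not_P[OF False] by (simp only: add_0_left)
          qed
        qed
        have r: "regular_part (D m) (\<phi> m) T \<epsilon> Y = integral {0..2} (rg m)" by (simp only: regular_part_def rg_def[abs_def])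
        have "(\<lambda>t. if m = 0 then pole t else 0) integrable_on {0..2}"
          by (cases "m = 0") (auto intro!: integrable_continuous_real cpole)
        then have "integral {0..2} (\<lambda>t. (if m = 0 then pole t else 0) + rg m t) = integral {0..2} (\<lambda>t. if m = 0 then pole t else 0) + integral {0..2} (rg m)"
          by (rule integral_add) (intro integrable_continuous_real crg)
        then show ?thesis unfolding e r by (cases "m = 0") auto
      qed
      have "((\<lambda>z. \<Sum>m<3. gwt \<sigma> z * Re (gchi m z) * integral {0..2} (\<lambda>t. \<phi> m t * cos (T * t * (ln ((cmod z)\<^sup>2) - Y)))) has_sum
         (\<Sum>m<3. integral {0..2} (\<lambda>t. \<phi> m t * gW m \<sigma> (T * t) Y))) (GI - {0})"
        by (rule has_sum_sum_lessThan) (rule gW_fourier[OF \<sigma> \<phi>])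
      moreover have "(\<Sum>m<3. gwt \<sigma> z * Re (gchi m z) * integral {0..2} (\<lambda>t. \<phi> m t * cos (T * t * (ln ((cmod z)\<^sup>2) - Y)))) = gwt \<sigma> z * gkernel \<phi> T Y z" for z
        by (simp add: gkernel_def sum_distrib_left mult.assoc)
      ultimately have hs: "((\<lambda>z. gwt \<sigma> z * gkernel \<phi> T Y z) has_sum (\<Sum>m<3. integral {0..2} (\<lambda>t. \<phi> m t * gW m \<sigma> (T * t) Y))) (GI - {0})"
        by simp
      have "(\<Sum>m<3. integral {0..2} (\<lambda>t. \<phi> m t * gW m \<sigma> (T * t) Y)) \<le> (\<Sum>z\<in>G Y. M * (gmangoldt z / (cmod z)\<^sup>2))"
      proof (rule has_sum_mono_neutral[OF hs has_sum_finite[OF G(1)]])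
        fix z assume z: "z \<in> (GI - {0}) \<inter> G Y"
        then have zz: "z \<in> GI" "z \<noteq> 0" by auto
        have N1: "(cmod z)\<^sup>2 \<ge> 1" using GI_cmod_ge_1[OF zz] by simp
        have "gwt \<sigma> z * gkernel \<phi> T Y z \<le> gwt \<sigma> z * M"
          using K(1) gwt_nonneg z by (intro mult_left_mono) auto
        also have "\<dots> \<le> gwt 1 z * M"
          unfolding gwt_def using N1 \<sigma> gmangoldt_bounds[OF zz] M by (intro mult_right_mono mult_left_mono powr_mono) auto
        also have "\<dots> = M * (gmangoldt z / (cmod z)\<^sup>2)" using N1 by (simp add: gwt_def powr_minus divide_inverse)
        finally show "gwt \<sigma> z * gkernel \<phi> T Y z \<le> M * (gmangoldt z / (cmod z)\<^sup>2)" .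
      next
        fix z assume "z \<in> (GI - {0}) - G Y"
        then show "gwt \<sigma> z * gkernel \<phi> T Y z \<le> 0" using K(2) gwt_nonneg by (intro mult_nonneg_nonpos) auto
      qed (use G(2) in blast)
      moreover have "(\<Sum>m<3. integral {0..2} (\<lambda>t. \<phi> m t * gW m \<sigma> (T * t) Y)) = integral {0..2} pole + (\<Sum>m<3. regular_part (D m) (\<phi> m) T \<epsilon> Y)"
        unfolding I0 by (simp add: sum.distrib)
      moreover have "J' n \<le> integral {0..2} pole" using J'(2)[of n] unfolding \<epsilon>_def[symmetric] pole_def .
      ultimately show ?thesis unfolding \<epsilon>_def[symmetric] by (simp add: S_def sum_distrib_left)
    qed
    have "(\<lambda>n. J' n + (\<Sum>m<3. regular_part (D m) (\<phi> m) T (1 / real (Suc n)) Y)) \<longlonglongrightarrow> main Y + reg Y"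
      unfolding reg_def by (intro tendsto_intros J'(1) regular_part_limits(1)[OF D(1) \<phi> T])
    then show ?thesis by (rule LIMSEQ_le_const2) (use le in auto)
  qed
  have TY: "filterlim (\<lambda>Y. T * Y) at_top at_top"
    using T by (intro filterlim_tendsto_pos_mult_at_top[OF tendsto_const] filterlim_ident)
  have TY2: "filterlim (\<lambda>Y. 2 * (T * Y)) at_top at_top"
    by (intro filterlim_tendsto_pos_mult_at_top[OF tendsto_const _ TY]) simp
  have "((\<lambda>X. integral {0..2} (\<lambda>t. of_real (\<psi> t) * exp (\<i> * of_real (X * t)))) \<longlongrightarrow> 0) at_top"
    by (rule riemann_lebesgue) (auto intro!: continuous_intros \<psi>)
  then have "((\<lambda>X. Im (integral {0..2} (\<lambda>t. of_real (\<psi> t) * exp (\<i> * of_real (X * t))))) \<longlongrightarrow> Im 0) at_top"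
    by (rule tendsto_Im)
  moreover have "Im (integral {0..2} (\<lambda>t. of_real (\<psi> t) * exp (\<i> * of_real (X * t)))) = integral {0..2} (\<lambda>t. \<psi> t * sin (X * t))" for X
  proof -
    have int: "(\<lambda>t. of_real (\<psi> t) * exp (\<i> * of_real (X * t))) integrable_on {0..2}"
      by (intro integrable_continuous_real continuous_intros \<psi>)
    have "Im (of_real (\<psi> t) * exp (\<i> * of_real (X * t))) = \<psi> t * sin (X * t)" for t
      unfolding cis_conv_exp[symmetric] by simp
    then show ?thesis using integral_unique[OF has_integral_Im[OF integrable_integral[OF int]]] by (simp only:)
  qed
  ultimately have "((\<lambda>X. integral {0..2} (\<lambda>t. \<psi> t * sin (X * t))) \<longlongrightarrow> 0) at_top" by simp
  then have "((\<lambda>Y. integral {0..2} (\<lambda>t. \<psi> t * sin (T * Y * t))) \<longlongrightarrow> 0) at_top"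
    by (rule filterlim_compose[OF _ TY])
  moreover have "((\<lambda>Y. Si (2 * (T * Y))) \<longlongrightarrow> pi / 2) at_top" by (rule filterlim_compose[OF Si_at_top TY2])
  moreover have "(reg \<longlongrightarrow> (\<Sum>m<(3::nat). 0)) at_top"
    unfolding reg_def by (intro tendsto_sum regular_part_limits(2)[OF D(1) \<phi> T])
  ultimately have "((\<lambda>Y. main Y + reg Y) \<longlongrightarrow> (4 / T) * (\<phi> 0 0 * (pi / 2) + 0) + (\<Sum>m<(3::nat). 0)) at_top"
    unfolding main_def by (intro tendsto_intros)
  then have lim: "((\<lambda>Y. main Y + reg Y) \<longlongrightarrow> (4 / T) * (\<phi> 0 0 * (pi / 2))) at_top" by simp
  define c where "c = (4 / T) * (\<phi> 0 0 * (pi / 2)) / 2"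
  have c: "c > 0" using T pos by (simp add: c_def)
  have "c < (4 / T) * (\<phi> 0 0 * (pi / 2))" using c unfolding c_def by linarith
  then have "\<forall>\<^sub>F Y in at_top. main Y + reg Y > c" by (rule order_tendstoD(1)[OF lim])
  then have "\<forall>\<^sub>F Y in at_top. S Y \<ge> c / M"
    using eventually_gt_at_top[of 0]
  proof eventually_elim
    case (elim Y)
    then have "c \<le> M * S Y" using bound[of Y] by linarith
    then show ?case using M by (simp add: field_simps)
  qed
  then show ?thesis using c M by (intro exI[of _ "c / M"]) (simp add: S_def)
qed

section \<open>The kernel\<close>

text \<open>The formula is kept multiplied by c^2 so that it needs no exception at c = 0. It is
  twice the sine square of c, the Fejer numerator.\<close>

lemma integral_linear_cos:
  fixes c :: real
  shows
  "c\<^sup>2 * integral {0..2} (\<lambda>t. (2 - t) * cos (c * t)) = 1 - cos (2 * c)"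
proof -
  have "((\<lambda>t::real. c\<^sup>2 * ((2 - t) * cos (c * t))) has_integral
      (((2 - 2) * c * sin (c * 2) - cos (c * 2)) - ((2 - 0) * c * sin (c * 0) - cos (c * 0)))) {0..2}"
    by (rule fundamental_theorem_of_calculus)
       (auto intro!: derivative_eq_intros simp: has_real_derivative_iff_has_vector_derivative[symmetric] power2_eq_square algebra_simps)
  from integral_unique[OF this] show ?thesis by (simp add: mult.commute)
qed

lemma integral_sin:
  fixes c :: real
  shows
  "c * integral {0..2} (\<lambda>t. sin (c * t)) = 1 - cos (2 * c)"
proof -
  have "((\<lambda>t. c * sin (c * t)) has_integral (- cos (c * 2) - (- cos (c * 0)))) {0..2}"
    by (rule fundamental_theorem_of_calculus)
       (auto intro!: derivative_eq_intros simp: has_real_derivative_iff_has_vector_derivative[symmetric])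
  from integral_unique[OF this] show ?thesis by (simp add: mult.commute)
qed

text \<open>For \<open>a = \<pi>/2\<close> the cosine transforms of \<open>kp\<close> and \<open>kq\<close> on \<open>[0, 2]\<close> are \<open>4a\<^sup>2 cos\<^sup>2 u / (a\<^sup>2 - u\<^sup>2)\<^sup>2\<close> and
  \<open>2a cos\<^sup>2 u / (a\<^sup>2 - u\<^sup>2)\<close>; so multiplying the first by \<open>u\<^sup>2\<close> does not destroy the compact support.\<close>

definition kp :: "real \<Rightarrow> real" where
  "kp t = (2 - t) * cos (pi / 2 * t) + sin (pi / 2 * t) / (pi / 2)"

definition kq :: "real \<Rightarrow> real" where
  "kq t = sin (pi / 2 * t)"

definition hp :: "real \<Rightarrow> real" where
  "hp u = integral {0..2} (\<lambda>t. kp t * cos (u * t))"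

definition hq :: "real \<Rightarrow> real" where
  "hq u = integral {0..2} (\<lambda>t. kq t * cos (u * t))"

lemma continuous_on_kpq [continuous_intros]: "continuous_on S kp" "continuous_on S kq"
  unfolding kp_def kq_def by (intro continuous_intros; simp)+

text \<open>Product-to-sum formulas reduce both transforms to the frequencies a + u and a - u. Since
  2 a = \<pi>, both numerators 1 - cos (2 (a + u)) and 1 - cos (2 (a - u)) equal 2 (cos u)^2, so the
  two contributions combine over common denominators. At u = a and u = -a the values are computed
  directly.\<close>

lemma fejer_type_transforms:
  fixes u :: real
  defines "a \<equiv> pi / 2"
  shows "hp u \<ge> 0" and "2 * a * hq u = (a\<^sup>2 - u\<^sup>2) * hp u"
proof -
  define A where "A c = integral {0..2} (\<lambda>t. (2 - t) * cos (c * t))" for c :: real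
  define S where "S c = integral {0..2} (\<lambda>t. sin (c * t))" for c :: real
  have a: "a > 0" by (simp add: a_def)
  have int: "(\<lambda>t. (2 - t) * cos (c * t)) integrable_on {0..2}" "(\<lambda>t. sin (c * t)) integrable_on {0..2}" for c :: real
    by (intro integrable_continuous_real continuous_intros)+
  have hq: "hq u = (S (a + u) + S (a - u)) / 2"
  proof -
    have "kq t * cos (u * t) = (1/2) * (sin ((a + u) * t) + sin ((a - u) * t))" for t
      by (simp add: kq_def a_def[symmetric] distrib_right left_diff_distrib sin_add sin_diff)
    then have "hq u = (1/2) * integral {0..2} (\<lambda>t. sin ((a + u) * t) + sin ((a - u) * t))"
      unfolding hq_def by (simp only: integral_mult_right)
    then show ?thesis by (simp add: integral_add[OF int(2) int(2)] S_def)
  qed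
  have hp: "hp u = (A (a + u) + A (a - u)) / 2 + hq u / a"
  proof -
    have e: "kp t * cos (u * t) = (1/2) * ((2 - t) * cos ((a + u) * t) + (2 - t) * cos ((a - u) * t)) + (1/a) * (kq t * cos (u * t))" for t
      by (simp add: kp_def kq_def a_def[symmetric] distrib_right left_diff_distrib cos_add cos_diff algebra_simps)
    have i: "(\<lambda>t. (1/2) * ((2 - t) * cos ((a + u) * t) + (2 - t) * cos ((a - u) * t))) integrable_on {0..2}"
      "(\<lambda>t. (1/a) * (kq t * cos (u * t))) integrable_on {0..2}"
      by (intro integrable_continuous_real continuous_intros)+
    have "hp u = integral {0..2} (\<lambda>t. (1/2) * ((2 - t) * cos ((a + u) * t) + (2 - t) * cos ((a - u) * t))) + integral {0..2} (\<lambda>t. (1/a) * (kq t * cos (u * t)))"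
      unfolding hp_def e by (rule integral_add[OF i])
    then show ?thesis unfolding integral_mult_right integral_add[OF int(1) int(1)]
      by (simp add: A_def hq_def)
  qed
  define C where "C = (cos u)\<^sup>2"
  have C0: "C \<ge> 0" by (simp add: C_def)
  have cc: "1 - cos (2 * (a + u)) = 2 * C" "1 - cos (2 * (a - u)) = 2 * C"
  proof -
    have "cos (2 * (a + u)) = - cos (2 * u)" "cos (2 * (a - u)) = - cos (2 * u)"
      by (simp_all add: a_def distrib_left right_diff_distrib cos_add cos_diff)
    then show "1 - cos (2 * (a + u)) = 2 * C" "1 - cos (2 * (a - u)) = 2 * C"
      using cos_double_cos[of u] by (simp_all add: C_def)
  qed
  have eqs: "(a + u)\<^sup>2 * A (a + u) = 2 * C" "(a - u)\<^sup>2 * A (a - u) = 2 * C"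
    "(a + u) * S (a + u) = 2 * C" "(a - u) * S (a - u) = 2 * C"
    unfolding A_def S_def integral_linear_cos integral_sin cc by auto
  have special: "A 0 = 2" "S 0 = 0" "A pi = 0" "S pi = 0"
  proof -
    have "((\<lambda>t. 2 - t) has_integral ((2 * 2 - 2\<^sup>2 / 2) - (2 * 0 - 0\<^sup>2 / 2))) {0..2::real}"
      by (rule fundamental_theorem_of_calculus)
         (auto intro!: derivative_eq_intros simp: has_real_derivative_iff_has_vector_derivative[symmetric])
    from integral_unique[OF this] show "A 0 = 2" by (simp add: A_def)
    show "S 0 = 0" by (simp add: S_def)
    show "A pi = 0" using integral_linear_cos[of pi] by (simp add: A_def)
    show "S pi = 0" using integral_sin[of pi] by (simp add: S_def)
  qed
  have "hp u \<ge> 0 \<and> 2 * a * hq u = (a\<^sup>2 - u\<^sup>2) * hp u"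
  proof (cases "u = a \<or> u = - a")
    case True
    then have "hq u = 0" "hp u = 1"
    proof -
      have "2 * a = pi" by (simp add: a_def)
      then have "(a + u = pi \<and> a - u = 0) \<or> (a + u = 0 \<and> a - u = pi)" using True by auto
      then show "hq u = 0" "hp u = 1" unfolding hp unfolding hq by (auto simp: special)
    qed
    then show ?thesis using True by auto
  next
    case False
    then have nz: "a + u \<noteq> 0" "a - u \<noteq> 0" by auto
    define x y where "x = a + u" and "y = a - u"
    have xy: "x \<noteq> 0" "y \<noteq> 0" "x + y = 2 * a" "a\<^sup>2 - u\<^sup>2 = x * y"
      using nz by (auto simp: x_def y_def power2_eq_square algebra_simps)
    have v: "A x = 2 * C / x\<^sup>2" "A y = 2 * C / y\<^sup>2" "S x = 2 * C / x" "S y = 2 * C / y"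
      using eqs xy unfolding x_def[symmetric] y_def[symmetric] by (simp_all add: field_simps)
    have hq2: "hq u = 2 * a * C / (x * y)"
    proof -
      have "hq u = (x + y) * C / (x * y)"
        unfolding hq x_def[symmetric] y_def[symmetric] v using xy(1,2) by (simp add: field_simps)
      then show ?thesis unfolding xy(3) .
    qed
    have hp2: "hp u = 4 * a\<^sup>2 * C / (x * y)\<^sup>2"
    proof -
      have "hp u = C / x\<^sup>2 + C / y\<^sup>2 + 2 * C / (x * y)"
        unfolding hp x_def[symmetric] y_def[symmetric] v hq2 using a by (simp add: add_divide_distrib)
      also have "\<dots> = C * (x + y)\<^sup>2 / (x * y)\<^sup>2" using xy(1,2) by (simp add: field_simps power2_eq_square)
      also have "\<dots> = 4 * a\<^sup>2 * C / (x * y)\<^sup>2" unfolding xy(3) by (simp add: power_mult_distrib)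
      finally show ?thesis .
    qed
    show ?thesis unfolding hp2 hq2 xy(4) using C0 xy(1,2) by (simp add: power2_eq_square)
  qed
  then show "hp u \<ge> 0" "2 * a * hq u = (a\<^sup>2 - u\<^sup>2) * hp u" by auto
qed

lemma hp_le: "hp u \<le> 6"
proof -
  have "norm (hp u) \<le> 3 * (2 - 0)"
    unfolding hp_def
  proof (rule integral_bound)
    show "continuous_on {0..2} (\<lambda>t. kp t * cos (u * t))" by (intro continuous_intros)
    fix t :: real assume t: "t \<in> {0..2}"
    have "\<bar>(2 - t) * cos (pi / 2 * t)\<bar> \<le> 2 * 1" unfolding abs_mult using t by (intro mult_mono) auto
    moreover have "\<bar>sin (pi / 2 * t) / (pi / 2)\<bar> \<le> 1 / 1"
      unfolding abs_divide using pi_gt3 by (intro frac_le) auto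
    ultimately have "\<bar>kp t\<bar> \<le> 3" unfolding kp_def by linarith
    then have "\<bar>kp t\<bar> * \<bar>cos (u * t)\<bar> \<le> 3 * 1" by (intro mult_mono) auto
    then show "norm (kp t * cos (u * t)) \<le> 3" by (simp add: abs_mult)
  qed simp
  then show ?thesis by simp
qed

text \<open>The coefficients come from expanding \<open>(1 - R) (36 - u\<^sup>2 - 60 (1 + R)) hp u\<close> in the characters, where
  \<open>R = Re (gchi 1 z)\<close> and \<open>R\<^sup>2 = (1 + Re (gchi 2 z)) / 2\<close>. The mean is positive because \<open>36 - 60/2 > (\<pi>/2)\<^sup>2\<close>.\<close>

definition k\<phi> :: "nat \<Rightarrow> real \<Rightarrow> real" where
  "k\<phi> m t = (if m = 0 then (6 - (pi / 2)\<^sup>2) * kp t + pi * kq t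
     else if m = 1 then - ((36 - (pi / 2)\<^sup>2) * kp t + pi * kq t) else 30 * kp t)"

lemma k\<phi>_transform:
  "integral {0..2} (\<lambda>t. k\<phi> m t * cos (u * t)) = (if m = 0 then (6 - (pi / 2)\<^sup>2) * hp u + pi * hq u
     else if m = 1 then - ((36 - (pi / 2)\<^sup>2) * hp u + pi * hq u) else 30 * hp u)"
proof -
  have i: "(\<lambda>t. b * (kp t * cos (u * t)) + c * (kq t * cos (u * t))) integrable_on {0..2}" for b c
    by (intro integrable_continuous_real continuous_intros)
  have "integral {0..2} (\<lambda>t. b * (kp t * cos (u * t)) + c * (kq t * cos (u * t))) = b * hp u + c * hq u" for b c
  proof -
    have "(\<lambda>t. b * (kp t * cos (u * t))) integrable_on {0..2}" "(\<lambda>t. c * (kq t * cos (u * t))) integrable_on {0..2}"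
      by (intro integrable_continuous_real continuous_intros)+
    then show ?thesis by (subst integral_add) (simp_all add: hp_def hq_def)
  qed
  note l = this
  have e: "k\<phi> m t * cos (u * t) = (if m = 0 then 6 - (pi / 2)\<^sup>2 else if m = 1 then - (36 - (pi / 2)\<^sup>2) else 30) * (kp t * cos (u * t))
     + (if m = 0 then pi else if m = 1 then - pi else 0) * (kq t * cos (u * t))" for t
    by (simp add: k\<phi>_def algebra_simps)
  show ?thesis unfolding e l by (simp add: left_diff_distrib)
qed

text \<open>The middle factor has the wanted sign pattern. The nonnegative factor 1 - R preserves it
  and shifts weight towards R = -1; without it the angular mean would start from 36 - 60, which is
  negative.\<close>

lemma gkernel_k\<phi>:
  fixes T Y :: real and z :: complex
  assumes "z \<noteq> 0"
  defines "u \<equiv> T * (ln ((cmod z)\<^sup>2) - Y)"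
  shows "gkernel k\<phi> T Y z = (1 - Re (gchi 1 z)) * (36 - u\<^sup>2 - 60 * (1 + Re (gchi 1 z))) * hp u"
proof -
  define R where "R = Re (gchi 1 z)"
  have "(Re (gchi 1 z))\<^sup>2 + (Im (gchi 1 z))\<^sup>2 = 1"
    using norm_gchi[OF assms(1), of 1] by (simp add: cmod_def)
  moreover have "gchi 2 z = (gchi 1 z)\<^sup>2" using gchi_double[of 1 z] by (simp only: mult_1_right)
  ultimately have R2: "Re (gchi 2 z) = 2 * R\<^sup>2 - 1"
    by (simp add: R_def power2_eq_square algebra_simps)
  have arg: "T * t * (ln ((cmod z)\<^sup>2) - Y) = u * t" for t by (simp add: u_def)
  have pq: "pi * hq u = ((pi / 2)\<^sup>2 - u\<^sup>2) * hp u" using fejer_type_transforms(2)[of u] by simp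
  have "gkernel k\<phi> T Y z = ((6 - (pi / 2)\<^sup>2) * hp u + pi * hq u) - R * ((36 - (pi / 2)\<^sup>2) * hp u + pi * hq u) + (2 * R\<^sup>2 - 1) * (30 * hp u)"
    unfolding gkernel_def arg k\<phi>_transform using assms(1) R2 by (simp add: eval_nat_numeral R_def) (simp add: algebra_simps)
  also have "\<dots> = (1 - R) * (36 - u\<^sup>2 - 60 * (1 + R)) * hp u"
    unfolding pq by (simp add: algebra_simps power2_eq_square)
  finally show ?thesis unfolding R_def .
qed

section \<open>Gaussian primes in a box\<close>

text \<open>The first character equals -1 exactly on the diagonals |Re z| = |Im z|. So this is a
  neighbourhood of the diagonals in a thin annulus of norm about e^Y, and it contains every nonzero
  z at which the kernel can be positive.\<close>

definition gbox :: "real \<Rightarrow> complex set" where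
  "gbox Y = {z \<in> GI - {0}. \<bar>ln ((cmod z)\<^sup>2) - Y\<bar> < 1 / 20 \<and> 1 + Re (gchi 1 z) < 3 / 5}"

lemma gbox_norm_bounds:
  assumes "z \<in> gbox Y"
  shows "exp (Y - 1 / 20) < (cmod z)\<^sup>2" "(cmod z)\<^sup>2 < exp (Y + 1 / 20)"
proof -
  have z: "z \<noteq> 0" "\<bar>ln ((cmod z)\<^sup>2) - Y\<bar> < 1 / 20" using assms by (auto simp: gbox_def)
  then have "Y - 1 / 20 < ln ((cmod z)\<^sup>2)" "ln ((cmod z)\<^sup>2) < Y + 1 / 20" by linarith+
  moreover have "exp (ln ((cmod z)\<^sup>2)) = (cmod z)\<^sup>2" using z by simp
  ultimately show "exp (Y - 1 / 20) < (cmod z)\<^sup>2" "(cmod z)\<^sup>2 < exp (Y + 1 / 20)"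
    by (metis exp_less_cancel_iff)+
qed

lemma finite_gbox: "finite (gbox Y)"
proof (rule finite_subset[OF _ finite_GI_cball])
  show "gbox Y \<subseteq> {z \<in> GI. cmod z \<le> sqrt (exp (Y + 1 / 20))}"
    using gbox_norm_bounds(2) by (auto simp: gbox_def real_le_rsqrt less_imp_le)
qed

text \<open>Supplies the continuous remainder \<psi> needed to split off the value of \<phi> at
  0.\<close>

lemma continuous_on_difference_quotient:
  fixes f :: "real \<Rightarrow> real"
  assumes f: "continuous_on S f" and d: "(f has_real_derivative d) (at 0)"
  shows "continuous_on S (\<lambda>t. if t = 0 then d else (f t - f 0) / t)"
  unfolding continuous_on
proof
  fix x assume x: "x \<in> S"
  show "((\<lambda>t. if t = 0 then d else (f t - f 0) / t) \<longlongrightarrow> (if x = 0 then d else (f x - f 0) / x)) (at x within S)"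
  proof (cases "x = 0")
    case True
    have "((\<lambda>t. (f t - f 0) / (t - 0)) \<longlongrightarrow> d) (at 0 within S)"
      using has_field_derivative_at_within[OF d, of S] by (simp add: has_field_derivative_iff)
    then have "((\<lambda>t. if t = 0 then d else (f t - f 0) / t) \<longlongrightarrow> d) (at 0 within S)"
      by (rule Lim_transform_within[where d = 1]) auto
    then show ?thesis using True by simp
  next
    case False
    have "(f \<longlongrightarrow> f x) (at x within S)" using f x by (simp add: continuous_on)
    then have "((\<lambda>t. (f t - f 0) / t) \<longlongrightarrow> (f x - f 0) / x) (at x within S)"
      using False by (intro tendsto_intros)
    then have "((\<lambda>t. if t = 0 then d else (f t - f 0) / t) \<longlongrightarrow> (f x - f 0) / x) (at x within S)"
      by (rule Lim_transform_within[where d = "\<bar>x\<bar>"]) (use False in auto)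
    then show ?thesis using False by simp
  qed
qed

lemma gmangoldt_gbox_lower_bound:
  "\<exists>c>0. \<forall>\<^sub>F Y in at_top. (\<Sum>z\<in>gbox Y. gmangoldt z / (cmod z)\<^sup>2) \<ge> c"
proof -
  have pi4: "(pi / 2)\<^sup>2 < 6"
  proof -
    have "(pi / 2)\<^sup>2 < 2\<^sup>2" using pi_less_4 by (intro power_strict_mono) auto
    then show ?thesis by simp
  qed
  have cont: "continuous_on S (k\<phi> m)" for S m
    unfolding k\<phi>_def by (cases "m = 0"; cases "m = 1") (auto intro!: continuous_intros)
  have k0: "k\<phi> 0 = (\<lambda>t. (6 - (pi / 2)\<^sup>2) * kp t + pi * kq t)" by (simp add: k\<phi>_def fun_eq_iff)
  have "\<exists>d. (k\<phi> 0 has_real_derivative d) (at 0)"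
    unfolding k0 kp_def kq_def by (rule exI, (rule derivative_eq_intros refl | simp)+)
  then obtain d where d: "(k\<phi> 0 has_real_derivative d) (at 0)" by blast
  define \<psi> where "\<psi> t = (if t = 0 then d else (k\<phi> 0 t - k\<phi> 0 0) / t)" for t
  have c\<psi>: "continuous_on {0..2} \<psi>" unfolding \<psi>_def by (rule continuous_on_difference_quotient[OF cont d])
  have dec: "k\<phi> 0 t = k\<phi> 0 0 + t * \<psi> t" for t by (simp add: \<psi>_def)
  have pos: "k\<phi> 0 0 > 0" using pi4 by (simp add: k0 kp_def kq_def)
  show ?thesis
  \<comment> \<open>T = 120 turns |u| < 6 into the width 1/20 of \<open>gbox\<close>, and 36/60 is
    its angular bound 3/5. M = 432 is 2 * 36 * 6, from 1 - R <= 2, middle factor at most 36 and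
    \<open>hp_le\<close>.\<close>
  proof (rule gmangoldt_localized_lower_bound[where \<phi> = k\<phi> and T = 120 and M = 432 and \<psi> = \<psi>])
    show "finite (gbox Y)" "gbox Y \<subseteq> GI - {0}" for Y by (auto simp: finite_gbox) (auto simp: gbox_def)
    fix Y :: real and z :: complex
    define R where "R = Re (gchi 1 z)"
    define u where "u = 120 * (ln ((cmod z)\<^sup>2) - Y)"
    have R: "-1 \<le> R" "R \<le> 1" using abs_Re_gchi_le[of 1 z] by (auto simp: R_def)
    have hp: "0 \<le> hp u" "hp u \<le> 6" using fejer_type_transforms(1) hp_le by auto
    {
      assume z: "z \<in> GI - {0}"
      have k: "gkernel k\<phi> 120 Y z = (1 - R) * (36 - u\<^sup>2 - 60 * (1 + R)) * hp u"
        using gkernel_k\<phi>[of z 120 Y] z by (simp add: R_def u_def)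
      have "0 \<le> 1 + R" using R by simp
      then have "0 \<le> u\<^sup>2 + 60 * (1 + R)" by (intro add_nonneg_nonneg[OF zero_le_power2 mult_nonneg_nonneg]) simp_all
      then have "36 - u\<^sup>2 - 60 * (1 + R) \<le> 36" by simp
      then have "(1 - R) * (36 - u\<^sup>2 - 60 * (1 + R)) \<le> (1 - R) * 36" using R by (intro mult_left_mono) auto
      also have "\<dots> \<le> 72" using R by simp
      finally have "(1 - R) * (36 - u\<^sup>2 - 60 * (1 + R)) * hp u \<le> 72 * hp u" using hp by (intro mult_right_mono) auto
      also have "\<dots> \<le> 432" using hp by simp
      finally show "gkernel k\<phi> 120 Y z \<le> 432" unfolding k .
    }
    {
      assume z: "z \<in> GI - {0} - gbox Y"
      have k: "gkernel k\<phi> 120 Y z = (1 - R) * (36 - u\<^sup>2 - 60 * (1 + R)) * hp u"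
        using gkernel_k\<phi>[of z 120 Y] z by (simp add: R_def u_def)
      have "\<not> (\<bar>ln ((cmod z)\<^sup>2) - Y\<bar> < 1 / 20 \<and> 1 + R < 3 / 5)" using z by (auto simp: gbox_def R_def)
      then have "36 - u\<^sup>2 - 60 * (1 + R) \<le> 0"
      proof (cases "1 + R < 3 / 5")
        case True
        then have "\<bar>ln ((cmod z)\<^sup>2) - Y\<bar> \<ge> 1 / 20" using \<open>\<not> _\<close> by (simp only: not_less simp_thms)
        moreover have "\<bar>u\<bar> = 120 * \<bar>ln ((cmod z)\<^sup>2) - Y\<bar>" by (simp only: u_def abs_mult abs_numeral)
        ultimately have "\<bar>u\<bar> \<ge> 6" by simp
        then have "6\<^sup>2 \<le> \<bar>u\<bar>\<^sup>2" by (intro power_mono) auto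
        then show ?thesis using R by simp
      next
        case False
        then have "60 * (1 + R) \<ge> 36" by simp
        then show ?thesis using zero_le_power2[of u] by linarith
      qed
      then show "gkernel k\<phi> 120 Y z \<le> 0" unfolding k using R hp
        by (intro mult_nonpos_nonneg mult_nonneg_nonpos) auto
    }
  next
    show "k\<phi> 0 t = k\<phi> 0 0 + t * \<psi> t" for t by (rule dec)
  qed (use cont c\<psi> pos in simp_all)
qed

text \<open>In polar form this is 1 + cos 4\<theta> = 2 (cos 2\<theta>)^2.\<close>

lemma gchi_1_Complex:
  fixes a b :: real
  assumes "a\<^sup>2 + b\<^sup>2 \<noteq> 0"
  shows "1 + Re (gchi 1 (Complex a b)) = 2 * (a\<^sup>2 - b\<^sup>2)\<^sup>2 / (a\<^sup>2 + b\<^sup>2)\<^sup>2"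
proof -
  define z where "z = Complex a b"
  define N where "N = a\<^sup>2 + b\<^sup>2"
  have N: "(cmod z)\<^sup>2 = N" by (simp add: z_def cmod_power2 N_def)
  have N0: "N \<noteq> 0" using assms by (simp add: N_def)
  have "gchi 1 z = z ^ 4 / of_real ((cmod z) ^ 4)" by (simp add: gchi_def power_divide)
  also have "(cmod z) ^ 4 = N\<^sup>2" unfolding N[symmetric] by (simp flip: power_mult)
  finally have "Re (gchi 1 z) = Re (z ^ 4) / N\<^sup>2" by (simp only: Re_divide_of_real)
  moreover have "Re (z ^ 4) = 2 * (a\<^sup>2 - b\<^sup>2)\<^sup>2 - N\<^sup>2"
    by (simp add: z_def N_def power4_eq_xxxx power2_eq_square algebra_simps)
  ultimately have "1 + Re (gchi 1 z) = 2 * (a\<^sup>2 - b\<^sup>2)\<^sup>2 / N\<^sup>2" using N0 by (simp add: field_simps)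
  then show ?thesis by (simp add: z_def N_def)
qed

lemma exp_20_bounds: "exp (1 / 20 :: real) \<le> 20 / 19" "exp (- 1 / 20 :: real) \<ge> 19 / 20"
proof -
  have "1 + (- 1 / 20) \<le> exp (- 1 / 20 :: real)" by (rule exp_ge_add_one_self)
  then show 1: "exp (- 1 / 20 :: real) \<ge> 19 / 20" by simp
  have "exp (1 / 20 :: real) * exp (- 1 / 20) = 1" by (simp flip: exp_add)
  then have "exp (1 / 20 :: real) = 1 / exp (- 1 / 20)" by (simp add: eq_divide_eq)
  also have "\<dots> \<le> 1 / (19 / 20)" using 1 by (intro divide_left_mono) auto
  finally show "exp (1 / 20 :: real) \<le> 20 / 19" by simp
qed

text \<open>With \<open>N = a\<^sup>2 + b\<^sup>2\<close> the two conditions give \<open>|a\<^sup>2 - b\<^sup>2| < \<surd>0.3 N\<close> and \<open>N \<approx> 4.8 Q\<^sup>2\<close>, and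
  \<open>2.4 (1 - \<surd>0.3) > 1\<close>, \<open>2.4 (1 + \<surd>0.3) < 4\<close>, with room for a factor \<open>exp (1/20)\<close>.\<close>

lemma gbox_coordinates:
  fixes Q :: real
  assumes z: "z \<in> gbox (ln (24 / 5 * Q\<^sup>2))" and Q: "Q > 0"
  shows "Q < \<bar>Re z\<bar> \<and> \<bar>Re z\<bar> < 2 * Q \<and> Q < \<bar>Im z\<bar> \<and> \<bar>Im z\<bar> < 2 * Q"
proof -
  define a b where "a = Re z" and "b = Im z"
  define N where "N = a\<^sup>2 + b\<^sup>2"
  have zab: "z = Complex a b" by (simp add: a_def b_def)
  have N: "(cmod z)\<^sup>2 = N" by (simp add: zab cmod_power2 N_def)
  have Q2: "24 / 5 * Q\<^sup>2 > 0" using Q by simp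
  have "N > 0" using z unfolding N[symmetric] by (auto simp: gbox_def)
  \<comment> \<open>The factors 19/20 and 20/19 place N between 4.56 Q^2 and 5.06 Q^2. With the
    angular bound below, the squares of both coordinates then lie between 1.02 Q^2 and 3.92
    Q^2.\<close>
  have lo: "24 / 5 * Q\<^sup>2 * (19 / 20) < N"
  proof -
    have "24 / 5 * Q\<^sup>2 * (19 / 20) \<le> 24 / 5 * Q\<^sup>2 * exp (- 1 / 20)" using exp_20_bounds Q2 by (intro mult_left_mono) auto
    also have "\<dots> = exp (ln (24 / 5 * Q\<^sup>2) - 1 / 20)" by (simp only: diff_conv_add_uminus exp_add exp_ln[OF Q2] minus_divide_left)
    also have "\<dots> < N" using gbox_norm_bounds(1)[OF z] by (simp add: N)
    finally show ?thesis .
  qed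
  have hi: "N < 24 / 5 * Q\<^sup>2 * (20 / 19)"
  proof -
    have "N < exp (ln (24 / 5 * Q\<^sup>2) + 1 / 20)" using gbox_norm_bounds(2)[OF z] by (simp add: N)
    also have "\<dots> = 24 / 5 * Q\<^sup>2 * exp (1 / 20)" using Q2 by (simp add: exp_add)
    also have "\<dots> \<le> 24 / 5 * Q\<^sup>2 * (20 / 19)" using exp_20_bounds Q2 by (intro mult_left_mono) auto
    finally show ?thesis .
  qed
  have z2: "1 + Re (gchi 1 z) < 3 / 5" using z by (simp only: gbox_def mem_Collect_eq)
  have nz: "a\<^sup>2 + b\<^sup>2 \<noteq> 0" using \<open>N > 0\<close> by (simp only: N_def)
  have "2 * (a\<^sup>2 - b\<^sup>2)\<^sup>2 / N\<^sup>2 < 3 / 5"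
    using z2 unfolding N_def zab gchi_1_Complex[OF nz] .
  then have "(a\<^sup>2 - b\<^sup>2)\<^sup>2 < 3 / 10 * N\<^sup>2" using \<open>N > 0\<close> by (simp add: field_simps)
  \<comment> \<open>11/20 is a rational upper bound for the square root of 3/10.\<close>
  also have "\<dots> \<le> (11 / 20 * N)\<^sup>2" by (simp add: power_mult_distrib power2_eq_square)
  finally have "\<bar>a\<^sup>2 - b\<^sup>2\<bar> < 11 / 20 * N"
    using \<open>N > 0\<close> by (intro power2_less_imp_less[of "\<bar>a\<^sup>2 - b\<^sup>2\<bar>" "11 / 20 * N"]) simp_all
  then have ab: "2 * a\<^sup>2 > 9 / 20 * N" "2 * a\<^sup>2 < 31 / 20 * N" "2 * b\<^sup>2 > 9 / 20 * N" "2 * b\<^sup>2 < 31 / 20 * N"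
  proof -
    have "2 * p > 9 / 20 * (p + r) \<and> 2 * p < 31 / 20 * (p + r) \<and> 2 * r > 9 / 20 * (p + r) \<and> 2 * r < 31 / 20 * (p + r)"
      if "\<bar>p - r\<bar> < 11 / 20 * (p + r)" for p r :: real
    proof -
      have "p - r < 11 / 20 * (p + r)" "- (p - r) < 11 / 20 * (p + r)"
        using that unfolding abs_less_iff by blast+
      then show ?thesis by (simp add: algebra_simps)
    qed
    from this[of "a\<^sup>2" "b\<^sup>2"] show "2 * a\<^sup>2 > 9 / 20 * N" "2 * a\<^sup>2 < 31 / 20 * N" "2 * b\<^sup>2 > 9 / 20 * N" "2 * b\<^sup>2 < 31 / 20 * N"
      using \<open>\<bar>a\<^sup>2 - b\<^sup>2\<bar> < 11 / 20 * N\<close> unfolding N_def by auto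
  qed
  have "Q\<^sup>2 < a\<^sup>2" "a\<^sup>2 < (2 * Q)\<^sup>2" "Q\<^sup>2 < b\<^sup>2" "b\<^sup>2 < (2 * Q)\<^sup>2"
    using ab lo hi Q2 by (simp_all add: power_mult_distrib)
  then have "Q < \<bar>a\<bar>" "\<bar>a\<bar> < 2 * Q" "Q < \<bar>b\<bar>" "\<bar>b\<bar> < 2 * Q"
    using Q power2_less_imp_less[of Q "\<bar>a\<bar>"] power2_less_imp_less[of "\<bar>a\<bar>" "2 * Q"]
      power2_less_imp_less[of Q "\<bar>b\<bar>"] power2_less_imp_less[of "\<bar>b\<bar>" "2 * Q"] by simp_all
  then show ?thesis unfolding a_def b_def by simp
qed

text \<open>As p divides its norm n, it divides some rational prime q, and taking norms n divides
  q^2. If n = q^2, then p is an associate of q and lies on a coordinate axis; hence n = q.\<close>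

lemma girr_norm_prime:
  assumes p: "girr p" "Re p \<noteq> 0" "Im p \<noteq> 0"
  shows "\<exists>q::nat. prime q \<and> (cmod p)\<^sup>2 = real q"
proof -
  have pG: "p \<in> GI" "cmod p > 1" using p by (auto simp: girr_def)
  obtain n :: nat where n: "(cmod p)\<^sup>2 = real n" using GI_cmod_square_nat[OF pG(1)] by blast
  have "(cmod p)\<^sup>2 > 1" using pG by (simp add: one_less_power)
  then have n1: "n > 1" using n by simp
  have pn: "of_nat n = p * cnj p" using n complex_norm_square[of p] by (metis of_real_of_nat_eq)
  have dvd_prod: "gdvd p (of_nat (\<Prod>\<^sub># A)) \<Longrightarrow> \<exists>q\<in>#A. gdvd p (of_nat q)" for A :: "nat multiset"
  proof (induction A)
    case empty
    then have "cmod p \<le> 1" using gdvd_cmod_le[of p 1] by simp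
    then show ?case using pG by simp
  next
    case (add q A)
    then have "gdvd p (of_nat q) \<or> gdvd p (of_nat (\<Prod>\<^sub># A))"
      using girr_prime[OF p(1), of "of_nat q" "of_nat (\<Prod>\<^sub># A)"] by simp
    then show ?case using add.IH by auto
  qed
  have "gdvd p (of_nat n)" unfolding pn gdvd_def using pG by blast
  moreover have "n = \<Prod>\<^sub># (prime_factorization n)" using n1 by (simp add: prod_mset_prime_factorization_nat)
  ultimately obtain q where q: "q \<in># prime_factorization n" "gdvd p (of_nat q)" using dvd_prod by metis
  have qp: "prime q" "q dvd n" using q(1) by (auto simp: in_prime_factors_iff)
  obtain w where w: "w \<in> GI" "of_nat q = p * w" using q(2) by (auto simp: gdvd_def)
  obtain k :: nat where k: "(cmod w)\<^sup>2 = real k" using GI_cmod_square_nat[OF w(1)] by blast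
  have "real (q\<^sup>2) = (cmod (of_nat q))\<^sup>2" by simp
  also have "\<dots> = real (n * k)" unfolding w(2) by (simp add: norm_mult power_mult_distrib n k)
  finally have nk: "q\<^sup>2 = n * k" by (simp only: of_nat_eq_iff)
  then have "n dvd q\<^sup>2" by simp
  then obtain i where i: "i \<le> 2" "n = q ^ i" using divides_primepow_nat[OF qp(1)] by blast
  have "i \<noteq> 0"
  proof
    assume "i = 0"
    then show False using i n1 by simp
  qed
  moreover have "i \<noteq> 2"
  proof
    assume "i = 2"
    then have "k = 1" using nk i n1 prime_gt_0_nat[OF qp(1)] by simp
    then have "cmod w = 1" using k power2_eq_imp_eq[of "cmod w" 1] by simp
    then have "gunit w" using w by (simp add: gunit_def)
    then have "p = of_nat q * cnj w" using w gunit_cnj(1)[of w] by (simp add: mult.assoc)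
    then have "Re p = 0 \<or> Im p = 0" using \<open>gunit w\<close> by (auto simp: gunit_iff)
    then show False using p by blast
  qed
  ultimately have "i = 1" using i(1) by auto
  then show ?thesis using i n qp by auto
qed

section \<open>Discarding proper prime powers\<close>

lemma card_GI_cball:
  assumes "r \<ge> 0"
  shows "real (card {z \<in> GI. cmod z \<le> r}) \<le> (2 * r + 3)\<^sup>2"
proof -
  let ?I = "{-\<lceil>r\<rceil>..\<lceil>r\<rceil>}"
  have "card {z \<in> GI. cmod z \<le> r} \<le> card ((\<lambda>(a,b). Complex (of_int a) (of_int b)) ` (?I \<times> ?I))"
    by (intro card_mono GI_cball_subset) auto
  also have "\<dots> \<le> card (?I \<times> ?I)" by (rule card_image_le) auto
  also have "\<dots> = (nat (2 * \<lceil>r\<rceil> + 1))\<^sup>2" by (simp add: card_cartesian_product power2_eq_square)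
  finally have "real (card {z \<in> GI. cmod z \<le> r}) \<le> (real (nat (2 * \<lceil>r\<rceil> + 1)))\<^sup>2"
    by (metis of_nat_le_iff of_nat_power)
  also have "\<dots> \<le> (2 * r + 3)\<^sup>2"
    using assms by (intro power_mono) linarith+
  finally show ?thesis .
qed

lemma girr_unit_mult: assumes "girr p" "gunit e" shows "girr (e * p)"
proof -
  have "cmod a = 1 \<or> cmod b = 1" if "a \<in> GI" "b \<in> GI" "e * p = a * b" for a b
  proof -
    have "p = cnj e * (e * p)" using gunit_cancel[OF assms(2)] by simp
    also have "\<dots> = (cnj e * a) * b" using that(3) by (simp add: mult.assoc)
    finally have "cmod (cnj e * a) = 1 \<or> cmod b = 1"
      using assms that by (auto simp: girr_def gunit_def)
    then show ?thesis using assms(2) by (simp add: norm_mult gunit_def)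
  qed
  then show ?thesis using assms by (auto simp: girr_def gunit_def norm_mult)
qed

text \<open>For j >= 2 the base satisfies |p|^4 <= |z|^2, which leaves O(e^(Y/2)) bases. Its norm is
  at least 2, which leaves O(Y) exponents. The total is negligible against e^Y / Y.\<close>

lemma card_proper_gprimepowers:
  assumes Y: "Y \<ge> 0"
  shows "real (card {z \<in> gbox Y. \<exists>p j. j \<ge> 2 \<and> gprimepow p j z}) \<le> 4 * (2 * (Y + 1) + 1) * (2 * exp ((Y + 1) / 4) + 3)\<^sup>2"
proof -
  define r where "r = exp ((Y + 1) / 4)"
  define J where "J = nat \<lfloor>2 * (Y + 1)\<rfloor>"
  let ?P = "{p \<in> GI. cmod p \<le> r}"
  let ?f = "\<lambda>(e, j, p). e * p ^ j"
  have fin: "finite {e. gunit e}" using card_gunit by (auto intro: card_ge_0_finite)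
  have sub: "{z \<in> gbox Y. \<exists>p j. j \<ge> 2 \<and> gprimepow p j z} \<subseteq> ?f ` ({e. gunit e} \<times> {..J} \<times> ?P)"
  proof
    fix z assume "z \<in> {z \<in> gbox Y. \<exists>p j. j \<ge> 2 \<and> gprimepow p j z}"
    then obtain p j where z: "z \<in> gbox Y" "j \<ge> 2" "gprimepow p j z" by auto
    then obtain e where e: "girr p" "gunit e" "z = e * p ^ j" by (auto simp: gprimepow_def)
    have p: "p \<in> GI" "cmod p > 1" using e by (auto simp: girr_def)
    have zp: "cmod z = cmod p ^ j" using e by (simp add: norm_mult norm_power gunit_def)
    have "(cmod z)\<^sup>2 < exp (Y + 1 / 20)" by (rule gbox_norm_bounds(2)[OF z(1)])
    also have "\<dots> \<le> exp (Y + 1)" by simp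
    finally have z2: "(cmod z)\<^sup>2 \<le> exp (Y + 1)" by simp
    have "cmod p ^ 2 \<le> cmod p ^ j" using p z(2) by (intro power_increasing) auto
    then have "(cmod p ^ 2) ^ 2 \<le> (cmod z)\<^sup>2" using zp by (intro power_mono) auto
    also have "\<dots> \<le> exp (Y + 1)" by (rule z2)
    also have "\<dots> = r ^ 4" by (simp add: r_def flip: exp_of_nat_mult)
    finally have "cmod p ^ 4 \<le> r ^ 4" by (simp flip: power_mult)
    then have pr: "cmod p \<le> r" by (subst (asm) power_mono_iff) (auto simp: r_def)
    obtain k :: nat where k: "(cmod p)\<^sup>2 = real k" using GI_cmod_square_nat p by blast
    have "(cmod p)\<^sup>2 > 1" using p by (simp add: one_less_power)
    then have "k \<ge> 2" using k by simp
    then have "2 ^ j \<le> real k ^ j" by (intro power_mono) auto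
    also have "\<dots> = (cmod z)\<^sup>2" unfolding zp k[symmetric] by (simp add: mult.commute flip: power_mult)
    also have "\<dots> \<le> exp (Y + 1)" by (rule z2)
    finally have "ln (2 ^ j) \<le> ln (exp (Y + 1))" by (subst ln_le_cancel_iff) auto
    then have "real j * ln 2 \<le> Y + 1" by (simp add: ln_realpow)
    moreover have "real j * (1 / 2) \<le> real j * ln 2" using ln2_ge_two_thirds by (intro mult_left_mono) auto
    ultimately have "real j \<le> 2 * (Y + 1)" by simp
    then have "j \<le> J" unfolding J_def by (rule le_nat_floor)
    then show "z \<in> ?f ` ({e. gunit e} \<times> {..J} \<times> ?P)"
      using e p pr by (intro rev_image_eqI[of "(e, j, p)"]) auto
  qed
  have "card {z \<in> gbox Y. \<exists>p j. j \<ge> 2 \<and> gprimepow p j z} \<le> card (?f ` ({e. gunit e} \<times> {..J} \<times> ?P))"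
    using fin finite_GI_cball by (intro card_mono sub) auto
  also have "\<dots> \<le> card ({e. gunit e} \<times> {..J} \<times> ?P)"
    using fin finite_GI_cball by (intro card_image_le) auto
  also have "\<dots> = 4 * ((J + 1) * card ?P)" by (simp add: card_cartesian_product card_gunit)
  finally have "real (card {z \<in> gbox Y. \<exists>p j. j \<ge> 2 \<and> gprimepow p j z}) \<le> real (4 * ((J + 1) * card ?P))"
    by (simp only: of_nat_le_iff)
  also have "\<dots> = 4 * ((real J + 1) * real (card ?P))" by (simp add: algebra_simps)
  also have "\<dots> \<le> 4 * ((2 * (Y + 1) + 1) * (2 * r + 3)\<^sup>2)"
  proof (intro mult_left_mono mult_mono card_GI_cball)
    have "real J \<le> 2 * (Y + 1)" unfolding J_def using Y by simp
    then show "real J + 1 \<le> 2 * (Y + 1) + 1" by simp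
  qed (use Y in \<open>auto simp: r_def\<close>)
  finally show ?thesis by (simp only: r_def mult.assoc)
qed

text \<open>In \<open>gbox Y\<close> a single term of the weighted sum is at most (Y + 1) / (e^Y /
  3), so a sum bounded below forces many terms. The gap between c / 3 and c / 10 absorbs the proper
  powers.\<close>

lemma card_girr_gbox:
  "\<exists>c>0. \<forall>\<^sub>F Y in at_top. real (card {z \<in> gbox Y. girr z}) \<ge> c * exp Y / Y"
proof -
  obtain c where c: "c > 0" "\<forall>\<^sub>F Y in at_top. (\<Sum>z\<in>gbox Y. gmangoldt z / (cmod z)\<^sup>2) \<ge> c"
    using gmangoldt_gbox_lower_bound by blast
  have "\<forall>\<^sub>F Y in at_top. c * (exp Y / 3) / (Y + 1) - 4 * (2 * (Y + 1) + 1) * (2 * exp ((Y + 1) / 4) + 3)\<^sup>2 \<ge> c / 10 * exp Y / Y"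
    using c(1) by real_asymp
  then have "\<forall>\<^sub>F Y in at_top. real (card {z \<in> gbox Y. girr z}) \<ge> c / 10 * exp Y / Y"
    using c(2) eventually_ge_at_top[of 1]
  proof eventually_elim
    case (elim Y)
    define Z where "Z = {z \<in> gbox Y. gmangoldt z \<noteq> 0}"
    have finZ: "finite Z" using finite_gbox by (simp add: Z_def)
    have "c \<le> (\<Sum>z\<in>gbox Y. gmangoldt z / (cmod z)\<^sup>2)" using elim by simp
    also have "\<dots> = (\<Sum>z\<in>Z. gmangoldt z / (cmod z)\<^sup>2)"
      by (rule sum.mono_neutral_right) (auto simp: Z_def finite_gbox)
    also have "\<dots> \<le> (\<Sum>z\<in>Z. (Y + 1) / (exp Y / 3))"
    proof (intro sum_mono frac_le)
      fix z assume "z \<in> Z"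
      then have z: "z \<in> gbox Y" "z \<in> GI" "z \<noteq> 0" by (auto simp: Z_def gbox_def)
      have "\<bar>ln ((cmod z)\<^sup>2) - Y\<bar> < 1 / 20" using z by (simp add: gbox_def)
      then have "ln ((cmod z)\<^sup>2) \<le> Y + 1" by linarith
      then show "gmangoldt z \<le> Y + 1" using gmangoldt_bounds(2)[OF z(2,3)] by linarith
      have "exp Y = exp (Y - 1) * exp 1" by (simp flip: exp_add)
      also have "\<dots> \<le> exp (Y - 1) * 3" by (intro mult_left_mono exp_le) auto
      also have "exp (Y - 1) \<le> exp (Y - 1 / 20)" by simp
      finally have "exp Y / 3 \<le> exp (Y - 1 / 20)" by simp
      then show "exp Y / 3 \<le> (cmod z)\<^sup>2" using gbox_norm_bounds(1)[OF z(1)] by linarith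
    qed (use elim in auto)
    also have "\<dots> = real (card Z) * ((Y + 1) / (exp Y / 3))" by simp
    finally have cZ: "c * (exp Y / 3) / (Y + 1) \<le> real (card Z)" using elim by (simp add: field_simps)
    have "Z \<subseteq> {z \<in> gbox Y. girr z} \<union> {z \<in> gbox Y. \<exists>p j. j \<ge> 2 \<and> gprimepow p j z}"
    proof
      fix z assume z: "z \<in> Z"
      then obtain p j where pj: "gprimepow p j z" by (auto simp: Z_def gmangoldt_def split: if_splits)
      show "z \<in> {z \<in> gbox Y. girr z} \<union> {z \<in> gbox Y. \<exists>p j. j \<ge> 2 \<and> gprimepow p j z}"
      proof (cases "j = 1")
        case True
        then have "girr z" using pj girr_unit_mult by (auto simp: gprimepow_def)
        then show ?thesis using z by (simp add: Z_def)
      next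
        case False
        then have "j \<ge> 2" using pj by (auto simp: gprimepow_def)
        then show ?thesis using z pj by (auto simp: Z_def)
      qed
    qed
    then have "card Z \<le> card ({z \<in> gbox Y. girr z} \<union> {z \<in> gbox Y. \<exists>p j. j \<ge> 2 \<and> gprimepow p j z})"
      using finite_gbox by (intro card_mono) auto
    also have "\<dots> \<le> card {z \<in> gbox Y. girr z} + card {z \<in> gbox Y. \<exists>p j. j \<ge> 2 \<and> gprimepow p j z}"
      by (rule card_Un_le)
    finally have "real (card Z) \<le> real (card {z \<in> gbox Y. girr z}) + real (card {z \<in> gbox Y. \<exists>p j. j \<ge> 2 \<and> gprimepow p j z})"
      by linarith
    then show ?case using cZ elim card_proper_gprimepowers[of Y] by linarith
  qed
  then show ?thesis using c(1) by (intro exI[of _ "c / 10"]) auto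
qed

text \<open>Taking absolute values of the coordinates sends the irreducible elements of the box to
  the wanted pairs, at most four to one.\<close>

theorem prime_sums_of_two_squares_in_box:
  "\<exists>c>0. \<exists>Q1. \<forall>Q\<ge>Q1. real (card {(a, b). a \<in> {n::nat. Q < real n \<and> real n \<le> 2 * Q} \<and>
      b \<in> {n::nat. Q < real n \<and> real n \<le> 2 * Q} \<and> prime (a\<^sup>2 + b\<^sup>2)}) \<ge> c * Q\<^sup>2 / ln Q"
proof -
  obtain c where c: "c > 0" "\<forall>\<^sub>F Y in at_top. real (card {z \<in> gbox Y. girr z}) \<ge> c * exp Y / Y"
    using card_girr_gbox by blast
  have "filterlim (\<lambda>Q::real. ln (24 / 5 * Q\<^sup>2)) at_top at_top" by real_asymp
  from eventually_compose_filterlim[OF c(2) this]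
  have "\<forall>\<^sub>F Q in at_top. real (card {z \<in> gbox (ln (24 / 5 * Q\<^sup>2)). girr z}) \<ge> c * exp (ln (24 / 5 * Q\<^sup>2)) / ln (24 / 5 * Q\<^sup>2)" .
  moreover have "\<forall>\<^sub>F Q in at_top. c * (24 / 5 * Q\<^sup>2) / ln (24 / 5 * Q\<^sup>2) \<ge> 4 * (c / 10 * Q\<^sup>2 / ln Q)"
    using c(1) by real_asymp
  ultimately have "\<forall>\<^sub>F Q in at_top. real (card {(a, b). a \<in> {n::nat. Q < real n \<and> real n \<le> 2 * Q} \<and>
      b \<in> {n::nat. Q < real n \<and> real n \<le> 2 * Q} \<and> prime (a\<^sup>2 + b\<^sup>2)}) \<ge> c / 10 * Q\<^sup>2 / ln Q"
    using eventually_gt_at_top[of 0]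
  proof eventually_elim
    case (elim Q)
    define A where "A = {z \<in> gbox (ln (24 / 5 * Q\<^sup>2)). girr z}"
    define V where "V = {n::nat. Q < real n \<and> real n \<le> 2 * Q}"
    define E where "E = {(a, b). a \<in> V \<and> b \<in> V \<and> prime (a\<^sup>2 + b\<^sup>2)}"
    define S where "S p = (case p of (a, b) \<Rightarrow> {Complex (real a) (real b), Complex (- real a) (real b), Complex (real a) (- real b), Complex (- real a) (- real b)})" for p :: "nat \<times> nat"
    have "V \<subseteq> {..nat \<lfloor>2 * Q\<rfloor>}" using elim by (auto simp: V_def le_nat_floor)
    then have "finite V" using finite_subset by blast
    then have fE: "finite E" by (intro finite_subset[of E "V \<times> V"]) (auto simp: E_def)
    have sub: "A \<subseteq> (\<Union>p\<in>E. S p)"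
    proof
      fix z assume z: "z \<in> A"
      then have zb: "z \<in> gbox (ln (24 / 5 * Q\<^sup>2))" "girr z" by (auto simp: A_def)
      then have co: "Q < \<bar>Re z\<bar>" "\<bar>Re z\<bar> < 2 * Q" "Q < \<bar>Im z\<bar>" "\<bar>Im z\<bar> < 2 * Q"
        using gbox_coordinates elim by auto
      obtain x y where xy: "z = Complex (of_int x) (of_int y)" using zb GI_Complex by (auto simp: gbox_def)
      define a b where "a = nat \<bar>x\<bar>" and "b = nat \<bar>y\<bar>"
      have ab: "real a = \<bar>Re z\<bar>" "real b = \<bar>Im z\<bar>" by (simp_all add: a_def b_def xy)
      have "Re z \<noteq> 0" "Im z \<noteq> 0" using co elim by auto
      then obtain q :: nat where q: "prime q" "(cmod z)\<^sup>2 = real q" using girr_norm_prime[OF zb(2)] by blast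
      have "real (a\<^sup>2 + b\<^sup>2) = (cmod z)\<^sup>2" by (simp add: ab cmod_power2)
      then have "a\<^sup>2 + b\<^sup>2 = q" using q by (simp only: of_nat_eq_iff)
      then have "(a, b) \<in> E" using q co ab by (auto simp: E_def V_def)
      moreover have "z \<in> S (a, b)"
      proof -
        have "Re z = real a \<or> Re z = - real a" "Im z = real b \<or> Im z = - real b" using ab by linarith+
        then show ?thesis by (auto simp: S_def complex_eq_iff)
      qed
      ultimately show "z \<in> (\<Union>p\<in>E. S p)" by blast
    qed
    have cS: "finite (S p) \<and> card (S p) \<le> 4" for p
    proof (cases p)
      case (Pair a b)
      show ?thesis unfolding S_def Pair by (auto intro!: order.trans[OF card_insert_le_m1] simp: card_insert_if)
    qed
    have "card A \<le> card (\<Union>p\<in>E. S p)" using fE cS by (intro card_mono sub) auto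
    also have "\<dots> \<le> (\<Sum>p\<in>E. card (S p))" by (rule card_UN_le[OF fE])
    also have "\<dots> \<le> (\<Sum>p\<in>E. 4)" by (rule sum_mono) (use cS in auto)
    finally have "real (card A) \<le> 4 * real (card E)" by simp
    moreover have "4 * (c / 10 * Q\<^sup>2 / ln Q) \<le> real (card A)"
    proof -
      have e: "exp (ln (24 / 5 * Q\<^sup>2)) = 24 / 5 * Q\<^sup>2" using elim by simp
      have "c * (24 / 5 * Q\<^sup>2) / ln (24 / 5 * Q\<^sup>2) \<le> real (card A)"
        using elim(1) unfolding e A_def .
      then show ?thesis using elim(2) by (rule order.trans[rotated])
    qed
    ultimately have "c / 10 * Q\<^sup>2 / ln Q \<le> real (card E)" by linarith
    then show ?case by (simp only: E_def V_def)
  qed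
  then obtain Q1 where "\<forall>Q\<ge>Q1. real (card {(a, b). a \<in> {n::nat. Q < real n \<and> real n \<le> 2 * Q} \<and>
      b \<in> {n::nat. Q < real n \<and> real n \<le> 2 * Q} \<and> prime (a\<^sup>2 + b\<^sup>2)}) \<ge> c / 10 * Q\<^sup>2 / ln Q"
    unfolding eventually_at_top_linorder by blast
  then show ?thesis using c(1) by (intro exI[of _ "c / 10"]) auto
qed

section \<open>Embedding forests\<close>

text \<open>Choose W to maximize the number of ordered adjacent pairs minus 2 D |W|. Deleting a
  vertex of degree below D would lose fewer than 2 D pairs and increase this quantity. It is
  positive at V, so W is nonempty.\<close>

lemma dense_min_degree_subset:
  fixes V :: "'a set" and E :: "'a \<Rightarrow> 'a \<Rightarrow> bool" and D :: real
  assumes fin: "finite V" and sym: "\<And>a b. E a b \<Longrightarrow> E b a"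
    and dense: "real (card {(a, b). a \<in> V \<and> b \<in> V \<and> E a b}) > 2 * D * real (card V)"
  shows "\<exists>W\<subseteq>V. W \<noteq> {} \<and> (\<forall>a\<in>W. real (card {b\<in>W. E a b}) \<ge> D)"
proof -
  define e where "e W = {(a, b). a \<in> W \<and> b \<in> W \<and> E a b}" for W
  define f where "f W = real (card (e W)) - 2 * D * real (card W)" for W
  have "finite (Pow V)" using fin by simp
  then have mx: "finite (f ` Pow V)" "f ` Pow V \<noteq> {}" by auto
  obtain W where "W \<in> Pow V" "Max (f ` Pow V) = f W" using Max_in[OF mx] by (metis imageE)
  then have W: "W \<in> Pow V" "\<And>U. U \<in> Pow V \<Longrightarrow> f U \<le> f W"
    using Max_ge[OF mx(1)] by auto
  have fW: "finite W" using W fin finite_subset by auto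
  have "f W > 0" using W(2)[of V] dense by (simp add: f_def e_def)
  then have "W \<noteq> {}" by (auto simp: f_def e_def)
  moreover have "real (card {b\<in>W. E a b}) \<ge> D" if a: "a \<in> W" for a
  proof (rule ccontr)
    assume less: "\<not> real (card {b\<in>W. E a b}) \<ge> D"
    let ?N = "{b\<in>W. E a b}"
    have "e W \<subseteq> e (W - {a}) \<union> (Pair a ` ?N \<union> (\<lambda>b. (b, a)) ` ?N)"
      using sym by (auto simp: e_def)
    moreover have fe: "finite (e U)" if "finite U" for U
      by (rule finite_subset[of _ "U \<times> U"]) (use that in \<open>auto simp: e_def\<close>)
    ultimately have "card (e W) \<le> card (e (W - {a}) \<union> (Pair a ` ?N \<union> (\<lambda>b. (b, a)) ` ?N))"
      using fW by (intro card_mono) auto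
    also have "\<dots> \<le> card (e (W - {a})) + (card (Pair a ` ?N) + card ((\<lambda>b. (b, a)) ` ?N))"
      by (meson add_left_mono card_Un_le order_trans)
    also have "\<dots> \<le> card (e (W - {a})) + (card ?N + card ?N)"
      using fW by (intro add_mono card_image_le) auto
    finally have "real (card (e W)) \<le> real (card (e (W - {a}))) + 2 * real (card ?N)" by linarith
    moreover have "real (card W) = real (card (W - {a})) + 1"
      using card_Suc_Diff1[OF fW a] by linarith
    ultimately have "f W < f (W - {a})" using less by (simp add: f_def algebra_simps)
    moreover have "f (W - {a}) \<le> f W" using W(1) by (intro W(2)) auto
    ultimately show False by simp
  qed
  ultimately show ?thesis using W(1) by (intro exI[of _ W] conjI ballI) auto
qed

text \<open>Double counting of the pairs (q, w) with q(x := w) in A'. Such a pair is recovered from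
  the updated function together with the overwritten value q x, so there are at most |A'| |W| of
  them.\<close>

lemma card_fun_upd_fibres:
  fixes A A' :: "('i \<Rightarrow> 'a) set" and d :: real
  assumes x: "x \<in> I" and fI: "finite I" and fW: "finite W"
    and A: "A \<subseteq> (\<Pi>\<^sub>E j\<in>I. W)" and A': "A' \<subseteq> (\<Pi>\<^sub>E j\<in>I. W)"
    and many: "\<And>q. q \<in> A \<Longrightarrow> real (card {w\<in>W. q(x := w) \<in> A'}) \<ge> d"
  shows "real (card A) * d \<le> real (card A') * real (card W)"
proof -
  have finP: "finite (\<Pi>\<^sub>E j\<in>I. W)" using fI fW by (intro finite_PiE) auto
  have fA: "finite A" "finite A'" using finite_subset[OF A finP] finite_subset[OF A' finP] .
  define S where "S = (SIGMA q:A. {w\<in>W. q(x := w) \<in> A'})"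
  have "card S \<le> card (A' \<times> W)"
  proof (rule card_inj_on_le)
    show "inj_on (\<lambda>(q, w). (q(x := w), q x)) S"
    proof (rule inj_onI, clarify)
      fix q w q' w' assume e: "q(x := w) = q'(x := w')" "q x = q' x"
      have "w = w'" using fun_cong[OF e(1), of x] by simp
      moreover have "q = q'"
      proof
        fix j show "q j = q' j" using fun_cong[OF e(1), of j] e(2) by (cases "j = x") auto
      qed
      ultimately show "q = q' \<and> w = w'" by simp
    qed
    show "(\<lambda>(q, w). (q(x := w), q x)) ` S \<subseteq> A' \<times> W"
      using A x by (auto simp: S_def PiE_def Pi_def)
  qed (use fA fW in auto)
  then have "real (card S) \<le> real (card A') * real (card W)"
    by (metis card_cartesian_product of_nat_le_iff of_nat_mult)
  moreover have "real (card S) = (\<Sum>q\<in>A. real (card {w\<in>W. q(x := w) \<in> A'}))"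
    unfolding S_def using fA fW by (subst card_SigmaI) auto
  moreover have "\<dots> \<ge> (\<Sum>q\<in>A. d)" by (rule sum_mono) (use many in auto)
  ultimately show ?thesis by simp
qed

text \<open>Edges are imposed in decreasing order of index. \<open>A r\<close> contains the maps
  whose edges after r give distinct primes. To impose the next edge, the value at its endpoint x
  that no later edge uses is replaced by a suitable neighbour of the value at the other endpoint;
  later edges are unaffected. Each step costs at most the factor (D - k) / |W|.\<close>

lemma forest_prime_embeddings:
  fixes u v :: "nat \<Rightarrow> nat" and W :: "nat set" and D :: real
  assumes uv: "\<And>i. i \<in> {1..k} \<Longrightarrow> u i \<in> {1..l} \<and> v i \<in> {1..l}"
    and ne: "\<And>i. i \<in> {1..k} \<Longrightarrow> u i \<noteq> v i"
    and leaf: "\<And>i. i \<in> {1..k} \<Longrightarrow> u i \<notin> u ` {i<..k} \<union> v ` {i<..k} \<or>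
                      v i \<notin> u ` {i<..k} \<union> v ` {i<..k}"
    and fW: "finite W" and W0: "W \<noteq> {}"
    and deg: "\<And>a. a \<in> W \<Longrightarrow> real (card {b\<in>W. prime (a\<^sup>2 + b\<^sup>2)}) \<ge> D"
    and Dk: "D \<ge> real k"
  shows "real (card {q \<in> (\<Pi>\<^sub>E j\<in>{1..l}. W). (\<forall>i\<in>{1..k}. prime ((q (u i))\<^sup>2 + (q (v i))\<^sup>2)) \<and>
           inj_on (\<lambda>i. (q (u i))\<^sup>2 + (q (v i))\<^sup>2) {1..k}})
         \<ge> real (card W) ^ l * ((D - real k) / real (card W)) ^ k"
proof -
  define n where "n q i = (q (u i))\<^sup>2 + (q (v i))\<^sup>2" for q :: "nat \<Rightarrow> nat" and i
  define A where "A r = {q \<in> (\<Pi>\<^sub>E j\<in>{1..l}. W). (\<forall>i\<in>{r<..k}. prime (n q i)) \<and> inj_on (n q) {r<..k}}" for r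
  have cW: "real (card W) > 0" using fW W0 by (simp add: card_gt_0_iff)
  have step: "real (card (A (Suc r))) * (D - real k) \<le> real (card (A r)) * real (card W)" if r: "r < k" for r
  proof -
    define i where "i = Suc r"
    have i: "i \<in> {1..k}" using r by (auto simp: i_def)
    define x where "x = (if u i \<notin> u ` {i<..k} \<union> v ` {i<..k} then u i else v i)"
    define y where "y = (if u i \<notin> u ` {i<..k} \<union> v ` {i<..k} then v i else u i)"
    have x: "x \<notin> u ` {i<..k} \<union> v ` {i<..k}" using leaf[OF i] by (auto simp: x_def)
    have xy: "x \<noteq> y" "x \<in> {1..l}" "y \<in> {1..l}" using ne[OF i] uv[OF i] by (auto simp: x_def y_def)
    have ni: "n q i = (q x)\<^sup>2 + (q y)\<^sup>2" for q by (auto simp: n_def x_def y_def)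
    have nj: "n (q(x := w)) j = n q j" if "j \<in> {i<..k}" for q w j
    proof -
      have "u j \<noteq> x" "v j \<noteq> x" using x that by blast+
      then show ?thesis by (simp add: n_def)
    qed
    have ins: "{r<..k} = insert i {i<..k}" using r by (auto simp: i_def)
    show ?thesis
    proof (rule card_fun_upd_fibres[where x = x and I = "{1..l}"])
      show "A (Suc r) \<subseteq> (\<Pi>\<^sub>E j\<in>{1..l}. W)" "A r \<subseteq> (\<Pi>\<^sub>E j\<in>{1..l}. W)" by (auto simp: A_def)
      fix q assume q: "q \<in> A (Suc r)"
      then have qW: "q \<in> (\<Pi>\<^sub>E j\<in>{1..l}. W)" by (simp add: A_def)
      have qy: "q y \<in> W" using qW xy by auto
      \<comment> \<open>Values that would repeat the prime of a later edge; each later edge excludes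
        at most one, since it determines w^2.\<close>
      define Bad where "Bad = (\<Union>j\<in>{i<..k}. {w. w\<^sup>2 + (q y)\<^sup>2 = n q j})"
      have bad1: "finite {w. w\<^sup>2 + (q y)\<^sup>2 = N} \<and> card {w. w\<^sup>2 + (q y)\<^sup>2 = N} \<le> 1" for N :: nat
      proof -
        have "\<exists>w0. {w. w\<^sup>2 + (q y)\<^sup>2 = N} \<subseteq> {w0}"
        proof (cases "\<exists>w0. w0\<^sup>2 + (q y)\<^sup>2 = N")
          case True
          then obtain w0 where "w0\<^sup>2 + (q y)\<^sup>2 = N" by blast
          then have "{w. w\<^sup>2 + (q y)\<^sup>2 = N} \<subseteq> {w0}" by auto
          then show ?thesis by blast
        qed auto
        then obtain w0 where s: "{w. w\<^sup>2 + (q y)\<^sup>2 = N} \<subseteq> {w0}" by blast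
        show ?thesis using finite_subset[OF s] card_mono[OF _ s] by auto
      qed
      have "card Bad \<le> (\<Sum>j\<in>{i<..k}. card {w. w\<^sup>2 + (q y)\<^sup>2 = n q j})"
        unfolding Bad_def by (rule card_UN_le) auto
      also have "\<dots> \<le> (\<Sum>j\<in>{i<..k}. 1)" by (rule sum_mono) (use bad1 in auto)
      also have "\<dots> \<le> k" by simp
      finally have cB: "card Bad \<le> k" .
      have fB: "finite Bad" unfolding Bad_def using bad1 by auto
      have good: "{b\<in>W. prime ((q y)\<^sup>2 + b\<^sup>2)} - Bad \<subseteq> {w\<in>W. q(x := w) \<in> A r}"
      proof safe
        fix w assume w: "w \<in> W" "prime ((q y)\<^sup>2 + w\<^sup>2)" "w \<notin> Bad"
        have e: "n (q(x := w)) i = w\<^sup>2 + (q y)\<^sup>2" using xy by (simp add: ni)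
        have inj: "inj_on (n (q(x := w))) {i<..k}"
          using q nj by (simp add: A_def i_def inj_on_def)
        have "n (q(x := w)) i \<notin> n (q(x := w)) ` {i<..k}"
          using w(3) nj e by (auto simp: Bad_def)
        then have "inj_on (n (q(x := w))) {r<..k}" unfolding ins using inj by (auto simp: inj_on_insert)
        moreover have "\<forall>j\<in>{r<..k}. prime (n (q(x := w)) j)" unfolding ins
          using q nj e w by (auto simp: A_def i_def add.commute)
        moreover have "q(x := w) \<in> (\<Pi>\<^sub>E j\<in>{1..l}. W)" using qW w xy by (auto simp: PiE_def extensional_def)
        ultimately show "q(x := w) \<in> A r" by (simp add: A_def)
      qed
      have "D - real k \<le> real (card {b\<in>W. prime ((q y)\<^sup>2 + b\<^sup>2)}) - real (card Bad)"
        using deg[OF qy] cB by linarith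
      also have "\<dots> \<le> real (card ({b\<in>W. prime ((q y)\<^sup>2 + b\<^sup>2)} - Bad))"
        using diff_card_le_card_Diff[OF fB, of "{b\<in>W. prime ((q y)\<^sup>2 + b\<^sup>2)}"] by linarith
      also have "\<dots> \<le> real (card {w\<in>W. q(x := w) \<in> A r})"
        using good fW by (simp add: card_mono)
      finally show "D - real k \<le> real (card {w\<in>W. q(x := w) \<in> A r})" .
    qed (use xy fW in auto)
  qed
  define t where "t = (D - real k) / real (card W)"
  have t0: "t \<ge> 0" using Dk cW by (simp add: t_def)
  have "real (card (A (k - j))) \<ge> real (card W) ^ l * t ^ j" if "j \<le> k" for j
    using that
  proof (induction j)
    case 0
    have "A k = (\<Pi>\<^sub>E j\<in>{1..l}. W)" by (auto simp: A_def)
    then show ?case by (simp add: card_PiE)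
  next
    case (Suc j)
    define r where "r = k - Suc j"
    have r: "r < k" "Suc r = k - j" using Suc by (auto simp: r_def)
    have "real (card W) ^ l * t ^ j * t \<le> real (card (A (Suc r))) * t"
      using Suc r t0 by (intro mult_right_mono) auto
    also have "\<dots> = real (card (A (Suc r))) * (D - real k) / real (card W)" by (simp add: t_def)
    also have "\<dots> \<le> real (card (A r))" using step[OF r(1)] cW by (simp add: divide_le_eq)
    finally show ?case unfolding r_def by (simp add: mult_ac)
  qed
  from this[of k] have "real (card (A 0)) \<ge> real (card W) ^ l * t ^ k" by simp
  moreover have "{0<..k} = {1..k}" by auto
  ultimately show ?thesis by (simp add: A_def n_def[abs_def] t_def)
qed

section \<open>From embeddings to the weighted sum\<close>

lemma squarefree_prod_distinct_primes:
  fixes f :: "'a \<Rightarrow> nat"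
  assumes "finite I" "\<And>i. i \<in> I \<Longrightarrow> prime (f i)" "inj_on f I"
  shows "squarefree (\<Prod>i\<in>I. f i)"
  using assms
proof (induction I rule: finite_induct)
  case (insert x I)
  have "coprime (f x) (\<Prod>i\<in>I. f i)"
  proof (rule prod_coprime_right)
    fix i assume "i \<in> I"
    then have "f x \<noteq> f i" using insert by (auto simp: inj_on_def)
    then show "coprime (f x) (f i)" using insert \<open>i \<in> I\<close> by (simp add: primes_coprime)
  qed
  then have "squarefree (f x * (\<Prod>i\<in>I. f i))"
    using insert by (subst squarefree_mult_coprime) (auto simp: squarefree_prime inj_on_insert)
  then show ?case using insert by simp
qed auto

text \<open>Each embedding with distinct primes contributes at least 1 and every other term is
  nonnegative, so it suffices to count embeddings into a subgraph of minimum degree D = c1 Q / ln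
  Q.\<close>

lemma forest_sum_lower_bound:
  fixes c0 Q1 :: real and k l :: nat
  assumes c0: "c0 > 0"
    and pairs: "\<forall>Q\<ge>Q1. real (card {(a, b). a \<in> {n::nat. Q < real n \<and> real n \<le> 2 * Q} \<and>
        b \<in> {n::nat. Q < real n \<and> real n \<le> 2 * Q} \<and> prime (a\<^sup>2 + b\<^sup>2)}) \<ge> c0 * Q\<^sup>2 / ln Q"
  shows "\<exists>c::real. c > 0 \<and> (\<exists>Q0::real. Q0 > 1 \<and>
    (\<forall>u v :: nat \<Rightarrow> nat.
       (\<forall>i\<in>{1..k}. u i \<in> {1..l} \<and> v i \<in> {1..l}) \<longrightarrow>
       (\<forall>i\<in>{1..k}. u i \<noteq> v i) \<longrightarrow>
       (\<forall>i\<in>{1..k}. u i \<notin> u ` {i<..k} \<union> v ` {i<..k} \<or>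
                      v i \<notin> u ` {i<..k} \<union> v ` {i<..k}) \<longrightarrow>
       (\<forall>Q::real. Q \<ge> Q0 \<longrightarrow>
          (\<Sum>q\<in>(\<Pi>\<^sub>E j\<in>{1..l}. {n::nat. Q < real n \<and> real n \<le> 2 * Q}).
              real_of_int ((moebius_mu (\<Prod>i=1..k. q (u i) ^ 2 + q (v i) ^ 2)) ^ 2) *
              (\<Prod>i=1..k. mangoldt (q (u i) ^ 2 + q (v i) ^ 2)))
          \<ge> c * Q ^ l / (ln Q) ^ (k + l))))"
proof -
  \<comment> \<open>With |V| <= 2 Q, the factor 1/8 makes 2 D |V| at most half the number of
    adjacent pairs, giving the strict inequality needed to extract the subgraph.\<close>
  define c1 where "c1 = c0 / 8"
  have c1: "c1 > 0" using c0 by (simp add: c1_def)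
  \<comment> \<open>D >= 2 k + 1 gives D - k >= D / 2, and Q >= 3 > e makes ln Q and the logarithms
    of the primes that occur at least 1.\<close>
  have "eventually (\<lambda>Q::real. c1 * Q / ln Q \<ge> 2 * real k + 1) at_top" using c1 by real_asymp
  moreover have "eventually (\<lambda>Q::real. Q \<ge> max Q1 3) at_top" by (rule eventually_ge_at_top)
  ultimately have "eventually (\<lambda>Q::real. c1 * Q / ln Q \<ge> 2 * real k + 1 \<and> Q \<ge> max Q1 3) at_top"
    by eventually_elim auto
  then obtain Q0 where Q0: "\<And>Q. Q \<ge> Q0 \<Longrightarrow> c1 * Q / ln Q \<ge> 2 * real k + 1 \<and> Q \<ge> max Q1 3"
    by (auto simp: eventually_at_top_linorder)
  define c where "c = c1 ^ l * (c1 / 4) ^ k"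
  show ?thesis
  proof (rule exI[of _ c], intro conjI exI[of _ "max Q0 2"] allI impI)
    show "c > 0" using c1 by (simp add: c_def)
    show "max Q0 2 > 1" by simp
    fix u v :: "nat \<Rightarrow> nat" and Q :: real
    assume uv: "\<forall>i\<in>{1..k}. u i \<in> {1..l} \<and> v i \<in> {1..l}"
      and ne: "\<forall>i\<in>{1..k}. u i \<noteq> v i"
      and leaf: "\<forall>i\<in>{1..k}. u i \<notin> u ` {i<..k} \<union> v ` {i<..k} \<or> v i \<notin> u ` {i<..k} \<union> v ` {i<..k}"
      and "max Q0 2 \<le> Q"
    then have Q: "c1 * Q / ln Q \<ge> 2 * real k + 1" "Q \<ge> Q1" "Q \<ge> 3" using Q0[of Q] by auto
    define V where "V = {n::nat. Q < real n \<and> real n \<le> 2 * Q}"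
    define D where "D = c1 * Q / ln Q"
    have lnQ: "ln Q \<ge> 1" using Q exp_le ln_ge_iff[of Q 1] by linarith
    have VV: "V \<subseteq> {1..nat \<lfloor>2 * Q\<rfloor>}" using Q by (auto simp: V_def le_nat_floor Suc_le_eq) 
    then have finV: "finite V" using finite_subset by blast
    have cV: "real (card V) \<le> 2 * Q"
    proof -
      have "card V \<le> nat \<lfloor>2 * Q\<rfloor>" using card_mono[OF _ VV] by simp
      then show ?thesis using Q by linarith
    qed
    have D0: "D \<ge> 2 * real k + 1" using Q by (simp add: D_def)
    have "2 * D * real (card V) \<le> 2 * D * (2 * Q)" using cV D0 by (intro mult_left_mono) auto
    also have "\<dots> = c0 * Q\<^sup>2 / ln Q / 2" by (simp add: D_def c1_def power2_eq_square mult_ac)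
    also have "\<dots> < c0 * Q\<^sup>2 / ln Q"
    proof -
      have "c0 * Q\<^sup>2 / ln Q > 0" using c0 Q lnQ by (intro divide_pos_pos mult_pos_pos) auto
      moreover have "x / 2 < x" if "x > 0" for x :: real using that by simp
      ultimately show ?thesis by blast
    qed
    also have "\<dots> \<le> real (card {(a, b). a \<in> V \<and> b \<in> V \<and> prime (a\<^sup>2 + b\<^sup>2)})"
      unfolding V_def by (rule pairs[rule_format, OF Q(2)])
    finally obtain W where W: "W \<subseteq> V" "W \<noteq> {}" "\<And>a. a \<in> W \<Longrightarrow> real (card {b\<in>W. prime (a\<^sup>2 + b\<^sup>2)}) \<ge> D"
      using dense_min_degree_subset[OF finV, of "\<lambda>a b. prime (a\<^sup>2 + b\<^sup>2)" D] by (auto simp: add.commute)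
    have fW: "finite W" using W finV finite_subset by blast
    define G where "G = {q \<in> (\<Pi>\<^sub>E j\<in>{1..l}. W). (\<forall>i\<in>{1..k}. prime ((q (u i))\<^sup>2 + (q (v i))\<^sup>2)) \<and>
           inj_on (\<lambda>i. (q (u i))\<^sup>2 + (q (v i))\<^sup>2) {1..k}}"
    have cG: "real (card G) \<ge> real (card W) ^ l * ((D - real k) / real (card W)) ^ k"
      unfolding G_def by (rule forest_prime_embeddings) (use uv ne leaf fW W D0 in auto)
    obtain a where a: "a \<in> W" using W by blast
    have DW: "D \<le> real (card W)"
      using W(3)[OF a] card_mono[OF fW, of "{b\<in>W. prime (a\<^sup>2 + b\<^sup>2)}"] by fastforce
    have W2Q: "real (card W) \<le> 2 * Q" using cV card_mono[OF finV W(1)] by linarith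
    have Wpos: "real (card W) > 0" using DW D0 by linarith
    have "c * Q ^ l / (ln Q) ^ (k + l) = D ^ l * ((c1 / 4) / ln Q) ^ k"
      by (simp add: c_def D_def power_divide power_mult_distrib power_add field_simps)
    also have "(c1 / 4) / ln Q = (D / 2) / (2 * Q)" using Q by (simp add: D_def)
    \<comment> \<open>The size of W is not known more precisely than D <= |W| <= 2 Q. The lower
      bound is used in the power l, the upper bound in the denominator of the power k.\<close>
    also have "D ^ l * ((D / 2) / (2 * Q)) ^ k \<le> real (card W) ^ l * ((D - real k) / real (card W)) ^ k"
      using D0 DW W2Q Wpos Q by (intro mult_mono power_mono frac_le) auto
    also have "\<dots> \<le> real (card G)" by (rule cG)
    also have "\<dots> = (\<Sum>q\<in>G. 1)" by simp
    also have "\<dots> \<le> (\<Sum>q\<in>G. real_of_int ((moebius_mu (\<Prod>i=1..k. q (u i) ^ 2 + q (v i) ^ 2)) ^ 2) *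
              (\<Prod>i=1..k. mangoldt (q (u i) ^ 2 + q (v i) ^ 2)))"
    proof (rule sum_mono)
      fix q assume q: "q \<in> G"
      have sf: "squarefree (\<Prod>i=1..k. q (u i) ^ 2 + q (v i) ^ 2)"
        by (rule squarefree_prod_distinct_primes) (use q in \<open>auto simp: G_def\<close>)
      then have "(\<Prod>i=1..k. q (u i) ^ 2 + q (v i) ^ 2) \<noteq> 0" by (metis not_squarefree_0)
      then have mu: "(moebius_mu (\<Prod>i=1..k. q (u i) ^ 2 + q (v i) ^ 2)) ^ 2 = 1"
        using sf unfolding moebius_mu_def by (simp add: minus_one_power_iff)
      have "1 \<le> (\<Prod>i=1..k. mangoldt (q (u i) ^ 2 + q (v i) ^ 2) :: real)"
      proof (rule prod_ge_1)
        fix i assume i: "i \<in> {1..k}"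
        have p: "prime (q (u i) ^ 2 + q (v i) ^ 2)" using q i by (auto simp: G_def)
        have "q (u i) \<in> W" using q i uv by (auto simp: G_def PiE_def Pi_def)
        then have "Q \<le> real (q (u i))" using W by (auto simp: V_def)
        also have "\<dots> \<le> real (q (u i) ^ 2 + q (v i) ^ 2)"
          by (subst of_nat_le_iff) (simp add: power2_eq_square trans_le_add1)
        finally have "3 \<le> real (q (u i) ^ 2 + q (v i) ^ 2)" using Q by linarith
        then have "1 \<le> ln (real (q (u i) ^ 2 + q (v i) ^ 2))"
          using exp_le ln_ge_iff[of "real (q (u i) ^ 2 + q (v i) ^ 2)" 1] by linarith
        then show "1 \<le> (mangoldt (q (u i) ^ 2 + q (v i) ^ 2) :: real)" using p by simp
      qed
      then show "1 \<le> real_of_int ((moebius_mu (\<Prod>i=1..k. q (u i) ^ 2 + q (v i) ^ 2)) ^ 2) *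
              (\<Prod>i=1..k. mangoldt (q (u i) ^ 2 + q (v i) ^ 2))" unfolding mu by simp
    qed
    also have "\<dots> \<le> (\<Sum>q\<in>(\<Pi>\<^sub>E j\<in>{1..l}. V). real_of_int ((moebius_mu (\<Prod>i=1..k. q (u i) ^ 2 + q (v i) ^ 2)) ^ 2) *
              (\<Prod>i=1..k. mangoldt (q (u i) ^ 2 + q (v i) ^ 2)))"
    proof (rule sum_mono2)
      show "finite (\<Pi>\<^sub>E j\<in>{1..l}. V)" using finV by (intro finite_PiE) auto
      show "G \<subseteq> (\<Pi>\<^sub>E j\<in>{1..l}. V)" using W by (auto simp: G_def PiE_def Pi_def)
    qed (auto intro!: mult_nonneg_nonneg prod_nonneg mangoldt_nonneg)
    finally show "c * Q ^ l / (ln Q) ^ (k + l) \<le> (\<Sum>q\<in>(\<Pi>\<^sub>E j\<in>{1..l}. {n::nat. Q < real n \<and> real n \<le> 2 * Q}).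
              real_of_int ((moebius_mu (\<Prod>i=1..k. q (u i) ^ 2 + q (v i) ^ 2)) ^ 2) *
              (\<Prod>i=1..k. mangoldt (q (u i) ^ 2 + q (v i) ^ 2)))" unfolding V_def .
  qed
qed

text \<open>The constants are chosen before u and v, and C is k + l. A threshold for Q is
  unavoidable: for 1 < Q < 3/2 every coordinate is 2, each factor is 8 and the sum is 0. A loop u i
  = v i would likewise make the sum 0, since 2 q^2 is not squarefree for q > 1.\<close>

theorem theorem1p4:
  fixes k l :: nat
  assumes "k \<ge> 1" and "l \<ge> 1"
  shows "\<exists>C::real. C > 0 \<and> (\<exists>c::real. c > 0 \<and> (\<exists>Q0::real. Q0 > 1 \<and>
    (\<forall>u v :: nat \<Rightarrow> nat.
       (\<forall>i\<in>{1..k}. u i \<in> {1..l} \<and> v i \<in> {1..l}) \<longrightarrow>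
       (\<forall>i\<in>{1..k}. u i \<noteq> v i) \<longrightarrow>
       (\<forall>i\<in>{1..k}. \<forall>j\<in>{1..k}. i \<noteq> j \<longrightarrow> {u i, v i} \<noteq> {u j, v j}) \<longrightarrow>
       (\<forall>i\<in>{1..k}. u i \<notin> u ` {i<..k} \<union> v ` {i<..k} \<or>
                      v i \<notin> u ` {i<..k} \<union> v ` {i<..k}) \<longrightarrow>
       (\<forall>Q::real. Q \<ge> Q0 \<longrightarrow>
          (\<Sum>q\<in>(\<Pi>\<^sub>E j\<in>{1..l}. {n::nat. Q < real n \<and> real n \<le> 2 * Q}).
              real_of_int ((moebius_mu (\<Prod>i=1..k. q (u i) ^ 2 + q (v i) ^ 2)) ^ 2) *
              (\<Prod>i=1..k. mangoldt (q (u i) ^ 2 + q (v i) ^ 2)))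
          \<ge> c * Q ^ l / (ln Q) powr C))))"
proof -
  obtain c0 Q1 where c0: "c0 > 0" and pairs: "\<forall>Q\<ge>Q1. real (card {(a, b). a \<in> {n::nat. Q < real n \<and> real n \<le> 2 * Q} \<and>
      b \<in> {n::nat. Q < real n \<and> real n \<le> 2 * Q} \<and> prime (a\<^sup>2 + b\<^sup>2)}) \<ge> c0 * Q\<^sup>2 / ln Q"
    using prime_sums_of_two_squares_in_box by blast
  from forest_sum_lower_bound[OF c0 pairs, where k = k and l = l]
  obtain c Q0 where c: "c > 0" "Q0 > 1" and bound: "\<forall>u v :: nat \<Rightarrow> nat.
       (\<forall>i\<in>{1..k}. u i \<in> {1..l} \<and> v i \<in> {1..l}) \<longrightarrow> (\<forall>i\<in>{1..k}. u i \<noteq> v i) \<longrightarrow>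
       (\<forall>i\<in>{1..k}. u i \<notin> u ` {i<..k} \<union> v ` {i<..k} \<or> v i \<notin> u ` {i<..k} \<union> v ` {i<..k}) \<longrightarrow>
       (\<forall>Q::real. Q \<ge> Q0 \<longrightarrow>
          (\<Sum>q\<in>(\<Pi>\<^sub>E j\<in>{1..l}. {n::nat. Q < real n \<and> real n \<le> 2 * Q}).
              real_of_int ((moebius_mu (\<Prod>i=1..k. q (u i) ^ 2 + q (v i) ^ 2)) ^ 2) *
              (\<Prod>i=1..k. mangoldt (q (u i) ^ 2 + q (v i) ^ 2)))
          \<ge> c * Q ^ l / (ln Q) ^ (k + l))"
    by (elim exE conjE)
  show ?thesis
  proof (intro exI conjI allI impI)
    show "0 < real (k + l)" using assms by simp
    show "0 < c" "1 < Q0" using c by auto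
    fix u v :: "nat \<Rightarrow> nat" and Q :: real
    assume uv: "\<forall>i\<in>{1..k}. u i \<in> {1..l} \<and> v i \<in> {1..l}" "\<forall>i\<in>{1..k}. u i \<noteq> v i"
      "\<forall>i\<in>{1..k}. u i \<notin> u ` {i<..k} \<union> v ` {i<..k} \<or> v i \<notin> u ` {i<..k} \<union> v ` {i<..k}" "Q0 \<le> Q"
    assume "\<forall>i\<in>{1..k}. \<forall>j\<in>{1..k}. i \<noteq> j \<longrightarrow> {u i, v i} \<noteq> {u j, v j}"
    have "ln Q powr real (k + l) = ln Q ^ (k + l)" using uv(4) c(2) by (intro powr_realpow) simp
    then show "c * Q ^ l / ln Q powr real (k + l) \<le>
          (\<Sum>q\<in>(\<Pi>\<^sub>E j\<in>{1..l}. {n::nat. Q < real n \<and> real n \<le> 2 * Q}).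
              real_of_int ((moebius_mu (\<Prod>i=1..k. q (u i) ^ 2 + q (v i) ^ 2)) ^ 2) *
              (\<Prod>i=1..k. mangoldt (q (u i) ^ 2 + q (v i) ^ 2)))"
      using bound[THEN spec, THEN spec, THEN mp, OF uv(1), THEN mp, OF uv(2), THEN mp, OF uv(3), THEN spec, THEN mp, OF uv(4)]
      by (simp only:)
  qed
qed

end
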